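(* Let $d\ge 2$ be an integer, let $t_d^*$ be the unique root in $(0,1)$ of the equation $(d+1)(1-t)+(1+dt)\ln t=0$, and let $c_d^*:=\dfrac{-\ln t_d^*}{(1-t_d^* )^d}$. For $c>c_d^*$, let $t_c$ be the smallest positive root of $t=e^{-c(1-t)^d}$. Let $Y\sim Y_d\left(n,\frac cn\right)$. Then, asymptotically almost surely, $$\dim H_d(Y;\mathbb{R})=\binom{n}{d}(1+o(1))\left(ct_c(1-t_c)^d+\frac{c}{d+1}(1-t_c)^{d+1}-(1-t_c)\right).$$
   Context: $Y_d(n,p)$ is the probability space of random $d$-dimensional simplicial complexes on $n$ vertices with full $(d-1)$-dimensional skeleton (all vertex subsets of size at most $d$ are faces), in which each of the $\binom{n}{d+1}$ possible $d$-faces (vertex sets of size $d+1$) is included independently with probability $p$. For a $d$-complex $Y$, $H_d(Y;\mathbb{R})=\ker\partial_d(Y)$, where $\partial_d(Y)$ is the real simplicial boundary operator from $d$-chains to $(d-1)$-chains. Asymptotically almost surely means with probability tending to $1$ as $n\to\infty$, with $d,c$ fixed; the asserted asymptotics mean that for every $\varepsilon>0$, with probability tending to $1$, $\dim H_d(Y;\mathbb{R})$ lies between $(1-\varepsilon)$ and $(1+\varepsilon)$ times $\binom nd\left(ct_c(1-t_c)^d+\frac{c}{d+1}(1-t_c)^{d+1}-(1-t_c)\right)$. Logarithms are natural. *)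

theory Defs
  imports "HOL-Probability.Probability" "HOL-Analysis.Finite_Function_Topology"
begin

section \<open>Simplicial homology in the top dimension\<close>

text \<open>
  A simplicial complex on an ordered vertex type is given by its set of faces, each face being a
  finite vertex set. Real chains are finitely supported functions on vertex sets.
\<close>

definition faces :: "nat \<Rightarrow> 'a set set \<Rightarrow> 'a set set" where
  "faces k Y = {\<sigma> \<in> Y. card \<sigma> = k + 1}"

definition chains :: "nat \<Rightarrow> 'a set set \<Rightarrow> ('a set \<Rightarrow>\<^sub>0 real) set" where
  "chains k Y = {f. Poly_Mapping.keys f \<subseteq> faces k Y}"

text \<open>
  The face \<open>{v\<^sub>0 < \<dots> < v\<^sub>k}\<close> is sent to the alternating sum of the faces with \<open>v\<^sub>i\<close> deleted; the
  index \<open>i\<close> is the number of vertices of the face below \<open>v\<^sub>i\<close>.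
\<close>

definition boundary_face :: "'a::linorder set \<Rightarrow> ('a set \<Rightarrow>\<^sub>0 real)" where
  "boundary_face \<sigma> = (\<Sum>v\<in>\<sigma>. Poly_Mapping.single (\<sigma> - {v}) ((-1) ^ card {u \<in> \<sigma>. u < v}))"

definition boundary :: "('a::linorder set \<Rightarrow>\<^sub>0 real) \<Rightarrow> ('a set \<Rightarrow>\<^sub>0 real)" where
  "boundary f = (\<Sum>\<sigma>\<in>Poly_Mapping.keys f. Poly_Mapping.lookup f \<sigma> *\<^sub>R boundary_face \<sigma>)"

text \<open>
  For a complex of dimension \<open>d\<close> there are no \<open>(d + 1)\<close>-chains, so its \<open>d\<close>-th homology is the
  kernel of the boundary operator on \<open>d\<close>-chains.
\<close>

definition top_homology :: "nat \<Rightarrow> 'a::linorder set set \<Rightarrow> ('a set \<Rightarrow>\<^sub>0 real) set" where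
  "top_homology d Y = {f \<in> chains d Y. boundary f = 0}"

lemma subspace_top_homology: "subspace (top_homology d Y)"
proof -
  have lk: "Poly_Mapping.lookup (r *\<^sub>R f) \<sigma> = r * Poly_Mapping.lookup f \<sigma>"
    for r and f :: "'a set \<Rightarrow>\<^sub>0 real" and \<sigma>
  proof -
    have "finite {\<tau>. r *\<^sub>R Poly_Mapping.lookup f \<tau> \<noteq> 0}"
      by (rule finite_subset[OF _ finite_keys[of f]]) (auto simp: in_keys_iff)
    then show ?thesis
      by (simp add: scaleR_poly_mapping_def lookup_Abs_poly_mapping)
  qed
  have sup: "boundary f = (\<Sum>\<sigma>\<in>S. Poly_Mapping.lookup f \<sigma> *\<^sub>R boundary_face \<sigma>)"
    if "finite S" "Poly_Mapping.keys f \<subseteq> S" for f :: "'a set \<Rightarrow>\<^sub>0 real" and S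
    unfolding boundary_def using that
    by (intro sum.mono_neutral_left) (auto simp: in_keys_iff)
  have add: "boundary (f + g) = boundary f + boundary g" for f g :: "'a set \<Rightarrow>\<^sub>0 real"
  proof -
    let ?S = "Poly_Mapping.keys f \<union> Poly_Mapping.keys g"
    have "Poly_Mapping.keys (f + g) \<subseteq> ?S"
      by (rule Poly_Mapping.keys_add)
    then show ?thesis
      by (simp add: sup[of ?S] lookup_add scaleR_add_left sum.distrib)
  qed
  have scale: "boundary (r *\<^sub>R f) = r *\<^sub>R boundary f" for r and f :: "'a set \<Rightarrow>\<^sub>0 real"
  proof -
    have "Poly_Mapping.keys (r *\<^sub>R f) \<subseteq> Poly_Mapping.keys f"
      by (auto simp: in_keys_iff lk)
    then show ?thesis
      by (simp add: lk sup[of "Poly_Mapping.keys f"] scaleR_sum_right)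
  qed
  show ?thesis
    unfolding subspace_def top_homology_def chains_def
  proof (intro conjI ballI allI)
    show "0 \<in> {f \<in> {f. Poly_Mapping.keys f \<subseteq> faces d Y}. boundary f = 0}"
      by (simp add: boundary_def)
  next
    fix f g assume "f \<in> {f \<in> {f. Poly_Mapping.keys f \<subseteq> faces d Y}. boundary f = 0}"
      "g \<in> {f \<in> {f. Poly_Mapping.keys f \<subseteq> faces d Y}. boundary f = 0}"
    then show "f + g \<in> {f \<in> {f. Poly_Mapping.keys f \<subseteq> faces d Y}. boundary f = 0}"
      using Poly_Mapping.keys_add[of f g] by (auto simp: add)
  next
    fix r :: real and f assume "f \<in> {f \<in> {f. Poly_Mapping.keys f \<subseteq> faces d Y}. boundary f = 0}"
    then show "r *\<^sub>R f \<in> {f \<in> {f. Poly_Mapping.keys f \<subseteq> faces d Y}. boundary f = 0}"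
      by (auto simp: scale lk in_keys_iff)
  qed
qed


section \<open>Random complexes\<close>

text \<open>
  \<open>random_complex d n p\<close> is the distribution of \<open>Y\<^sub>d(n, p)\<close> on the vertex set \<open>{0, \<dots>, n - 1}\<close>.
  The success probability of \<^const>\<open>bernoulli_pmf\<close> is clamped to \<open>[0, 1]\<close>, so the
  value for \<open>p\<close> outside this interval is meaningless.
\<close>

definition random_complex :: "nat \<Rightarrow> nat \<Rightarrow> real \<Rightarrow> nat set set pmf" where
  "random_complex d n p =
     map_pmf (\<lambda>X. {\<sigma>. \<sigma> \<subseteq> {..<n} \<and> card \<sigma> \<le> d} \<union> {\<sigma>. \<sigma> \<subseteq> {..<n} \<and> card \<sigma> = d + 1 \<and> X \<sigma>})
       (Pi_pmf {\<sigma>. \<sigma> \<subseteq> {..<n} \<and> card \<sigma> = d + 1} False (\<lambda>_. bernoulli_pmf p))"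


section \<open>The threshold\<close>

definition t_star :: "nat \<Rightarrow> real" where
  "t_star d = (THE t. 0 < t \<and> t < 1 \<and> (real d + 1) * (1 - t) + (1 + real d * t) * ln t = 0)"

definition c_star :: "nat \<Rightarrow> real" where
  "c_star d = - ln (t_star d) / (1 - t_star d) ^ d"

definition t_root :: "nat \<Rightarrow> real \<Rightarrow> real" where
  "t_root d c = (LEAST t. 0 < t \<and> t = exp (- c * (1 - t) ^ d))"

lemma t_star_ex1:
  assumes "d \<ge> 2"
  shows "\<exists>!t::real. 0 < t \<and> t < 1 \<and> (real d + 1) * (1 - t) + (1 + real d * t) * ln t = 0"
proof -
  define D where "D = real d"
  have D: "D \<ge> 2" using assms by (simp add: D_def)
  define g where "g = (\<lambda>t. (D + 1) * (1 - t) / (1 + D * t) + ln t)"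
  define b where "b = 1 / D^2"
  have "D^2 > 1" using D by (intro one_less_power) auto
  then have b: "0 < b" "b < 1" by (auto simp: b_def divide_less_eq)
  have pos: "1 + D * t > 0" if "t > 0" for t
    using that D by (simp add: add_pos_pos)
  have iff: "(D + 1) * (1 - t) + (1 + D * t) * ln t = 0 \<longleftrightarrow> g t = 0" if "t > 0" for t
    using pos[OF that] by (simp add: g_def field_simps)
  have der: "(g has_real_derivative ((1 - t) * (1 - D^2 * t) / (t * (1 + D * t)^2))) (at t)"
    if t: "t > 0" for t
  proof -
    have "(g has_real_derivative
        ((- (D + 1) * (1 + D * t) - (D + 1) * (1 - t) * D) / ((1 + D * t) * (1 + D * t)) + 1 / t)) (at t)"
      unfolding g_def using pos[OF t] t
      by (auto intro!: derivative_eq_intros simp: algebra_simps)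
    moreover have "(- (D + 1) * (1 + D * t) - (D + 1) * (1 - t) * D) / ((1 + D * t) * (1 + D * t)) + 1 / t
        = (1 - t) * (1 - D^2 * t) / (t * (1 + D * t)^2)"
      using pos[OF t] t by (simp add: add_frac_eq power2_eq_square) (simp add: field_simps)
    ultimately show ?thesis by simp
  qed
  have inc: "g x < g y" if "0 < x" "x < y" "y \<le> b" for x y
  proof (rule DERIV_pos_imp_increasing_open[OF that(2)])
    fix t assume t: "x < t" "t < y"
    then have "0 < t" "t < 1" "t < b" using that b by auto
    then have "D^2 * t < 1" using D by (simp add: b_def field_simps)
    with \<open>0 < t\<close> \<open>t < 1\<close> pos[of t] have "(1 - t) * (1 - D^2 * t) / (t * (1 + D * t)^2) > 0" by simp
    then show "\<exists>z. (g has_real_derivative z) (at t) \<and> 0 < z" using der \<open>0 < t\<close> by blast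
  next
    show "continuous_on {x..y} g"
      using that by (intro continuous_at_imp_continuous_on ballI) (auto intro!: DERIV_isCont der)
  qed
  have gpos: "g x > 0" if "b \<le> x" "x < 1" for x
  proof -
    have "g x > g 1"
    proof (rule DERIV_neg_imp_decreasing_open[OF that(2)])
      fix t assume t: "x < t" "t < 1"
      then have "0 < t" "t > b" using that b by auto
      then have "D^2 * t > 1" using D by (simp add: b_def field_simps)
      with \<open>0 < t\<close> t pos[of t] have "(1 - t) * (1 - D^2 * t) / (t * (1 + D * t)^2) < 0"
        by (intro divide_neg_pos mult_pos_neg) auto
      then show "\<exists>z. (g has_real_derivative z) (at t) \<and> z < 0" using der \<open>0 < t\<close> by blast
    next
      show "continuous_on {x..1} g"
        using that b by (intro continuous_at_imp_continuous_on ballI) (auto intro!: DERIV_isCont der)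
    qed
    then show ?thesis by (simp add: g_def)
  qed
  define a where "a = exp (- (D + 1))"
  have a: "0 < a" "a < 1" using D by (auto simp: a_def)
  have "(D + 1) * (1 - a) < (D + 1) * (1 + D * a)"
  proof (rule mult_strict_left_mono)
    have "0 < D * a" using D a by simp
    then show "1 - a < 1 + D * a" using a by linarith
  qed (use D in simp)
  then have "(D + 1) * (1 - a) / (1 + D * a) < D + 1"
    using pos[OF a(1)] by (simp add: divide_less_eq)
  then have ga: "g a < 0"
    by (simp add: g_def a_def)
  have "a < b" using gpos[of a] ga a by force
  have "\<exists>t\<ge>a. t \<le> b \<and> g t = 0"
    using \<open>a < b\<close> ga gpos[of b] b a
    by (intro IVT') (auto intro!: continuous_at_imp_continuous_on DERIV_isCont der)
  then obtain t where t: "a \<le> t" "t \<le> b" "g t = 0" by blast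
  show ?thesis
    unfolding D_def[symmetric]
  proof (rule ex1I[of _ t])
    show "0 < t \<and> t < 1 \<and> (D + 1) * (1 - t) + (1 + D * t) * ln t = 0"
      using t a b iff[of t] by auto
  next
    fix s assume s: "0 < s \<and> s < 1 \<and> (D + 1) * (1 - s) + (1 + D * s) * ln s = 0"
    then have gs: "g s = 0" using iff by blast
    then have "s < b" using gpos[of s] s by force
    then show "s = t"
      using inc[of s t] inc[of t s] gs t s a by (cases s t rule: linorder_cases) auto
  qed
qed

lemma t_root_least:
  assumes "d \<ge> 1"
  shows "0 < t_root d c" "t_root d c = exp (- c * (1 - t_root d c) ^ d)"
    and "\<And>s. 0 < s \<Longrightarrow> s = exp (- c * (1 - s) ^ d) \<Longrightarrow> t_root d c \<le> s"
proof -
  define S where "S = {0..1} \<inter> {t::real. t = exp (- c * (1 - t) ^ d)}"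
  define P where "P = (\<lambda>t::real. 0 < t \<and> t = exp (- c * (1 - t) ^ d))"
  have "closed {t::real. t = exp (- c * (1 - t) ^ d)}"
    by (intro closed_Collect_eq continuous_intros)
  then have "compact S" by (auto simp: S_def intro: compact_Int_closed)
  obtain m where m: "0 < m" "m = exp (- c * (1 - m) ^ d)" "\<And>s. P s \<Longrightarrow> m \<le> s"
  proof -
    have "1 \<in> S" using assms by (simp add: S_def)
    then obtain m where mS: "m \<in> S" and le: "\<And>s. s \<in> S \<Longrightarrow> m \<le> s"
      using compact_attains_inf[OF \<open>compact S\<close>] by blast
    have e: "m = exp (- c * (1 - m) ^ d)" "m \<le> 1" using mS by (auto simp: S_def)
    have "m > 0" by (subst e(1)) simp
    moreover have "m \<le> s" if "P s" for s
      using that le[of s] e(2) by (cases "s \<le> 1") (auto simp: S_def P_def)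
    ultimately show ?thesis using that e by blast
  qed
  have "t_root d c = m"
    unfolding t_root_def by (rule Least_equality) (use m in \<open>auto simp: P_def\<close>)
  with m show "0 < t_root d c" "t_root d c = exp (- c * (1 - t_root d c) ^ d)"
    "\<And>s. 0 < s \<Longrightarrow> s = exp (- c * (1 - s) ^ d) \<Longrightarrow> t_root d c \<le> s"
    by (auto simp: P_def)
qed

end

theory Submission
  imports Defs
begin

text \<open>
  Let \<open>X\<close> be the random set of \<open>d\<close>-faces, and call the \<open>d\<close>-subsets of the vertex set cells. The homology in
  question is the space of cycles supported on \<open>X\<close>. Its dimension changes by at most \<open>1\<close> when one
  face is added, so its variance is at most the expected number of faces (\<open>variance_random_subset_le\<close>), which is
  of order \<open>n^d\<close>. As the asserted value is also of order \<open>n^d\<close> (\<open>excess_t_root_pos\<close>), Chebyshev's inequality reduces the theorem to the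
  asymptotics of the expectation. A lower and an upper bound are obtained by different arguments, and they agree
  above the threshold.

  Lower bound. If \<open>A\<close> is a set of cells, the faces all of whose facets lie in \<open>A\<close> have their boundaries in
  a space of dimension \<open>card A\<close>, so the dimension of the cycles is at least the number of these faces
  minus \<open>card A\<close> (\<open>dim_cycles_ge\<close>). For \<open>A\<close> one takes the cells that still lie in at least two faces after \<open>r\<close> rounds
  of collapsing, that is, of removing the faces with a facet that lies in no other face. The neighbourhood
  of a cell looks like a random tree in which each cell lies in a Poisson number of further faces, with mean \<open>c\<close>
  (\<open>local_limit\<close>). On this tree, as \<open>r\<close> grows, a cell loses all its faces with a probability that tends to
  \<open>t_c\<close>, and the difference of the two numbers, per cell, tends to the asserted density \<open>excess d c (t_root d c)\<close>.

  Upper bound. The rank of the boundary operator is at least the number of cells minus the sum over all cells \<open>e\<close>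
  of the squared distance from \<open>e\<close> to some chosen boundary (\<open>dim_cycles_le\<close>). Where the neighbourhood of \<open>e\<close> is
  a tree, the best choice supported on it can be computed from the branches, and its squared distance, the
  mass of \<open>e\<close>, satisfies the recursion \<open>h = 1 / (1 + (\<Sum>v. 1 / (\<Sum>u. h\<^sub>v\<^sub>u)))\<close> over the faces \<open>v\<close> through \<open>e\<close> and
  their other facets \<open>u\<close> (\<open>local_test_chain\<close>). On the Poisson tree the mean mass decreases with the depth.
  Let \<open>x\<close> be the probability that the limiting mass is positive. A Poisson size-bias identity and the
  exchangeability of the \<open>d + 1\<close> facets of a face bound the limiting mean by \<open>potential d c x\<close>
  (\<open>mean_mass_limit\<close>). For \<open>c > c_star d\<close> the largest value of the potential on \<open>[0, 1]\<close> is attained at \<open>t_c\<close>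
  (\<open>potential_le\<close>), and together with the expected number of faces it gives \<open>excess d c (t_root d c)\<close> again.
\<close>

section \<open>The variational formula for the density\<close>

text \<open>
  In the local limit of the random complex a \<open>(d - 1)\<close>-cell keeps no face under collapsing with
  probability \<open>t\<close>, a root of \<open>t = exp (- c (1 - t)^d)\<close>. The value \<open>excess d c t\<close> is the number of faces
  minus the number of \<open>(d - 1)\<close>-cells of the core, per \<open>(d - 1)\<close>-cell of the whole complex.
\<close>

definition excess :: "nat \<Rightarrow> real \<Rightarrow> real \<Rightarrow> real" where
  "excess d c t = c * t * (1 - t) ^ d + c / (real d + 1) * (1 - t) ^ (d + 1) - (1 - t)"

text \<open>
  The mean squared distance from a basis chain to the image of the boundary operator is bounded by the value
  of this function at the limiting probability \<open>x\<close> of a positive mass. Its critical points in \<open>[0, 1]\<close> are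
  the roots of \<open>x = exp (- c (1 - x)^d)\<close>, and its value there is \<open>excess\<close> up to a constant.
\<close>

definition potential :: "nat \<Rightarrow> real \<Rightarrow> real \<Rightarrow> real" where
  "potential d c x =
     exp (- c * (1 - x) ^ d) - c / (real d + 1) * (1 - (1 - x) ^ (d + 1)) + c * x * (1 - x) ^ d"

text \<open>
  At a root \<open>x < 1\<close> one has \<open>c = - ln x / (1 - x)^d\<close>; eliminating \<open>c\<close> from \<open>excess d c x\<close> leaves this
  function of \<open>x\<close> alone. Its only zero in \<open>(0, 1)\<close> is \<open>t_star d\<close>.
\<close>

definition root_excess :: "nat \<Rightarrow> real \<Rightarrow> real" where
  "root_excess d x = - (1 - x) - (1 + real d * x) * ln x / (real d + 1)"

lemma excess_at_root:
  assumes "0 < x" "x = exp (- c * (1 - x) ^ d)"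
  shows "excess d c x = root_excess d x"
proof -
  have l: "ln x = - c * (1 - x) ^ d"
    using arg_cong[OF assms(2), of ln] by (simp only: ln_exp)
  have "c * x * (1 - x) ^ d = - x * ln x" by (simp add: l)
  moreover have "c / (real d + 1) * (1 - x) ^ (d + 1) = - (1 - x) * ln x / (real d + 1)"
  proof -
    have "- (1 - x) * ln x = c * (1 - x) ^ (d + 1)" unfolding l by (simp add: algebra_simps)
    then show ?thesis by simp
  qed
  moreover have "- x * ln x + - (1 - x) * ln x / (real d + 1) = - ((1 + real d * x) * ln x / (real d + 1))"
    by (simp add: field_simps)
  ultimately show ?thesis
    unfolding excess_def root_excess_def by linarith
qed

lemma potential_at_root:
  assumes "x = exp (- c * (1 - x) ^ d)"
  shows "potential d c x = 1 - c / (real d + 1) + excess d c x"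
proof -
  have "potential d c x = 1 - c / (real d + 1) + excess d c x + (exp (- c * (1 - x) ^ d) - x)"
    by (simp add: potential_def excess_def right_diff_distrib)
  also have "exp (- c * (1 - x) ^ d) - x = 0"
    by (rule right_minus_eq[THEN iffD2, OF assms[symmetric]])
  finally show ?thesis by (simp only: add_0_right)
qed

lemma root_excess_deriv:
  assumes "0 < x"
  shows "(root_excess d has_real_derivative (1 - real d * ln x - 1 / x) / (real d + 1)) (at x)"
proof -
  have "((\<lambda>x. - (1 - x) - (1 + real d * x) * ln x / m) has_real_derivative
      1 - (real d * ln x + (1 + real d * x) * (1 / x)) / m) (at x)" if "m > 0" for m
    using assms that
    by (auto intro!: derivative_eq_intros simp: add_divide_distrib)
  then have "(root_excess d has_real_derivative 1 - (real d * ln x + (1 + real d * x) * (1 / x)) / (real d + 1)) (at x)"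
    unfolding root_excess_def[abs_def] by simp
  moreover have "1 - (real d * ln x + (1 + real d * x) * (1 / x)) / (real d + 1)
      = ((real d + 1) - (real d * ln x + (1 + real d * x) * (1 / x))) / (real d + 1)"
    by (simp add: diff_divide_distrib)
  moreover have "(1 + real d * x) * (1 / x) = 1 / x + real d"
    using assms by (simp add: field_simps)
  moreover have "(real d + 1) - (real d * ln x + (1 / x + real d)) = 1 - real d * ln x - 1 / x"
    by simp
  ultimately show ?thesis by (simp only:)
qed

text \<open>
  The function \<open>1 - d ln x - 1 / x\<close>, the derivative of \<open>root_excess\<close> up to the factor \<open>d + 1\<close>, increases up
  to \<open>1 / d\<close>, then decreases, and it vanishes at \<open>1\<close>. Hence on \<open>(0, 1)\<close> the function \<open>root_excess\<close> never
  decreases again after it has increased.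
\<close>

lemma slope_pos_mono:
  assumes d: "d \<ge> 1" and yz: "0 < y" "y \<le> z" "z < 1"
    and pos: "1 - real d * ln y - 1 / y > 0"
  shows "1 - real d * ln z - 1 / z > 0"
proof -
  define k where "k = (\<lambda>x::real. 1 - real d * ln x - 1 / x)"
  have der: "(k has_real_derivative (1 - real d * x) / x^2) (at x)" if "0 < x" for x
  proof -
    have "(k has_real_derivative 0 - real d * (1 / x) - (0 * x - 1 * 1) / (x * x)) (at x)"
      unfolding k_def using that
      by (intro DERIV_diff DERIV_const DERIV_cmult DERIV_divide DERIV_ident DERIV_ln_divide) auto
    moreover have "0 - real d * (1 / x) - (0 * x - 1 * 1) / (x * x) = (1 - real d * x) / x^2"
      using that by (simp add: power2_eq_square field_simps)
    ultimately show ?thesis by (simp only:)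
  qed
  show ?thesis
  proof (cases "z \<le> 1 / real d")
    case True
    have "k y \<le> k z"
    proof (rule DERIV_nonneg_imp_nondecreasing[OF yz(2)])
      fix x assume x: "y \<le> x" "x \<le> z"
      have "real d * x \<le> real d * z" using x d by (intro mult_left_mono) auto
      moreover have "real d * z \<le> 1" using True d by (simp add: field_simps)
      ultimately have "real d * x \<le> 1" by linarith
      then show "\<exists>w. (k has_real_derivative w) (at x) \<and> 0 \<le> w"
        using der[of x] x yz by (intro exI[of _ "(1 - real d * x) / x^2"]) auto
    qed
    then show ?thesis using pos by (simp add: k_def)
  next
    case False
    have "k 1 < k z"
    proof (rule DERIV_neg_imp_decreasing[OF yz(3)])
      fix x assume x: "z \<le> x" "x \<le> 1"
      have "1 < real d * z" using False d by (simp add: field_simps)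
      moreover have "real d * z \<le> real d * x" using x by (intro mult_left_mono) auto
      ultimately have "1 < real d * x" by linarith
      then show "\<exists>w. (k has_real_derivative w) (at x) \<and> w < 0"
        using der[of x] x yz by (intro exI[of _ "(1 - real d * x) / x^2"]) (auto simp: divide_neg_pos)
    qed
    then show ?thesis by (simp add: k_def)
  qed
qed

lemma t_star_props:
  assumes "d \<ge> 2"
  shows "0 < t_star d" "t_star d < 1" "root_excess d (t_star d) = 0"
    and "\<And>t. 0 < t \<Longrightarrow> t < 1 \<Longrightarrow> root_excess d t = 0 \<Longrightarrow> t = t_star d"
proof -
  let ?P = "\<lambda>t::real. 0 < t \<and> t < 1 \<and> (real d + 1) * (1 - t) + (1 + real d * t) * ln t = 0"
  have eq: "root_excess d t = - ((real d + 1) * (1 - t) + (1 + real d * t) * ln t) / (real d + 1)" for t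
    by (simp add: root_excess_def field_simps)
  have iff: "root_excess d t = 0 \<longleftrightarrow> (real d + 1) * (1 - t) + (1 + real d * t) * ln t = 0" for t
    unfolding eq by (simp add: add_eq_0_iff) linarith
  have "?P (t_star d)"
    unfolding t_star_def by (rule theI'[OF t_star_ex1[OF assms]])
  then show "0 < t_star d" "t_star d < 1" "root_excess d (t_star d) = 0"
    using iff by auto
  show "t = t_star d" if "0 < t" "t < 1" "root_excess d t = 0" for t
    using t_star_ex1[OF assms] \<open>?P (t_star d)\<close> that iff by blast
qed

lemma c_star_pos: "d \<ge> 2 \<Longrightarrow> c_star d > 0"
  using t_star_props(1,2)[of d] by (simp add: c_star_def divide_neg_pos)

text \<open>
  Where the derivative is positive it stays positive, so the function climbs to its value \<open>0\<close> at \<open>1\<close>.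
\<close>

lemma root_excess_neg_where_increasing:
  assumes d: "d \<ge> 1" and x: "0 < x" "x \<le> y" "y < 1" and slope: "1 - real d * ln x - 1 / x > 0"
  shows "root_excess d y < 0"
proof -
  have "root_excess d y < root_excess d 1"
  proof (rule DERIV_pos_imp_increasing_open[OF x(3)])
    fix w assume w: "y < w" "w < 1"
    then have "1 - real d * ln w - 1 / w > 0" using slope_pos_mono[OF d x(1) _ _ slope, of w] x by auto
    then show "\<exists>v. (root_excess d has_real_derivative v) (at w) \<and> 0 < v"
      using root_excess_deriv[of w d] w x
      by (intro exI[of _ "(1 - real d * ln w - 1 / w) / (real d + 1)"]) auto
  next
    show "continuous_on {y..1} (root_excess d)"
      using x by (intro continuous_at_imp_continuous_on ballI)
        (auto intro!: DERIV_isCont[OF root_excess_deriv])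
  qed
  then show ?thesis by (simp add: root_excess_def)
qed

lemma root_excess_antimono:
  assumes d: "d \<ge> 1" and xy: "0 < x" "x \<le> y" and slope: "1 - real d * ln y - 1 / y \<le> 0" "y < 1"
  shows "root_excess d y \<le> root_excess d x"
proof (rule DERIV_nonpos_imp_nonincreasing[OF xy(2)])
  fix z assume z: "x \<le> z" "z \<le> y"
  have "1 - real d * ln z - 1 / z \<le> 0"
    using slope_pos_mono[OF d, of z y] z xy slope by force
  then show "\<exists>w. (root_excess d has_real_derivative w) (at z) \<and> w \<le> 0"
    using root_excess_deriv[of z d] z xy
    by (intro exI[of _ "(1 - real d * ln z - 1 / z) / (real d + 1)"]) (auto simp: divide_nonpos_pos)
qed

lemma root_excess_antimono_below_t_star:
  assumes d: "d \<ge> 2" and xy: "0 < x" "x \<le> y" "y \<le> t_star d"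
  shows "root_excess d y \<le> root_excess d x"
proof (rule root_excess_antimono)
  note ts = t_star_props(1-3)[OF d]
  show "y < 1" using xy ts by simp
  show "1 - real d * ln y - 1 / y \<le> 0"
    using root_excess_neg_where_increasing[of d y "t_star d"] d xy ts by force
qed (use d xy in auto)

lemma root_excess_nonpos:
  assumes d: "d \<ge> 2" and x: "t_star d \<le> x" "x < 1"
  shows "root_excess d x \<le> 0"
proof (cases "1 - real d * ln x - 1 / x > 0")
  case True
  then show ?thesis
    using root_excess_neg_where_increasing[of d x x] d x t_star_props(1)[OF d] by simp
next
  case False
  then show ?thesis
    using root_excess_antimono[of d "t_star d" x] d x t_star_props(1,3)[OF d] by simp
qed

text \<open>
  The inequality \<open>c > c_star d\<close> says that \<open>exp (- c (1 - t)^d)\<close> lies below \<open>t\<close> at \<open>t = t_star d\<close>, while it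
  lies above \<open>t\<close> at \<open>0\<close>.
\<close>

lemma t_root_below_t_star:
  assumes d: "d \<ge> 2" and c: "c > c_star d"
  shows "t_root d c < t_star d"
proof -
  note ts = t_star_props(1-3)[OF d]
  have "c > 0" using c_star_pos[OF d] c by simp
  define g where "g = (\<lambda>t::real. exp (- c * (1 - t) ^ d) - t)"
  have "g 0 > 0" by (simp add: g_def)
  have "- ln (t_star d) = c_star d * (1 - t_star d) ^ d"
    using ts by (simp add: c_star_def)
  then have "- ln (t_star d) < c * (1 - t_star d) ^ d"
    using c ts by simp
  then have "- c * (1 - t_star d) ^ d < ln (t_star d)" by simp
  then have "exp (- c * (1 - t_star d) ^ d) < exp (ln (t_star d))"
    by (rule exp_less_mono)
  then have "exp (- c * (1 - t_star d) ^ d) < t_star d"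
    using ts(1) by simp
  then have g1: "g (t_star d) < 0" by (simp add: g_def)
  have "\<exists>t\<ge>0. t \<le> t_star d \<and> g t = 0"
    by (rule IVT2') (use ts g1 \<open>g 0 > 0\<close> in \<open>auto simp: g_def intro!: continuous_intros\<close>)
  then obtain t where t: "0 \<le> t" "t \<le> t_star d" "g t = 0" by blast
  have "t \<noteq> 0" "t \<noteq> t_star d" using t g1 \<open>g 0 > 0\<close> by auto
  then have "t_root d c \<le> t"
    using t_root_least(3)[of d t c] t d unfolding g_def by simp
  then show ?thesis using t \<open>t \<noteq> t_star d\<close> by simp
qed

lemma excess_t_root_pos:
  assumes d: "d \<ge> 2" and c: "c > c_star d"
  shows "excess d c (t_root d c) > 0"
proof -
  note ts = t_star_props(1-3)[OF d]
  have d1: "1 \<le> d" using d by simp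
  note tr = t_root_least[OF d1, where c = c]
  have lt: "t_root d c < t_star d" by (rule t_root_below_t_star[OF assms])
  have eq: "excess d c (t_root d c) = root_excess d (t_root d c)"
    by (rule excess_at_root[OF tr(1,2)])
  have "root_excess d (t_star d) \<le> root_excess d (t_root d c)"
    using root_excess_antimono_below_t_star[OF d, of "t_root d c" "t_star d"] lt tr(1) d by auto
  moreover have "root_excess d (t_root d c) \<noteq> 0"
    using t_star_props(4)[OF d, of "t_root d c"] lt ts tr(1) by auto
  ultimately show ?thesis using ts eq by simp
qed

lemma potential_deriv:
  assumes "d \<ge> 1"
  shows "(potential d c has_real_derivative
     c * real d * (1 - x) ^ (d - 1) * (exp (- c * (1 - x) ^ d) - x)) (at x)"
proof -
  obtain k where k: "d = Suc k" using assms by (cases d) auto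
  have "(potential d c has_real_derivative
     exp (- c * (1 - x) ^ d) * (c * (real d * (1 - x) ^ k)) - c / (real d + 1) * ((real d + 1) * (1 - x) ^ d)
      + (c * (1 - x) ^ d - c * x * (real d * (1 - x) ^ k))) (at x)"
  proof -
    have p: "((\<lambda>x. (1 - x) ^ Suc j) has_real_derivative - (real (Suc j) * (1 - x) ^ j)) (at x)" for j
      by (rule derivative_eq_intros refl)+ simp
    have 1: "((\<lambda>x. - c * (1 - x) ^ d) has_real_derivative - c * - (real d * (1 - x) ^ k)) (at x)"
      using DERIV_cmult[OF p[of k], of "- c"] by (simp add: k)
    have 2: "((\<lambda>x. exp (- c * (1 - x) ^ d)) has_real_derivative
        exp (- c * (1 - x) ^ d) * (- c * - (real d * (1 - x) ^ k))) (at x)"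
      by (rule DERIV_fun_exp[OF 1])
    have 3: "((\<lambda>x. c / (real d + 1) * (1 - (1 - x) ^ (d + 1))) has_real_derivative
        c / (real d + 1) * (0 - - (real (Suc d) * (1 - x) ^ d))) (at x)"
      using DERIV_cmult[OF DERIV_diff[OF DERIV_const p[of d]], of "c / (real d + 1)"] by simp
    have 4: "((\<lambda>x. c * x * (1 - x) ^ d) has_real_derivative
        c * (1 - x) ^ d + - (real d * (1 - x) ^ k) * (c * x)) (at x)"
      using DERIV_mult[OF DERIV_cmult[OF DERIV_ident, of c] p[of k]] by (simp add: k)
    show ?thesis
      unfolding potential_def
      by (rule DERIV_cong[OF DERIV_add[OF DERIV_diff[OF 2 3] 4]]) (simp add: algebra_simps)
  qed
  moreover have "exp (- c * (1 - x) ^ d) * (c * (real d * (1 - x) ^ k)) - c / (real d + 1) * ((real d + 1) * (1 - x) ^ d)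
      + (c * (1 - x) ^ d - c * x * (real d * (1 - x) ^ k)) = c * real d * (1 - x) ^ (d - 1) * (exp (- c * (1 - x) ^ d) - x)"
  proof -
    have "c / (real d + 1) * ((real d + 1) * (1 - x) ^ d) = c * (1 - x) ^ d"
      by (simp add: add_nonneg_eq_0_iff)
    then show ?thesis by (simp add: k algebra_simps)
  qed
  ultimately show ?thesis by simp
qed

text \<open>
  A maximum over \<open>[0, 1]\<close> is attained at a root of \<open>x = exp (- c (1 - x)^d)\<close>, so by elimination of \<open>c\<close> it
  is governed by \<open>root_excess\<close>. Among the roots below \<open>t_star d\<close> the smallest one wins by monotonicity,
  and at the other roots the excess is not positive. The threshold enters here: for \<open>c > c_star d\<close> the
  smallest root lies below \<open>t_star d\<close> and has positive excess.
\<close>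

lemma potential_le:
  assumes d: "d \<ge> 2" and c: "c > c_star d" and x: "0 \<le> x" "x \<le> 1"
  shows "potential d c x \<le> 1 - c / (real d + 1) + excess d c (t_root d c)"
proof -
  note ts = t_star_props(1-3)[OF d]
  have d1: "1 \<le> d" using d by simp
  note tr = t_root_least[OF d1, where c = c]
  have "c > 0" using c_star_pos[OF d] c by simp
  have cont: "continuous_on {0..1} (potential d c)"
    unfolding potential_def by (intro continuous_intros)
  obtain m where m: "m \<in> {0..1}" and max: "\<And>y. y \<in> {0..1} \<Longrightarrow> potential d c y \<le> potential d c m"
    using continuous_attains_sup[OF _ _ cont] by auto
  have der: "(potential d c has_real_derivative
     c * real d * (1 - y) ^ (d - 1) * (exp (- c * (1 - y) ^ d) - y)) (at y)" for y
    using potential_deriv[of d c y] d by simp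
  \<comment> \<open>The derivative is positive at \<open>0\<close>.\<close>
  have "m \<noteq> 0"
  proof
    assume "m = 0"
    have "c * real d * (1 - 0) ^ (d - 1) * (exp (- c * (1 - 0) ^ d) - 0) > 0"
      using \<open>c > 0\<close> d by simp
    from DERIV_pos_inc_right[OF der this] obtain e where "e > 0"
      "\<And>h. 0 < h \<Longrightarrow> h < e \<Longrightarrow> potential d c 0 < potential d c (0 + h)" by blast
    moreover from this(1) have "0 < min (e / 2) 1" "min (e / 2) 1 < e" by auto
    ultimately have "potential d c 0 < potential d c (0 + min (e / 2) 1)" by blast
    moreover have "0 + min (e / 2) 1 \<in> {0..1}" using \<open>e > 0\<close> by auto
    ultimately show False using max[of "0 + min (e / 2) 1"] \<open>m = 0\<close> by simp
  qed
  \<comment> \<open>The right end point \<open>1\<close> is itself a root.\<close>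
  have root: "m = exp (- c * (1 - m) ^ d)"
  proof (cases "m = 1")
    case True then show ?thesis using d by simp
  next
    case False
    then have m01: "0 < m" "m < 1" using m \<open>m \<noteq> 0\<close> by auto
    have "c * real d * (1 - m) ^ (d - 1) * (exp (- c * (1 - m) ^ d) - m) = 0"
    proof (rule DERIV_local_max[OF der[of m], of "min m (1 - m)"])
      show "0 < min m (1 - m)" using m01 by simp
      show "\<forall>y. \<bar>m - y\<bar> < min m (1 - m) \<longrightarrow> potential d c y \<le> potential d c m"
        using max by (auto simp: abs_if split: if_splits)
    qed
    then show ?thesis using \<open>c > 0\<close> d m01 by auto
  qed
  have "m > 0" using m \<open>m \<noteq> 0\<close> by auto
  \<comment> \<open>Compare with the smallest root on either side of \<open>t_star d\<close>.\<close>
  have "excess d c m \<le> excess d c (t_root d c)"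
  proof (cases "m < t_star d")
    case True
    have "t_root d c \<le> m" using tr(3)[OF \<open>m > 0\<close> root] by simp
    then have "root_excess d m \<le> root_excess d (t_root d c)"
      using root_excess_antimono_below_t_star[OF d, of "t_root d c" m] True tr(1) d by auto
    then show ?thesis
      using excess_at_root[OF \<open>m > 0\<close> root] excess_at_root[OF tr(1,2)] by simp
  next
    case False
    have "root_excess d m \<le> 0"
      using root_excess_nonpos[OF d, of m] False m by (cases "m = 1") (auto simp: root_excess_def)
    then show ?thesis
      using excess_at_root[OF \<open>m > 0\<close> root] excess_t_root_pos[OF d c] by simp
  qed
  then have "potential d c m \<le> 1 - c / (real d + 1) + excess d c (t_root d c)"
    using potential_at_root[OF root] by simp
  with max[of x] x show ?thesis by simp
qed

text \<open>
  The probability that the root of the Poisson tree loses all its faces within \<open>r\<close> rounds of collapsing.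
\<close>

primrec collapse_prob :: "nat \<Rightarrow> real \<Rightarrow> nat \<Rightarrow> real" where
  "collapse_prob d c 0 = 0"
| "collapse_prob d c (Suc r) = exp (- c * (1 - collapse_prob d c r) ^ d)"

lemma collapse_prob_tendsto:
  assumes d: "d \<ge> 1" and c: "c > 0"
  shows "collapse_prob d c \<longlonglongrightarrow> t_root d c"
proof -
  note tr = t_root_least[OF d, where c = c]
  have t1: "t_root d c \<le> 1"
    using c d by (intro tr(3)) (auto simp: power_0_left)
  have bd: "0 \<le> collapse_prob d c r \<and> collapse_prob d c r \<le> t_root d c" for r
  proof (induction r)
    case (Suc r)
    have "(1 - t_root d c) ^ d \<le> (1 - collapse_prob d c r) ^ d"
      using Suc t1 by (intro power_mono) auto
    then have "exp (- c * (1 - collapse_prob d c r) ^ d) \<le> exp (- c * (1 - t_root d c) ^ d)"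
      using c by simp
    also have "\<dots> = t_root d c" by (rule tr(2)[symmetric])
    finally show ?case by simp
  qed (use tr(1) in auto)
  have "incseq (collapse_prob d c)"
  proof (rule incseq_SucI)
    show "collapse_prob d c r \<le> collapse_prob d c (Suc r)" for r
    proof (induction r)
      case (Suc r)
      have "collapse_prob d c (Suc r) \<le> 1" using bd[of "Suc r"] t1 by linarith
      then have "(1 - collapse_prob d c (Suc r)) ^ d \<le> (1 - collapse_prob d c r) ^ d"
        using Suc by (intro power_mono) auto
      then have "- c * (1 - collapse_prob d c r) ^ d \<le> - c * (1 - collapse_prob d c (Suc r)) ^ d"
        using c by simp
      then show ?case
        unfolding collapse_prob.simps(2)[of d c "Suc r"]
        by (subst collapse_prob.simps(2)) (rule exp_le_cancel_iff[THEN iffD2])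
    qed simp
  qed
  then obtain L where L: "collapse_prob d c \<longlonglongrightarrow> L"
    by (rule incseq_convergent[where B = "t_root d c"]) (use bd in auto)
  have "(\<lambda>r. collapse_prob d c (Suc r)) \<longlonglongrightarrow> exp (- c * (1 - L) ^ d)"
    unfolding collapse_prob.simps by (intro tendsto_intros L)
  moreover have "(\<lambda>r. collapse_prob d c (Suc r)) \<longlonglongrightarrow> L"
    using L by (rule LIMSEQ_Suc)
  ultimately have eq: "L = exp (- c * (1 - L) ^ d)" by (rule LIMSEQ_unique[rotated])
  then have "L > 0" by (metis exp_gt_zero)
  then have "t_root d c \<le> L" using tr(3) eq by blast
  moreover have "L \<le> t_root d c" by (rule LIMSEQ_le_const2[OF L]) (use bd in auto)
  ultimately show ?thesis using L by simp
qed

section \<open>Expectations over discrete distributions\<close>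

abbreviation expect :: "'a pmf \<Rightarrow> ('a \<Rightarrow> real) \<Rightarrow> real" where
  "expect \<equiv> measure_pmf.expectation"

lemma integrable_pmf_bounded:
  fixes f :: "'a \<Rightarrow> real"
  assumes "\<And>x. x \<in> set_pmf p \<Longrightarrow> \<bar>f x\<bar> \<le> B"
  shows "integrable (measure_pmf p) f"
  using assms by (intro measure_pmf.integrable_const_bound[where B = B]) (auto simp: AE_measure_pmf_iff)

lemma expectation_cong:
  fixes f g :: "'a \<Rightarrow> real"
  assumes "\<And>x. x \<in> set_pmf p \<Longrightarrow> f x = g x"
  shows "expect p f = expect p g"
  using assms by (intro integral_cong_AE) (auto simp: AE_measure_pmf_iff)

lemma expectation_mono:
  fixes f g :: "'a \<Rightarrow> real"
  assumes "integrable (measure_pmf p) f" "integrable (measure_pmf p) g"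
    and "\<And>x. x \<in> set_pmf p \<Longrightarrow> f x \<le> g x"
  shows "expect p f \<le> expect p g"
  using assms by (intro integral_mono_AE) (auto simp: AE_measure_pmf_iff)

lemma expectation_abs_le:
  fixes f :: "'a \<Rightarrow> real"
  assumes "\<And>x. x \<in> set_pmf p \<Longrightarrow> \<bar>f x\<bar> \<le> B"
  shows "\<bar>expect p f\<bar> \<le> B"
proof -
  have i: "integrable (measure_pmf p) f" by (rule integrable_pmf_bounded[OF assms])
  have "expect p f \<le> expect p (\<lambda>_. B)"
    by (rule expectation_mono) (use i assms in \<open>auto simp: abs_le_iff\<close>)
  moreover have "expect p (\<lambda>_. - B) \<le> expect p f"
    by (rule expectation_mono) (use i assms in \<open>auto simp: abs_le_iff minus_le_iff\<close>)
  ultimately show ?thesis by (simp add: abs_le_iff)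
qed

lemma expectation_bind:
  fixes f :: "'b \<Rightarrow> real"
  assumes "\<And>y. y \<in> set_pmf (bind_pmf p q) \<Longrightarrow> \<bar>f y\<bar> \<le> B"
  shows "expect (bind_pmf p q) f
    = expect p (\<lambda>x. expect (q x) f)"
proof -
  define g where "g = (\<lambda>y. if y \<in> set_pmf (bind_pmf p q) then f y else 0)"
  have g: "\<bar>g y\<bar> \<le> max 0 B" for y using assms[of y] by (simp add: g_def le_max_iff_disj del: set_bind_pmf)
  have "expect (bind_pmf p q) f = expect (bind_pmf p q) g"
    by (rule expectation_cong) (simp add: g_def)
  also have "\<dots> = expect p (\<lambda>x. expect (q x) g)"
    unfolding measure_pmf_bind
    by (rule integral_bind[where K = "count_space UNIV" and B = "max 0 B" and B' = 1])
      (use g in \<open>auto intro: measure_pmf.finite_measure_axioms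
        simp: measure_pmf_in_subprob_algebra measure_pmf.emeasure_le_1\<close>)
  also have "\<dots> = expect p (\<lambda>x. expect (q x) f)"
    by (intro expectation_cong) (auto simp: g_def)
  finally show ?thesis .
qed

lemma expectation_pair:
  fixes f :: "'a \<times> 'b \<Rightarrow> real"
  assumes "\<And>x y. x \<in> set_pmf p \<Longrightarrow> y \<in> set_pmf q \<Longrightarrow> \<bar>f (x, y)\<bar> \<le> B"
  shows "expect (pair_pmf p q) f
    = expect p (\<lambda>x. expect q (\<lambda>y. f (x, y)))"
proof -
  have eq: "pair_pmf p q = bind_pmf p (\<lambda>x. map_pmf (Pair x) q)"
    by (simp add: pair_pmf_def map_pmf_def)
  show ?thesis
    unfolding eq by (subst expectation_bind[where B = B]) (use assms in auto)
qed

lemma expectation_replicate_Suc: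
  fixes f :: "'a list \<Rightarrow> real"
  assumes "\<And>xs. set xs \<subseteq> set_pmf p \<Longrightarrow> length xs = Suc n \<Longrightarrow> \<bar>f xs\<bar> \<le> B"
  shows "expect (replicate_pmf (Suc n) p) f
    = expect p (\<lambda>x. expect (replicate_pmf n p) (\<lambda>xs. f (x # xs)))"
proof -
  have eq: "replicate_pmf (Suc n) p = bind_pmf p (\<lambda>x. map_pmf ((#) x) (replicate_pmf n p))"
    by (simp add: map_pmf_def)
  show ?thesis
    unfolding eq
  proof (subst expectation_bind[where B = B])
    fix ys assume "ys \<in> set_pmf (bind_pmf p (\<lambda>x. map_pmf ((#) x) (replicate_pmf n p)))"
    then show "\<bar>f ys\<bar> \<le> B"
      unfolding eq[symmetric] using assms[of ys] by (auto simp: set_replicate_pmf subset_iff)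
  qed simp
qed


section \<open>Random subsets\<close>

definition random_subset :: "'a set \<Rightarrow> real \<Rightarrow> 'a set pmf" where
  "random_subset A p = map_pmf (\<lambda>X. {a \<in> A. X a}) (Pi_pmf A False (\<lambda>_. bernoulli_pmf p))"

lemma set_random_subset: "X \<in> set_pmf (random_subset A p) \<Longrightarrow> X \<subseteq> A"
  by (auto simp: random_subset_def)

lemma finite_set_random_subset: "finite A \<Longrightarrow> finite (set_pmf (random_subset A p))"
  by (rule finite_subset[of _ "Pow A"]) (auto dest: set_random_subset)

lemma integrable_random_subset [simp]:
  fixes f :: "'a set \<Rightarrow> real"
  shows "finite A \<Longrightarrow> integrable (measure_pmf (random_subset A p)) f"
  by (intro integrable_measure_pmf_finite finite_set_random_subset)

lemma random_subset_empty: "random_subset {} p = return_pmf {}"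
  by (simp add: random_subset_def)

lemma random_subset_insert:
  assumes "finite A" "a \<notin> A"
  shows "random_subset (insert a A) p
    = bind_pmf (bernoulli_pmf p) (\<lambda>b. map_pmf (\<lambda>X. if b then insert a X else X) (random_subset A p))"
proof -
  have *: "{x \<in> insert a A. (f(a := b)) x} = (if b then insert a {x \<in> A. f x} else {x \<in> A. f x})" for f b
    using assms by auto
  show ?thesis
    unfolding random_subset_def using assms
    by (subst Pi_pmf_insert')
      (auto simp: map_bind_pmf map_pmf_comp * map_pmf_def bind_assoc_pmf bind_return_pmf intro!: bind_pmf_cong)
qed

lemma expectation_random_subset_insert:
  fixes f :: "'a set \<Rightarrow> real"
  assumes "finite A" "a \<notin> A" "0 \<le> p" "p \<le> 1"
  shows "expect (random_subset (insert a A) p) f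
    = expect (random_subset A p) (\<lambda>X. p * f (insert a X) + (1 - p) * f X)"
proof -
  have "expect (random_subset (insert a A) p) f
      = expect (bernoulli_pmf p)
          (\<lambda>b. expect (random_subset A p) (\<lambda>X. f (if b then insert a X else X)))"
    unfolding random_subset_insert[OF assms(1,2)]
    by (subst pmf_expectation_bind[of UNIV])
      (use assms in \<open>auto simp: UNIV_bool finite_set_random_subset\<close>)
  also have "\<dots> = expect (random_subset A p) (\<lambda>X. p * f (insert a X) + (1 - p) * f X)"
    using assms by simp
  finally show ?thesis .
qed

lemma random_subset_union:
  assumes "finite A" "finite B" "A \<inter> B = {}"
  shows "random_subset (A \<union> B) p
    = map_pmf (\<lambda>(X, Y). X \<union> Y) (pair_pmf (random_subset A p) (random_subset B p))"
proof -
  show ?thesis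
    unfolding random_subset_def Pi_pmf_union[OF assms] map_pair[symmetric]
    using assms(3) by (auto simp: map_pmf_comp case_prod_unfold intro!: map_pmf_cong)
qed

text \<open>
  The parts of a random subset inside and outside \<open>B\<close> are independent; this form of independence draws
  the two parts from two copies of the whole random set.
\<close>

lemma expectation_decouple:
  fixes g :: "'a set \<Rightarrow> 'a set \<Rightarrow> real"
  assumes "finite A" "B \<subseteq> A"
  shows "expect (random_subset A p) (\<lambda>X. g (X \<inter> B) (X - B))
    = expect (random_subset A p) (\<lambda>Y.
        expect (random_subset A p) (\<lambda>X. g (Y \<inter> B) (X - B)))"
proof -
  have fin: "finite B" "finite (A - B)" using assms finite_subset by auto
  have split: "expect (random_subset A p) f
      = expect (random_subset B p) (\<lambda>Y.
          expect (random_subset (A - B) p) (\<lambda>Z. f (Y \<union> Z)))" for f :: "'a set \<Rightarrow> real"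
  proof -
    have "random_subset A p = random_subset (B \<union> (A - B)) p" using assms by (simp add: Un_absorb1)
    also have "\<dots> = map_pmf (\<lambda>(X, Y). X \<union> Y) (pair_pmf (random_subset B p) (random_subset (A - B) p))"
      using fin by (intro random_subset_union) auto
    finally have *: "random_subset A p = \<dots>" .
    let ?B = "Max ((\<lambda>X. \<bar>f X\<bar>) ` Pow A)"
    have "\<bar>f (X \<union> Y)\<bar> \<le> ?B" if "X \<in> set_pmf (random_subset B p)" "Y \<in> set_pmf (random_subset (A - B) p)" for X Y
      using set_random_subset[OF that(1)] set_random_subset[OF that(2)] assms by (intro Max_ge) auto
    then show ?thesis
      unfolding * by (simp add: expectation_pair[where B = ?B])
  qed
  have 1: "expect (random_subset B p) (\<lambda>Y.
          expect (random_subset (A - B) p) (\<lambda>Z. h ((Y \<union> Z) \<inter> B) ((Y \<union> Z) - B)))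
      = expect (random_subset B p) (\<lambda>Y.
          expect (random_subset (A - B) p) (\<lambda>Z. h Y Z))" for h :: "'a set \<Rightarrow> 'a set \<Rightarrow> real"
  proof (intro expectation_cong)
    fix Y Z assume "Y \<in> set_pmf (random_subset B p)" "Z \<in> set_pmf (random_subset (A - B) p)"
    then have "(Y \<union> Z) \<inter> B = Y" "(Y \<union> Z) - B = Z" by (auto dest!: set_random_subset)
    then show "h ((Y \<union> Z) \<inter> B) ((Y \<union> Z) - B) = h Y Z" by simp
  qed
  have 2: "expect (random_subset A p) (\<lambda>X. h (X \<inter> B) (X - B)) =
     expect (random_subset B p) (\<lambda>Y.
          expect (random_subset (A - B) p) (\<lambda>Z. h Y Z))" for h :: "'a set \<Rightarrow> 'a set \<Rightarrow> real"
    unfolding split 1 ..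
  have 3: "expect (random_subset A p) (\<lambda>X. g V (X - B))
     = expect (random_subset (A - B) p) (g V)" for V
    using 2[of "\<lambda>_. g V"] by simp
  have "expect (random_subset A p) (\<lambda>Y.
        expect (random_subset A p) (\<lambda>X. g (Y \<inter> B) (X - B)))
    = expect (random_subset B p) (\<lambda>Y. expect (random_subset (A - B) p) (g Y))"
    unfolding 3 using 2[of "\<lambda>V _. expect (random_subset (A - B) p) (g V)"] by simp
  then show ?thesis unfolding 2 by simp
qed

lemma prob_subset_random_subset:
  assumes "finite A" "S \<subseteq> A" "0 \<le> p" "p \<le> 1"
  shows "expect (random_subset A p) (\<lambda>X. of_bool (S \<subseteq> X)) = p ^ card S"
  using assms(1,2)
proof (induction A arbitrary: S rule: finite_induct)
  case empty
  then show ?case by (simp add: random_subset_empty)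
next
  case (insert a A)
  have eq: "expect (random_subset (insert a A) p) (\<lambda>X. of_bool (S \<subseteq> X))
    = expect (random_subset A p)
       (\<lambda>X. p * of_bool (S \<subseteq> insert a X) + (1 - p) * of_bool (S \<subseteq> X))"
    by (rule expectation_random_subset_insert) (use insert assms in auto)
  show ?case
  proof (cases "a \<in> S")
    case True
    have "expect (random_subset (insert a A) p) (\<lambda>X. of_bool (S \<subseteq> X))
        = expect (random_subset A p) (\<lambda>X. p * of_bool (S - {a} \<subseteq> X))"
      unfolding eq using True insert.hyps
      by (intro expectation_cong) (auto dest!: set_random_subset)
    also have "\<dots> = p * p ^ card (S - {a})"
      using insert by (subst integral_mult_right_zero, subst insert.IH) auto
    also have "\<dots> = p ^ card S"
      using card.remove[of S a] True finite_subset[OF insert.prems] insert.hyps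
      by (metis finite_insert power_Suc)
    finally show ?thesis .
  next
    case False
    have "expect (random_subset (insert a A) p) (\<lambda>X. of_bool (S \<subseteq> X))
        = expect (random_subset A p) (\<lambda>X. of_bool (S \<subseteq> X) :: real)"
      unfolding eq using False
      by (intro expectation_cong) (auto simp: of_bool_def)
    then show ?thesis using insert False by auto
  qed
qed

lemma expectation_subset_and_rest:
  fixes g :: "'a set \<Rightarrow> real"
  assumes "finite A" "B \<subseteq> A" "S \<subseteq> B" "0 \<le> p" "p \<le> 1"
  shows "expect (random_subset A p) (\<lambda>X. of_bool (S \<subseteq> X) * g (X - B))
    = p ^ card S * expect (random_subset A p) (\<lambda>X. g (X - B))"
proof -
  have "S \<subseteq> X \<longleftrightarrow> S \<subseteq> X \<inter> B" for X using assms by auto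
  then have "expect (random_subset A p) (\<lambda>X. of_bool (S \<subseteq> X) * g (X - B))
     = expect (random_subset A p) (\<lambda>Y.
        expect (random_subset A p) (\<lambda>X. of_bool (S \<subseteq> Y) * g (X - B)))"
    using expectation_decouple[OF assms(1,2), of p "\<lambda>Y Z. of_bool (S \<subseteq> Y) * g Z"] by simp
  then show ?thesis
    using prob_subset_random_subset[of A S p] assms by auto
qed

lemma card_random_subset:
  assumes "finite A" "0 \<le> p" "p \<le> 1"
  shows "map_pmf card (random_subset A p) = binomial_pmf (card A) p"
  unfolding random_subset_def map_pmf_comp
  by (rule binomial_pmf_altdef'[symmetric]) (use assms in auto)

lemma expectation_card_random_subset:
  assumes "finite A" "0 \<le> p" "p \<le> 1"
  shows "expect (random_subset A p) (\<lambda>X. real (card X)) = p * real (card A)"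
  using assms(1)
proof (induction A rule: finite_induct)
  case empty
  then show ?case by (simp add: random_subset_empty)
next
  case (insert a A)
  have "expect (random_subset (insert a A) p) (\<lambda>X. real (card X))
    = expect (random_subset A p) (\<lambda>X. p * real (card (insert a X)) + (1 - p) * real (card X))"
    by (rule expectation_random_subset_insert) (use insert assms in auto)
  also have "\<dots> = expect (random_subset A p) (\<lambda>X. p + real (card X))"
  proof (rule expectation_cong)
    fix X assume "X \<in> set_pmf (random_subset A p)"
    then have "X \<subseteq> A" by (rule set_random_subset)
    then have "card (insert a X) = Suc (card X)"
      using insert finite_subset by (intro card_insert_disjoint) auto
    then show "p * real (card (insert a X)) + (1 - p) * real (card X) = p + real (card X)"
      by (simp add: algebra_simps)
  qed
  also have "\<dots> = p + p * real (card A)" using insert by simp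
  finally show ?case using insert by (simp add: algebra_simps)
qed

text \<open>
  The Efron--Stein inequality. Averaging over the membership of one element \<open>a\<close> leaves a function of the
  same kind on \<open>A - {a}\<close> and removes at most \<open>p * (1 - p)\<close> of the variance.
\<close>

lemma variance_random_subset_le:
  fixes f :: "'a set \<Rightarrow> real"
  assumes "finite A" "0 \<le> p" "p \<le> 1"
    and "\<And>X a. X \<subseteq> A \<Longrightarrow> a \<in> A \<Longrightarrow> \<bar>f (insert a X) - f X\<bar> \<le> 1"
  shows "expect (random_subset A p)
     (\<lambda>X. (f X - expect (random_subset A p) f)\<^sup>2) \<le> p * real (card A)"
  using assms(1,4)
proof (induction A arbitrary: f rule: finite_induct)
  case empty
  then show ?case by (simp add: random_subset_empty)
next
  case (insert a A)
  define g where "g = (\<lambda>X. p * f (insert a X) + (1 - p) * f X)"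
  let ?E = "expect (random_subset A p)"
  let ?E' = "expect (random_subset (insert a A) p)"
  have mean: "?E' f = ?E g"
    unfolding g_def by (rule expectation_random_subset_insert) (use insert assms in auto)
  have "?E' (\<lambda>X. (f X - ?E' f)\<^sup>2)
      = ?E (\<lambda>X. p * (f (insert a X) - ?E g)\<^sup>2 + (1 - p) * (f X - ?E g)\<^sup>2)"
    unfolding mean by (rule expectation_random_subset_insert) (use insert assms in auto)
  also have "\<dots> \<le> ?E (\<lambda>X. (g X - ?E g)\<^sup>2 + p)"
  proof (rule expectation_mono)
    fix X assume "X \<in> set_pmf (random_subset A p)"
    then have "X \<subseteq> A" by (rule set_random_subset)
    then have "\<bar>f (insert a X) - f X\<bar> \<le> 1" using insert.prems by auto
    then have "(f (insert a X) - f X)\<^sup>2 \<le> 1" by (simp add: abs_square_le_1)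
    then have "p * (1 - p) * (f (insert a X) - f X)\<^sup>2 \<le> p * (1 - p) * 1"
      using assms by (intro mult_left_mono) auto
    also have "\<dots> \<le> p" using assms by (simp add: mult_left_le)
    finally have *: "p * (1 - p) * (f (insert a X) - f X)\<^sup>2 \<le> p" .
    have "p * (f (insert a X) - m)\<^sup>2 + (1 - p) * (f X - m)\<^sup>2
        = (g X - m)\<^sup>2 + p * (1 - p) * (f (insert a X) - f X)\<^sup>2" for m
      unfolding g_def by (simp add: power2_eq_square algebra_simps)
    with * show "p * (f (insert a X) - ?E g)\<^sup>2 + (1 - p) * (f X - ?E g)\<^sup>2 \<le> (g X - ?E g)\<^sup>2 + p"
      by simp
  qed (use insert in auto)
  also have "\<dots> = ?E (\<lambda>X. (g X - ?E g)\<^sup>2) + p" using insert by simp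
  also have "?E (\<lambda>X. (g X - ?E g)\<^sup>2) \<le> p * real (card A)"
  proof (rule insert.IH)
    fix X b assume X: "X \<subseteq> A" "b \<in> A"
    have "\<bar>f (insert b (insert a X)) - f (insert a X)\<bar> \<le> 1" "\<bar>f (insert b X) - f X\<bar> \<le> 1"
      using X insert.prems[of "insert a X" b] insert.prems[of X b] by auto
    then have "p * \<bar>f (insert b (insert a X)) - f (insert a X)\<bar> + (1 - p) * \<bar>f (insert b X) - f X\<bar>
        \<le> p * 1 + (1 - p) * 1"
      using assms by (intro add_mono mult_left_mono) auto
    moreover have "g (insert b X) - g X
        = p * (f (insert b (insert a X)) - f (insert a X)) + (1 - p) * (f (insert b X) - f X)"
      unfolding g_def by (simp add: insert_commute algebra_simps)
    moreover have "\<bar>p * u + (1 - p) * v\<bar> \<le> p * \<bar>u\<bar> + (1 - p) * \<bar>v\<bar>" for u v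
      using abs_triangle_ineq[of "p * u" "(1 - p) * v"] assms by (simp add: abs_mult)
    ultimately show "\<bar>g (insert b X) - g X\<bar> \<le> 1" by (smt (verit))
  qed
  finally show ?case using insert by (simp add: algebra_simps)
qed

section \<open>Exploring a complex from a cell\<close>

text \<open>
  Throughout, \<open>X\<close> is a set of faces with \<open>d + 1\<close> vertices and \<open>e\<close> is a cell with \<open>d\<close> vertices. The faces
  through \<open>e\<close> are \<open>insert v e\<close> for \<open>v\<close> in the link of \<open>e\<close>, and the other facets of such a face are
  \<open>flip e v u\<close> for \<open>u \<in> e\<close>. The exploration from \<open>e\<close> moves to all these facets and deletes the star of \<open>e\<close>
  from \<open>X\<close>, so that it never returns to \<open>e\<close>.
\<close>

definition link :: "'a set \<Rightarrow> 'a set set \<Rightarrow> 'a set" where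
  "link e X = {v. v \<notin> e \<and> insert v e \<in> X}"

definition del :: "'a set \<Rightarrow> 'a set set \<Rightarrow> 'a set set" where
  "del e X = {\<sigma> \<in> X. \<not> e \<subseteq> \<sigma>}"

definition flip :: "'a set \<Rightarrow> 'a \<Rightarrow> 'a \<Rightarrow> 'a set" where
  "flip e v u = insert v e - {u}"

primrec reach :: "nat \<Rightarrow> 'a set \<Rightarrow> 'a set set \<Rightarrow> 'a set set" where
  "reach 0 e X = {e}"
| "reach (Suc r) e X = insert e (\<Union>v\<in>link e X. \<Union>u\<in>e. reach r (flip e v u) (del e X))"

text \<open>
  Two branches of the exploration meet. If this does not happen, then the explored part of the complex is
  a tree in which cells and faces alternate.
\<close>

primrec tangled :: "nat \<Rightarrow> 'a set \<Rightarrow> 'a set set \<Rightarrow> bool" where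
  "tangled 0 e X \<longleftrightarrow> False"
| "tangled (Suc r) e X \<longleftrightarrow>
     (\<exists>v\<in>link e X. \<exists>u\<in>e. tangled r (flip e v u) (del e X)) \<or>
     (\<exists>v\<in>link e X. \<exists>u\<in>e. \<exists>v'\<in>link e X. \<exists>u'\<in>e. (v, u) \<noteq> (v', u') \<and>
        reach r (flip e v u) (del e X) \<inter> reach r (flip e v' u') (del e X) \<noteq> {})"

text \<open>
  A quantity computed upwards along the exploration: \<open>b\<close> is the value at depth \<open>0\<close>, and \<open>G\<close> combines the
  values at the children, which are given as one list of \<open>d\<close> values for each face through \<open>e\<close>. Both the
  core degrees and the masses below are of this form.
\<close>

primrec local_val :: "('b list list \<Rightarrow> 'b) \<Rightarrow> 'b \<Rightarrow> nat \<Rightarrow> 'a::linorder set \<Rightarrow> 'a set set \<Rightarrow> 'b" where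
  "local_val G b 0 e X = b"
| "local_val G b (Suc r) e X =
     G (map (\<lambda>v. map (\<lambda>u. local_val G b r (flip e v u) (del e X)) (sorted_list_of_set e))
        (sorted_list_of_set (link e X)))"

lemma flip_card:
  assumes "finite e" "v \<notin> e" "u \<in> e"
  shows "card (flip e v u) = card e" "finite (flip e v u)"
  using assms card_gt_0_iff[of e] by (auto simp: flip_def)

lemma flip_inj:
  assumes "v \<notin> e" "u \<in> e" "v' \<notin> e" "u' \<in> e" "flip e v u = flip e v' u'"
  shows "v = v'" "u = u'"
proof -
  have "v \<in> flip e v' u'" "v' \<in> flip e v u" using assms by (auto simp: flip_def)
  then show "v = v'" using assms by (auto simp: flip_def)
  have "u \<notin> flip e v' u'" using assms(5)[symmetric] by (simp add: flip_def)
  then show "u = u'" using assms by (auto simp: flip_def)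
qed

lemma flip_neq: "v \<notin> e \<Longrightarrow> u \<in> e \<Longrightarrow> flip e v u \<noteq> e"
  by (auto simp: flip_def)

lemma del_commute: "del e (del e' X) = del e' (del e X)"
  by (auto simp: del_def)

lemma del_mono: "X \<subseteq> X' \<Longrightarrow> del e X \<subseteq> del e X'"
  by (auto simp: del_def)

lemma del_subset: "del e X \<subseteq> X"
  by (auto simp: del_def)

lemma link_mono: "X \<subseteq> X' \<Longrightarrow> link e X \<subseteq> link e X'"
  by (auto simp: link_def)

lemma reach_self: "e \<in> reach r e X"
  by (cases r) auto

lemma reach_mono: "X \<subseteq> X' \<Longrightarrow> reach r e X \<subseteq> reach r e X'"
proof (induction r arbitrary: e X X')
  case (Suc r)
  have "reach r (flip e v u) (del e X) \<subseteq> reach r (flip e v u) (del e X')" for v u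
    by (rule Suc.IH[OF del_mono[OF Suc.prems]])
  then show ?case using link_mono[OF Suc.prems, of e] by (simp, blast)
qed simp

lemma tangled_mono: "X \<subseteq> X' \<Longrightarrow> tangled r e X \<Longrightarrow> tangled r e X'"
proof (induction r arbitrary: e X X')
  case (Suc r)
  have rm: "reach r (flip e v u) (del e X) \<subseteq> reach r (flip e v u) (del e X')" for v u
    by (rule reach_mono[OF del_mono[OF Suc.prems(1)]])
  have lm: "link e X \<subseteq> link e X'" by (rule link_mono[OF Suc.prems(1)])
  from Suc.prems(2) consider
      v u where "v \<in> link e X" "u \<in> e" "tangled r (flip e v u) (del e X)"
    | v u v' u' g where "v \<in> link e X" "u \<in> e" "v' \<in> link e X" "u' \<in> e" "(v, u) \<noteq> (v', u')"
        "g \<in> reach r (flip e v u) (del e X)" "g \<in> reach r (flip e v' u') (del e X)"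
    unfolding tangled.simps by (metis disjoint_iff)
  then show ?case
  proof cases
    case 1
    then have "tangled r (flip e v u) (del e X')"
      using Suc.IH[OF del_mono[OF Suc.prems(1)]] by blast
    then have "\<exists>v\<in>link e X'. \<exists>u\<in>e. tangled r (flip e v u) (del e X')" using 1(1,2) lm by blast
    then show ?thesis by simp
  next
    case 2
    then have "g \<in> reach r (flip e v u) (del e X') \<inter> reach r (flip e v' u') (del e X')"
      using rm by blast
    moreover have "v \<in> link e X'" "v' \<in> link e X'" using 2 lm by auto
    ultimately have "\<exists>v\<in>link e X'. \<exists>u\<in>e. \<exists>v'\<in>link e X'. \<exists>u'\<in>e. (v, u) \<noteq> (v', u') \<and>
        reach r (flip e v u) (del e X') \<inter> reach r (flip e v' u') (del e X') \<noteq> {}"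
      using 2(2,4,5) by (intro bexI[of _ v] bexI[of _ u] bexI[of _ v'] bexI[of _ u']) auto
    then show ?thesis by (simp only: tangled.simps simp_thms)
  qed
qed simp

lemma facet_is_flip:
  assumes "finite e" "card e' = card e" "e' \<noteq> e" "v \<notin> e" "e' \<subseteq> insert v e"
  obtains u where "u \<in> e" "e' = flip e v u"
proof -
  have fin: "finite e'" using assms finite_subset by auto
  have "v \<in> e'"
  proof (rule ccontr)
    assume "v \<notin> e'"
    then have "e' \<subseteq> e" using assms by auto
    then show False using card_subset_eq[OF assms(1)] assms by auto
  qed
  have "\<not> e \<subseteq> e'" using card_subset_eq[OF fin, of e] assms by auto
  then obtain u where u: "u \<in> e" "u \<notin> e'" by auto
  then have "e' \<subseteq> flip e v u" using assms by (auto simp: flip_def)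
  moreover have "card e' = card (flip e v u)" using flip_card assms u by metis
  ultimately have "e' = flip e v u" using flip_card(2) assms u by (intro card_subset_eq) auto
  with u show ?thesis using that by blast
qed

text \<open>
  A cell \<open>e'\<close> lying in a face through \<open>e\<close> is a facet of that face, and so it is a neighbour of \<open>e\<close> in the
  exploration.
\<close>

lemma unreached_link:
  assumes "finite e" "card e' = card e" "e' \<noteq> e"
    and "\<And>v u. v \<in> link e X \<Longrightarrow> u \<in> e \<Longrightarrow> flip e v u \<noteq> e'"
  shows "link e (del e' X) = link e X"
proof -
  have "\<not> e' \<subseteq> insert v e" if "v \<in> link e X" for v
    using facet_is_flip[OF assms(1-3), of v] assms(4)[OF that] that by (auto simp: link_def)
  then show ?thesis by (auto simp: link_def del_def)
qed

text \<open>
  The exploration inspects a face containing \<open>e'\<close> only after it has arrived at \<open>e'\<close> or at another facet of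
  that face; in the latter case it moves to \<open>e'\<close> next. At the last level nothing is inspected.
\<close>

lemma unreached_del:
  assumes "finite e" "card e' = card e" "e' \<notin> reach r e X"
  shows "reach r e (del e' X) = reach r e X"
    and "local_val G b r e (del e' X) = local_val G b r e X"
proof -
  have "reach r e (del e' X) = reach r e X \<and> local_val G b r e (del e' X) = local_val G b r e X"
    using assms
  proof (induction r arbitrary: e X)
    case (Suc r)
    have sub: "e' \<notin> reach r (flip e v u) (del e X)" if "v \<in> link e X" "u \<in> e" for v u
      using Suc.prems(3) that by auto
    have "flip e v u \<noteq> e'" if "v \<in> link e X" "u \<in> e" for v u
      using sub[OF that] reach_self by metis
    then have lk: "link e (del e' X) = link e X"
      using Suc.prems by (intro unreached_link) auto
    have IH: "reach r (flip e v u) (del e (del e' X)) = reach r (flip e v u) (del e X) \<and>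
       local_val G b r (flip e v u) (del e (del e' X)) = local_val G b r (flip e v u) (del e X)"
      if "v \<in> link e X" "u \<in> e" for v u
      unfolding del_commute[of e e'] using that Suc.prems flip_card[of e v u] sub[OF that]
      by (intro Suc.IH) (auto simp: link_def)
    have "reach (Suc r) e (del e' X) = reach (Suc r) e X"
      using IH by (simp add: lk)
    moreover have "local_val G b (Suc r) e (del e' X) = local_val G b (Suc r) e X"
    proof -
      have "map (\<lambda>v. map (\<lambda>u. local_val G b r (flip e v u) (del e (del e' X))) (sorted_list_of_set e))
          (sorted_list_of_set (link e X))
        = map (\<lambda>v. map (\<lambda>u. local_val G b r (flip e v u) (del e X)) (sorted_list_of_set e))
          (sorted_list_of_set (link e X))"
      proof (intro map_cong refl)
        fix v u assume "v \<in> set (sorted_list_of_set (link e X))" "u \<in> set (sorted_list_of_set e)"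
        then have "v \<in> link e X" "u \<in> e"
          by (cases "finite (link e X)"; cases "finite e"; simp)+
        then show "local_val G b r (flip e v u) (del e (del e' X)) = local_val G b r (flip e v u) (del e X)"
          using IH by blast
      qed
      then show ?thesis by (simp only: local_val.simps lk)
    qed
    ultimately show ?case by blast
  qed simp
  then show "reach r e (del e' X) = reach r e X"
    and "local_val G b r e (del e' X) = local_val G b r e X" by auto
qed

section \<open>The exploration is a tree with high probability\<close>

definition cells :: "nat \<Rightarrow> nat \<Rightarrow> nat set set" where
  "cells n k = {\<sigma>. \<sigma> \<subseteq> {..<n} \<and> card \<sigma> = k}"

lemma finite_cells [simp]: "finite (cells n k)"
  by (rule finite_subset[of _ "Pow {..<n}"]) (auto simp: cells_def)

lemma card_cells: "card (cells n k) = n choose k"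
  using n_subsets[of "{..<n}" k] by (simp add: cells_def)

lemma cells_finite: "e \<in> cells n k \<Longrightarrow> finite e"
  by (auto simp: cells_def intro: finite_subset)

lemma cells_nonempty: "e \<in> cells n d \<Longrightarrow> d \<ge> 1 \<Longrightarrow> e \<noteq> {}"
  by (auto simp: cells_def)

lemma insert_cells: "e \<in> cells n k \<Longrightarrow> v \<notin> e \<Longrightarrow> insert v e \<in> cells n (Suc k) \<longleftrightarrow> v < n"
  using cells_finite[of e n k] by (auto simp: cells_def)

lemma flip_cells: "e \<in> cells n k \<Longrightarrow> v \<notin> e \<Longrightarrow> v < n \<Longrightarrow> u \<in> e \<Longrightarrow> flip e v u \<in> cells n k"
  using flip_card[of e v u] cells_finite[of e n k] by (auto simp: cells_def flip_def)

text \<open>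
  All possible faces through \<open>e\<close>; for a random \<open>X\<close>, what \<open>X\<close> contains of them is independent of \<open>del e X\<close>.
\<close>

definition star :: "nat \<Rightarrow> nat set \<Rightarrow> nat set set" where
  "star n e = {\<sigma> \<in> cells n (Suc (card e)). e \<subseteq> \<sigma>}"

definition random_faces :: "nat \<Rightarrow> real \<Rightarrow> nat \<Rightarrow> nat set set pmf" where
  "random_faces d c n = random_subset (cells n (Suc d)) (c / real n)"

lemma set_random_faces: "X \<in> set_pmf (random_faces d c n) \<Longrightarrow> X \<subseteq> cells n (Suc d)"
  unfolding random_faces_def by (rule set_random_subset)

lemma integrable_random_faces [simp]:
  fixes f :: "nat set set \<Rightarrow> real"
  shows "integrable (measure_pmf (random_faces d c n)) f"
  by (simp add: random_faces_def)

lemma del_eq_star: "e \<in> cells n d \<Longrightarrow> X \<subseteq> cells n (Suc d) \<Longrightarrow> del e X = X - star n e"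
  by (auto simp: del_def star_def cells_def)

lemma link_less: "X \<subseteq> cells n (Suc d) \<Longrightarrow> v \<in> link e X \<Longrightarrow> v < n"
  by (auto simp: link_def cells_def)

lemma finite_link: "X \<subseteq> cells n (Suc d) \<Longrightarrow> finite (link e X)"
  using link_less[of X n d] by (intro finite_subset[of "link e X" "{..<n}"]) auto

abbreviation EF :: "nat \<Rightarrow> real \<Rightarrow> nat \<Rightarrow> (nat set set \<Rightarrow> real) \<Rightarrow> real" where
  "EF d c n \<equiv> expect (random_faces d c n)"

abbreviation PF :: "nat \<Rightarrow> real \<Rightarrow> nat \<Rightarrow> (nat set set \<Rightarrow> bool) \<Rightarrow> real" where
  "PF d c n P \<equiv> EF d c n (\<lambda>X. of_bool (P X))"

lemma EF_mono:
  assumes "\<And>X. X \<subseteq> cells n (Suc d) \<Longrightarrow> f X \<le> g X"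
  shows "EF d c n f \<le> EF d c n g"
  by (rule expectation_mono) (auto intro!: assms set_random_faces)

lemma PF_mono:
  assumes "\<And>X. X \<subseteq> cells n (Suc d) \<Longrightarrow> P X \<Longrightarrow> Q X"
  shows "PF d c n P \<le> PF d c n Q"
  using assms by (intro EF_mono) (auto simp: of_bool_def)

lemma PF_disj:
  assumes "\<And>X. X \<subseteq> cells n (Suc d) \<Longrightarrow> P X \<Longrightarrow> Q X \<or> R X"
  shows "PF d c n P \<le> PF d c n Q + PF d c n R"
proof -
  have "PF d c n P \<le> EF d c n (\<lambda>X. of_bool (Q X) + of_bool (R X))"
    using assms by (intro EF_mono) (auto simp: of_bool_def)
  then show ?thesis by simp
qed

lemma of_bool_Bex_le_sum:
  assumes "finite A"
  shows "of_bool (\<exists>a\<in>A. P a) \<le> (\<Sum>a\<in>A. of_bool (P a) :: real)"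
proof (cases "\<exists>a\<in>A. P a")
  case True
  then obtain a where "a \<in> A" "P a" by blast
  then show ?thesis using member_le_sum[of a A "\<lambda>a. of_bool (P a) :: real"] assms True by simp
qed (simp add: sum_nonneg)

lemma PF_union:
  assumes "finite A"
  shows "PF d c n (\<lambda>X. \<exists>a\<in>A. P a X) \<le> (\<Sum>a\<in>A. PF d c n (P a))"
proof -
  have "PF d c n (\<lambda>X. \<exists>a\<in>A. P a X) \<le> EF d c n (\<lambda>X. \<Sum>a\<in>A. of_bool (P a X))"
    by (rule EF_mono) (rule of_bool_Bex_le_sum[OF assms])
  then show ?thesis by simp
qed

lemma PF_star:
  assumes e: "e \<in> cells n d" and c: "0 \<le> c" "c \<le> real n" and S: "S \<subseteq> star n e"
  shows "PF d c n (\<lambda>X. S \<subseteq> X \<and> Q (del e X)) = (c / real n) ^ card S * PF d c n (\<lambda>X. Q (del e X))"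
proof -
  have sub: "star n e \<subseteq> cells n (Suc d)" using e by (auto simp: star_def cells_def)
  have eq: "PF d c n (\<lambda>X. P X \<and> Q (del e X)) = EF d c n (\<lambda>X. of_bool (P X) * of_bool (Q (X - star n e)))" for P
    by (rule expectation_cong) (use set_random_faces del_eq_star[OF e] in \<open>auto simp: of_bool_conj\<close>)
  have p: "0 \<le> c / real n" "c / real n \<le> 1" using c by (auto simp: divide_le_eq_1)
  show ?thesis
    using expectation_subset_and_rest[OF finite_cells sub S p, of "\<lambda>Z. of_bool (Q Z)"] eq[of "\<lambda>X. S \<subseteq> X"] eq[of "\<lambda>_. True"]
    unfolding random_faces_def by simp
qed

lemma PF_le_1: "PF d c n P \<le> 1"
  using EF_mono[of n d "\<lambda>X. of_bool (P X)" "\<lambda>_. 1" c] by simp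

text \<open>
  Union bound over the first step of the exploration. Whether \<open>insert v e\<close> is present is independent of
  \<open>del e X\<close>, so each of the possible steps contributes a factor \<open>c / n\<close>.
\<close>

lemma PF_link_le:
  assumes e: "e \<in> cells n d" and c: "0 \<le> c" "c \<le> real n"
  shows "PF d c n (\<lambda>X. \<exists>v\<in>link e X. \<exists>u\<in>e. Q v u (del e X))
    \<le> c / real n * (\<Sum>(v,u)\<in>({..<n} - e) \<times> e. PF d c n (\<lambda>X. Q v u (del e X)))"
proof -
  let ?I = "({..<n} - e) \<times> e"
  have "PF d c n (\<lambda>X. \<exists>v\<in>link e X. \<exists>u\<in>e. Q v u (del e X))
     \<le> PF d c n (\<lambda>X. \<exists>i\<in>?I. {insert (fst i) e} \<subseteq> X \<and> Q (fst i) (snd i) (del e X))"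
  proof (rule PF_mono)
    fix X assume X: "X \<subseteq> cells n (Suc d)" and "\<exists>v\<in>link e X. \<exists>u\<in>e. Q v u (del e X)"
    then obtain v u where vu: "v \<in> link e X" "u \<in> e" "Q v u (del e X)" by blast
    then have "(v, u) \<in> ?I" "insert v e \<in> X" using link_less[OF X] by (auto simp: link_def)
    then show "\<exists>i\<in>?I. {insert (fst i) e} \<subseteq> X \<and> Q (fst i) (snd i) (del e X)"
      using vu(3) by (intro bexI[of _ "(v, u)"]) auto
  qed
  also have "\<dots> \<le> (\<Sum>i\<in>?I. PF d c n (\<lambda>X. {insert (fst i) e} \<subseteq> X \<and> Q (fst i) (snd i) (del e X)))"
    by (rule PF_union) (use cells_finite[OF e] in simp)
  also have "\<dots> = (\<Sum>i\<in>?I. c / real n * PF d c n (\<lambda>X. Q (fst i) (snd i) (del e X)))"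
  proof (rule sum.cong[OF refl])
    fix i assume "i \<in> ?I"
    then have "{insert (fst i) e} \<subseteq> star n e" using e cells_finite[OF e] by (auto simp: star_def cells_def)
    from PF_star[OF e c this, of "Q (fst i) (snd i)"]
    show "PF d c n (\<lambda>X. {insert (fst i) e} \<subseteq> X \<and> Q (fst i) (snd i) (del e X))
      = c / real n * PF d c n (\<lambda>X. Q (fst i) (snd i) (del e X))" by simp
  qed
  finally show ?thesis by (simp add: sum_distrib_left case_prod_unfold)
qed

lemma card_flips_le:
  assumes e: "e \<in> cells n d"
  shows "real (card (({..<n} - e) \<times> e)) \<le> real n * real d"
proof -
  have "card (({..<n} - e) \<times> e) \<le> n * d"
    using e cells_finite[OF e] card_mono[of "{..<n}" "{..<n} - e"] by (simp add: cells_def card_cartesian_product)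
  then show ?thesis by (metis of_nat_le_iff of_nat_mult)
qed

text \<open>
  At most one of the flips of \<open>e\<close> is the cell \<open>e'\<close>.
\<close>

lemma sum_flip_le:
  assumes e: "e \<in> cells n d" and K: "0 \<le> K"
  shows "(\<Sum>(v,u)\<in>({..<n} - e) \<times> e. if flip e v u = e' then 1 else K) \<le> 1 + real n * real d * K"
proof -
  let ?I = "({..<n} - e) \<times> e"
  have fin: "finite ?I" using cells_finite[OF e] by simp
  have one: "card {x \<in> ?I. flip e (fst x) (snd x) = e'} \<le> 1"
  proof -
    have "\<And>x y. x \<in> {x \<in> ?I. flip e (fst x) (snd x) = e'} \<Longrightarrow> y \<in> {x \<in> ?I. flip e (fst x) (snd x) = e'} \<Longrightarrow> x = y"
      using flip_inj[of _ e _] by (auto simp: mem_Times_iff prod_eq_iff)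
    then show ?thesis using fin by (subst card_le_Suc0_iff_eq[unfolded One_nat_def[symmetric]]) auto
  qed
  have "(\<Sum>(v,u)\<in>?I. if flip e v u = e' then 1 else K)
      \<le> (\<Sum>x\<in>?I. of_bool (flip e (fst x) (snd x) = e') + K)"
    using K by (intro sum_mono) (simp add: case_prod_unfold)
  also have "\<dots> = real (card {x \<in> ?I. flip e (fst x) (snd x) = e'}) + real (card ?I) * K"
    using fin by (simp add: sum.distrib Int_def)
  also have "\<dots> \<le> 1 + real n * real d * K"
    using one card_flips_le[OF e] K by (intro add_mono mult_right_mono) auto
  finally show ?thesis .
qed

text \<open>
  There are about \<open>d n\<close> possible first steps, each present with probability \<open>c / n\<close>. One of them may lead
  straight to \<open>e'\<close>; from each of the others \<open>e'\<close> is reached with probability \<open>O(1 / n)\<close> by induction.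
\<close>

lemma reach_prob:
  assumes c: "0 \<le> c"
  shows "\<exists>C\<ge>0. \<forall>n e e'. 0 < n \<longrightarrow> c \<le> real n \<longrightarrow> e \<in> cells n d \<longrightarrow> e' \<in> cells n d \<longrightarrow> e' \<noteq> e \<longrightarrow>
    PF d c n (\<lambda>X. e' \<in> reach r e X) \<le> C / real n"
proof (induction r)
  case 0
  show ?case by (intro exI[of _ 0]) auto
next
  case (Suc r)
  then obtain C where C: "C \<ge> 0" "\<And>n e e'. 0 < n \<Longrightarrow> c \<le> real n \<Longrightarrow> e \<in> cells n d \<Longrightarrow> e' \<in> cells n d \<Longrightarrow>
      e' \<noteq> e \<Longrightarrow> PF d c n (\<lambda>X. e' \<in> reach r e X) \<le> C / real n" by blast
  show ?case
  proof (intro exI[of _ "c * (1 + real d * C)"] conjI allI impI)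
    show "0 \<le> c * (1 + real d * C)" using c C by simp
    fix n :: nat and e e' assume n: "0 < n" "c \<le> real n" and e: "e \<in> cells n d" "e' \<in> cells n d" "e' \<noteq> e"
    have "PF d c n (\<lambda>X. e' \<in> reach (Suc r) e X)
        \<le> PF d c n (\<lambda>X. \<exists>v\<in>link e X. \<exists>u\<in>e. e' \<in> reach r (flip e v u) (del e X))"
      using e by (intro PF_mono) auto
    also have "\<dots> \<le> c / real n * (\<Sum>(v,u)\<in>({..<n} - e) \<times> e. PF d c n (\<lambda>X. e' \<in> reach r (flip e v u) (del e X)))"
      by (rule PF_link_le) (use e n c in auto)
    also have "\<dots> \<le> c / real n * (\<Sum>(v,u)\<in>({..<n} - e) \<times> e. if flip e v u = e' then 1 else C / real n)"
    proof (intro mult_left_mono sum_mono, clarify)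
      fix v u assume vu: "v < n" "v \<notin> e" "u \<in> e"
      have "PF d c n (\<lambda>X. e' \<in> reach r (flip e v u) (del e X)) \<le> PF d c n (\<lambda>X. e' \<in> reach r (flip e v u) X)"
        using reach_mono[OF del_subset, of r "flip e v u" e] by (intro PF_mono) blast
      also have "\<dots> \<le> (if flip e v u = e' then 1 else C / real n)"
        using C(2)[OF n flip_cells[OF e(1), of v u] e(2)] vu by (auto intro: PF_le_1)
      finally show "PF d c n (\<lambda>X. e' \<in> reach r (flip e v u) (del e X)) \<le> (if flip e v u = e' then 1 else C / real n)" .
    qed (use c in auto)
    also have "\<dots> \<le> c / real n * (1 + real n * real d * (C / real n))"
      using c C by (intro mult_left_mono sum_flip_le e) auto
    also have "\<dots> = c * (1 + real d * C) / real n" using n by simp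
    finally show "PF d c n (\<lambda>X. e' \<in> reach (Suc r) e X) \<le> c * (1 + real d * C) / real n" .
  qed
qed

text \<open>
  If the second exploration does not reach \<open>e\<close>, then deleting the star of \<open>e\<close> does not change it, and the
  meeting takes place after the first step from \<open>e\<close>. The first steps are treated as in \<open>reach_prob\<close>.
\<close>

lemma reach_meet_prob:
  assumes c: "0 \<le> c"
  shows "\<exists>C\<ge>0. \<forall>n e e'. 0 < n \<longrightarrow> c \<le> real n \<longrightarrow> e \<in> cells n d \<longrightarrow> e' \<in> cells n d \<longrightarrow> e \<noteq> e' \<longrightarrow>
    PF d c n (\<lambda>X. reach r e X \<inter> reach s e' X \<noteq> {}) \<le> C / real n"
proof (induction r)
  case 0
  from reach_prob[OF c, of d s] show ?case by simp metis
next
  case (Suc r)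
  then obtain C where C: "C \<ge> 0" "\<And>n e e'. 0 < n \<Longrightarrow> c \<le> real n \<Longrightarrow> e \<in> cells n d \<Longrightarrow> e' \<in> cells n d \<Longrightarrow>
      e \<noteq> e' \<Longrightarrow> PF d c n (\<lambda>X. reach r e X \<inter> reach s e' X \<noteq> {}) \<le> C / real n" by blast
  obtain D where D: "D \<ge> 0" "\<And>n e e'. 0 < n \<Longrightarrow> c \<le> real n \<Longrightarrow> e \<in> cells n d \<Longrightarrow> e' \<in> cells n d \<Longrightarrow>
      e' \<noteq> e \<Longrightarrow> PF d c n (\<lambda>X. e' \<in> reach s e X) \<le> D / real n" using reach_prob[OF c, of d s] by blast
  show ?case
  proof (intro exI[of _ "D + c * (1 + real d * C)"] conjI allI impI)
    show "0 \<le> D + c * (1 + real d * C)" using c C D by simp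
    fix n :: nat and e e' assume n: "0 < n" "c \<le> real n" and e: "e \<in> cells n d" "e' \<in> cells n d" "e \<noteq> e'"
    let ?Q = "\<lambda>v u Z. reach r (flip e v u) Z \<inter> reach s e' Z \<noteq> {}"
    have "PF d c n (\<lambda>X. reach (Suc r) e X \<inter> reach s e' X \<noteq> {})
        \<le> PF d c n (\<lambda>X. e \<in> reach s e' X) + PF d c n (\<lambda>X. \<exists>v\<in>link e X. \<exists>u\<in>e. ?Q v u (del e X))"
    proof (rule PF_disj)
      fix X assume meet: "reach (Suc r) e X \<inter> reach s e' X \<noteq> {}"
      show "e \<in> reach s e' X \<or> (\<exists>v\<in>link e X. \<exists>u\<in>e. ?Q v u (del e X))"
      proof (cases "e \<in> reach s e' X")
        case False
        have "reach s e' (del e X) = reach s e' X"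
          using False e by (intro unreached_del) (auto simp: cells_def intro: finite_subset)
        then show ?thesis using False meet by auto
      qed simp
    qed
    also have "PF d c n (\<lambda>X. e \<in> reach s e' X) \<le> D / real n"
      by (rule D(2)) (use n e in auto)
    also have "PF d c n (\<lambda>X. \<exists>v\<in>link e X. \<exists>u\<in>e. ?Q v u (del e X))
      \<le> c / real n * (\<Sum>(v,u)\<in>({..<n} - e) \<times> e. PF d c n (\<lambda>X. ?Q v u (del e X)))"
      by (rule PF_link_le) (use e n c in auto)
    also have "\<dots> \<le> c / real n * (\<Sum>(v,u)\<in>({..<n} - e) \<times> e. if flip e v u = e' then 1 else C / real n)"
    proof (intro mult_left_mono sum_mono, clarify)
      fix v u assume vu: "v < n" "v \<notin> e" "u \<in> e"
      have "PF d c n (\<lambda>X. ?Q v u (del e X)) \<le> PF d c n (\<lambda>X. ?Q v u X)"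
        using reach_mono[OF del_subset, of r "flip e v u" e] reach_mono[OF del_subset, of s e' e]
        by (intro PF_mono) blast
      also have "\<dots> \<le> (if flip e v u = e' then 1 else C / real n)"
        using C(2)[OF n flip_cells[OF e(1), of v u] e(2)] vu by (auto intro: PF_le_1)
      finally show "PF d c n (\<lambda>X. ?Q v u (del e X)) \<le> (if flip e v u = e' then 1 else C / real n)" .
    qed (use c in auto)
    also have "\<dots> \<le> c / real n * (1 + real n * real d * (C / real n))"
      using c C by (intro mult_left_mono sum_flip_le e) auto
    also have "D / real n + c / real n * (1 + real n * real d * (C / real n)) = (D + c * (1 + real d * C)) / real n"
      using n by (simp add: add_divide_distrib)
    finally show "PF d c n (\<lambda>X. reach (Suc r) e X \<inter> reach s e' X \<noteq> {}) \<le> (D + c * (1 + real d * C)) / real n"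
      by simp
  qed
qed

lemma PF_link_le_uniform:
  assumes e: "e \<in> cells n d" and n: "0 < n" and c: "0 \<le> c" "c \<le> real n" and K: "0 \<le> K"
    and Q: "\<And>v u. v < n \<Longrightarrow> v \<notin> e \<Longrightarrow> u \<in> e \<Longrightarrow> PF d c n (\<lambda>X. Q v u (del e X)) \<le> K"
  shows "PF d c n (\<lambda>X. \<exists>v\<in>link e X. \<exists>u\<in>e. Q v u (del e X)) \<le> c * real d * K"
proof -
  have "PF d c n (\<lambda>X. \<exists>v\<in>link e X. \<exists>u\<in>e. Q v u (del e X))
    \<le> c / real n * (\<Sum>(v,u)\<in>({..<n} - e) \<times> e. PF d c n (\<lambda>X. Q v u (del e X)))"
    by (rule PF_link_le[OF e c])
  also have "\<dots> \<le> c / real n * (\<Sum>x\<in>({..<n} - e) \<times> e. K)"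
    using c Q by (intro mult_left_mono sum_mono) auto
  also have "\<dots> = c / real n * (real (card (({..<n} - e) \<times> e)) * K)" by simp
  also have "\<dots> \<le> c / real n * (real n * real d * K)"
    using c K card_flips_le[OF e] by (intro mult_left_mono mult_right_mono) auto
  also have "\<dots> = c * real d * K" using n by simp
  finally show ?thesis .
qed

text \<open>
  Branches may meet inside one subtree, or between two subtrees hanging at the same face or at two
  different faces through \<open>e\<close>. A pair of different faces has probability \<open>(c / n)^2\<close>, which balances the
  order \<open>n^2\<close> of the number of such pairs.
\<close>

lemma tangled_prob:
  assumes c: "0 \<le> c"
  shows "\<exists>C\<ge>0. \<forall>n e. 0 < n \<longrightarrow> c \<le> real n \<longrightarrow> e \<in> cells n d \<longrightarrow>
    PF d c n (\<lambda>X. tangled r e X) \<le> C / real n"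
proof (induction r)
  case 0
  show ?case by (intro exI[of _ 0]) auto
next
  case (Suc r)
  then obtain B where B: "B \<ge> 0" "\<And>n e. 0 < n \<Longrightarrow> c \<le> real n \<Longrightarrow> e \<in> cells n d \<Longrightarrow>
      PF d c n (\<lambda>X. tangled r e X) \<le> B / real n" by blast
  obtain C where C: "C \<ge> 0" "\<And>n e e'. 0 < n \<Longrightarrow> c \<le> real n \<Longrightarrow> e \<in> cells n d \<Longrightarrow> e' \<in> cells n d \<Longrightarrow>
      e \<noteq> e' \<Longrightarrow> PF d c n (\<lambda>X. reach r e X \<inter> reach r e' X \<noteq> {}) \<le> C / real n"
    using reach_meet_prob[OF c, of d r r] by blast
  show ?case
  proof (intro exI[of _ "c * real d * B + c * real d * (real d * C) + c^2 * (real d)^2 * C"] conjI allI impI)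
    show "0 \<le> c * real d * B + c * real d * (real d * C) + c^2 * (real d)^2 * C" using c B C by simp
    fix n :: nat and e assume n: "0 < n" "c \<le> real n" and e: "e \<in> cells n d"
    let ?I = "({..<n} - e) \<times> e"
    have fin: "finite ?I" "finite e" using cells_finite[OF e] by auto
    define M where "M = (\<lambda>v u v' u' Z. reach r (flip e v u) Z \<inter> reach r (flip e v' u') Z \<noteq> {})"
    have M: "PF d c n (\<lambda>X. M v u v' u' (del e X)) \<le> C / real n"
      if "v < n" "v \<notin> e" "u \<in> e" "v' < n" "v' \<notin> e" "u' \<in> e" "(v, u) \<noteq> (v', u')" for v u v' u'
    proof -
      have "PF d c n (\<lambda>X. M v u v' u' (del e X)) \<le> PF d c n (\<lambda>X. M v u v' u' X)"
        using reach_mono[OF del_subset, of r "flip e v u" e] reach_mono[OF del_subset, of r "flip e v' u'" e]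
        unfolding M_def by (intro PF_mono) blast
      also have "\<dots> \<le> C / real n"
        unfolding M_def using that flip_inj[of v e u v' u']
        by (intro C(2) n flip_cells[OF e]) auto
      finally show ?thesis .
    qed
    have A: "PF d c n (\<lambda>X. \<exists>v\<in>link e X. \<exists>u\<in>e. tangled r (flip e v u) (del e X)) \<le> c * real d * (B / real n)"
    proof (rule PF_link_le_uniform[OF e n(1) c n(2)])
      fix v u assume vu: "v < n" "v \<notin> e" "u \<in> e"
      have "PF d c n (\<lambda>X. tangled r (flip e v u) (del e X)) \<le> PF d c n (\<lambda>X. tangled r (flip e v u) X)"
        by (rule PF_mono) (rule tangled_mono[OF del_subset])
      also have "\<dots> \<le> B / real n" by (intro B(2) n flip_cells[OF e] vu)
      finally show "PF d c n (\<lambda>X. tangled r (flip e v u) (del e X)) \<le> B / real n" .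
    qed (use B in auto)
    have same: "PF d c n (\<lambda>X. \<exists>v\<in>link e X. \<exists>u\<in>e. \<exists>u'\<in>e. u \<noteq> u' \<and> M v u v u' (del e X))
        \<le> c * real d * (real d * C / real n)"
    proof (rule PF_link_le_uniform[OF e n(1) c n(2)])
      fix v u assume vu: "v < n" "v \<notin> e" "u \<in> e"
      have "PF d c n (\<lambda>X. \<exists>u'\<in>e. u \<noteq> u' \<and> M v u v u' (del e X))
        \<le> PF d c n (\<lambda>X. \<exists>u'\<in>e - {u}. M v u v u' (del e X))"
        by (rule PF_mono) blast
      also have "\<dots> \<le> (\<Sum>u'\<in>e - {u}. PF d c n (\<lambda>X. M v u v u' (del e X)))"
        by (rule PF_union) (use fin in simp)
      also have "\<dots> \<le> (\<Sum>u'\<in>e - {u}. C / real n)"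
        using vu by (intro sum_mono M) auto
      also have "\<dots> \<le> real d * (C / real n)"
      proof -
        have "card (e - {u}) \<le> d" using e fin card_mono[of e "e - {u}"] by (auto simp: cells_def)
        then have "real (card (e - {u})) \<le> real d" by simp
        then show ?thesis using C by (simp only: sum_constant) (intro mult_right_mono, auto)
      qed
      finally show "PF d c n (\<lambda>X. \<exists>u'\<in>e. u \<noteq> u' \<and> M v u v u' (del e X)) \<le> real d * C / real n" by simp
    qed (use C in auto)
    have diff: "PF d c n (\<lambda>X. \<exists>v\<in>link e X. \<exists>u\<in>e. \<exists>v'\<in>link e X. \<exists>u'\<in>e. v \<noteq> v' \<and> M v u v' u' (del e X))
        \<le> c^2 * (real d)^2 * C / real n"
    proof -
      define J where "J = {(x, y). x \<in> ?I \<and> y \<in> ?I \<and> fst x \<noteq> fst y}"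
      define P where "P = (\<lambda>(x, y) X. {insert (fst x) e, insert (fst y) e} \<subseteq> X \<and> M (fst x) (snd x) (fst y) (snd y) (del e X))"
      have J: "J \<subseteq> ?I \<times> ?I" by (auto simp: J_def)
      have finJ: "finite J" using finite_subset[OF J] fin by simp
      have "PF d c n (\<lambda>X. \<exists>v\<in>link e X. \<exists>u\<in>e. \<exists>v'\<in>link e X. \<exists>u'\<in>e. v \<noteq> v' \<and> M v u v' u' (del e X))
          \<le> PF d c n (\<lambda>X. \<exists>z\<in>J. P z X)"
      proof (rule PF_mono)
        fix X assume X: "X \<subseteq> cells n (Suc d)" and "\<exists>v\<in>link e X. \<exists>u\<in>e. \<exists>v'\<in>link e X. \<exists>u'\<in>e. v \<noteq> v' \<and> M v u v' u' (del e X)"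
        then obtain v u v' u' where *: "v \<in> link e X" "u \<in> e" "v' \<in> link e X" "u' \<in> e" "v \<noteq> v'" "M v u v' u' (del e X)"
          by blast
        then have "((v, u), (v', u')) \<in> J" using link_less[OF X] by (auto simp: J_def link_def)
        moreover have "P ((v, u), (v', u')) X" using * by (simp add: P_def link_def)
        ultimately show "\<exists>z\<in>J. P z X" by blast
      qed
      also have "\<dots> \<le> (\<Sum>z\<in>J. PF d c n (P z))" by (rule PF_union[OF finJ])
      also have "\<dots> \<le> (\<Sum>z\<in>J. (c / real n)^2 * (C / real n))"
      proof (intro sum_mono)
        fix z assume z: "z \<in> J"
        obtain v u v' u' where zz: "z = ((v, u), (v', u'))" by (metis surj_pair)
        have I: "v < n" "v \<notin> e" "u \<in> e" "v' < n" "v' \<notin> e" "u' \<in> e" "v \<noteq> v'" using z by (auto simp: J_def zz)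
        have sub: "{insert v e, insert v' e} \<subseteq> star n e"
          using I e cells_finite[OF e] by (auto simp: star_def cells_def)
        have "insert v e \<noteq> insert v' e" using I by auto
        then have "card {insert v e, insert v' e} = 2" by simp
        then have "PF d c n (P z) = (c / real n)^2 * PF d c n (\<lambda>X. M v u v' u' (del e X))"
          using PF_star[OF e c n(2) sub, of "M v u v' u'"] by (simp add: P_def zz)
        also have "\<dots> \<le> (c / real n)^2 * (C / real n)"
          using I by (intro mult_left_mono M) auto
        finally show "PF d c n (P z) \<le> (c / real n)^2 * (C / real n)" .
      qed
      also have "\<dots> = real (card J) * ((c / real n)^2 * (C / real n))" by simp
      also have "\<dots> \<le> (real n * real d)^2 * ((c / real n)^2 * (C / real n))"
      proof (intro mult_right_mono)
        have "card J \<le> card (?I \<times> ?I)" using J fin by (intro card_mono) auto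
        then have "real (card J) \<le> real (card ?I) ^ 2"
          by (simp add: card_cartesian_product power2_eq_square flip: of_nat_mult)
        also have "\<dots> \<le> (real n * real d)^2" using card_flips_le[OF e] by (intro power_mono) auto
        finally show "real (card J) \<le> (real n * real d)^2" .
      qed (use C in auto)
      also have "\<dots> = c^2 * (real d)^2 * C / real n"
        using n by (simp add: power_mult_distrib power_divide)
      finally show ?thesis .
    qed
    have "PF d c n (\<lambda>X. tangled (Suc r) e X)
      \<le> PF d c n (\<lambda>X. \<exists>v\<in>link e X. \<exists>u\<in>e. tangled r (flip e v u) (del e X))
        + PF d c n (\<lambda>X. \<exists>v\<in>link e X. \<exists>u\<in>e. \<exists>v'\<in>link e X. \<exists>u'\<in>e. (v, u) \<noteq> (v', u') \<and> M v u v' u' (del e X))"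
      by (rule PF_disj) (simp only: tangled.simps M_def)
    also have "PF d c n (\<lambda>X. \<exists>v\<in>link e X. \<exists>u\<in>e. \<exists>v'\<in>link e X. \<exists>u'\<in>e. (v, u) \<noteq> (v', u') \<and> M v u v' u' (del e X))
      \<le> PF d c n (\<lambda>X. \<exists>v\<in>link e X. \<exists>u\<in>e. \<exists>u'\<in>e. u \<noteq> u' \<and> M v u v u' (del e X))
        + PF d c n (\<lambda>X. \<exists>v\<in>link e X. \<exists>u\<in>e. \<exists>v'\<in>link e X. \<exists>u'\<in>e. v \<noteq> v' \<and> M v u v' u' (del e X))"
      by (rule PF_disj) (metis (no_types, lifting))
    finally have "PF d c n (\<lambda>X. tangled (Suc r) e X)
        \<le> c * real d * (B / real n) + (c * real d * (real d * C / real n) + c^2 * (real d)^2 * C / real n)"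
      using A same diff by linarith
    also have "\<dots> = (c * real d * B + c * real d * (real d * C) + c^2 * (real d)^2 * C) / real n"
      by (simp add: add_divide_distrib)
    finally show "PF d c n (\<lambda>X. tangled (Suc r) e X)
        \<le> (c * real d * B + c * real d * (real d * C) + c^2 * (real d)^2 * C) / real n" .
  qed
qed

section \<open>Poisson limit of the degree\<close>

lemma random_subset_Int:
  assumes "finite A" "B \<subseteq> A"
  shows "map_pmf (\<lambda>X. X \<inter> B) (random_subset A p) = random_subset B p"
proof -
  have fin: "finite B" "finite (A - B)" using assms finite_subset by auto
  have "random_subset A p = random_subset (B \<union> (A - B)) p" using assms by (simp add: Un_absorb1)
  also have "\<dots> = map_pmf (\<lambda>(X, Y). X \<union> Y) (pair_pmf (random_subset B p) (random_subset (A - B) p))"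
    using fin by (intro random_subset_union) auto
  finally have "map_pmf (\<lambda>X. X \<inter> B) (random_subset A p)
     = map_pmf (\<lambda>(X, Y). (X \<union> Y) \<inter> B) (pair_pmf (random_subset B p) (random_subset (A - B) p))"
    by (simp add: map_pmf_comp case_prod_unfold)
  also have "\<dots> = map_pmf fst (pair_pmf (random_subset B p) (random_subset (A - B) p))"
    by (intro map_pmf_cong refl) (auto dest!: set_random_subset)
  finally show ?thesis by (simp add: map_fst_pair_pmf)
qed

lemma star_eq_image: "e \<in> cells n d \<Longrightarrow> star n e = (\<lambda>v. insert v e) ` ({..<n} - e)"
proof (intro equalityI subsetI)
  fix \<sigma> assume e: "e \<in> cells n d" and s: "\<sigma> \<in> star n e"
  then have fin: "finite e" "card e = d" "e \<subseteq> \<sigma>" "\<sigma> \<subseteq> {..<n}" "card \<sigma> = Suc d" "finite \<sigma>"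
    using cells_finite[OF e] cells_finite[of \<sigma> n "Suc d"] by (auto simp: star_def cells_def)
  then have "card (\<sigma> - e) = 1" by (simp add: card_Diff_subset)
  then obtain v where "\<sigma> - e = {v}" by (auto simp: card_1_singleton_iff)
  then have "\<sigma> = insert v e" "v \<notin> e" using fin by auto
  then show "\<sigma> \<in> (\<lambda>v. insert v e) ` ({..<n} - e)" using fin by auto
next
  fix \<sigma> assume e: "e \<in> cells n d" and s: "\<sigma> \<in> (\<lambda>v. insert v e) ` ({..<n} - e)"
  then show "\<sigma> \<in> star n e" using cells_finite[OF e] by (auto simp: star_def cells_def)
qed

lemma card_star:
  assumes e: "e \<in> cells n d"
  shows "card (star n e) = n - d"
proof -
  have "card (star n e) = card ({..<n} - e)"
    unfolding star_eq_image[OF e] by (intro card_image inj_onI) auto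
  also have "\<dots> = n - d" using e cells_finite[OF e] by (subst card_Diff_subset) (auto simp: cells_def)
  finally show ?thesis .
qed

lemma card_link:
  assumes e: "e \<in> cells n d" and X: "X \<subseteq> cells n (Suc d)"
  shows "card (link e X) = card (X \<inter> star n e)"
proof -
  have "X \<inter> star n e = (\<lambda>v. insert v e) ` link e X"
    unfolding star_eq_image[OF e] using link_less[OF X, of _ e] by (auto simp: link_def)
  moreover have "inj_on (\<lambda>v. insert v e) (link e X)"
    by (intro inj_onI) (auto simp: link_def)
  ultimately show ?thesis by (simp add: card_image)
qed

lemma degree_distribution:
  assumes e: "e \<in> cells n d" and c: "0 \<le> c" "c \<le> real n"
  shows "map_pmf (\<lambda>X. card (link e X)) (random_faces d c n) = binomial_pmf (n - d) (c / real n)"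
proof -
  have p: "0 \<le> c / real n" "c / real n \<le> 1" using c by (auto simp: divide_le_eq_1)
  have sub: "star n e \<subseteq> cells n (Suc d)" using e by (auto simp: star_def cells_def)
  have "map_pmf (\<lambda>X. card (link e X)) (random_faces d c n) = map_pmf (\<lambda>X. card (X \<inter> star n e)) (random_faces d c n)"
    using card_link[OF e] set_random_faces by (intro map_pmf_cong) auto
  also have "\<dots> = map_pmf card (random_subset (star n e) (c / real n))"
    unfolding random_faces_def random_subset_Int[OF finite_cells sub, symmetric] by (simp add: map_pmf_comp)
  also have "\<dots> = binomial_pmf (n - d) (c / real n)"
    using card_random_subset[of "star n e"] p card_star[OF e] finite_subset[OF sub] by simp
  finally show ?thesis .
qed

text \<open>
  Scheffe's lemma: pointwise convergence of probability mass functions to a probability mass function is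
  convergence in total variation.
\<close>

lemma pmf_nat_limit_uniform:
  fixes p :: "nat \<Rightarrow> nat pmf" and q :: "nat pmf"
  assumes lim: "\<And>k. (\<lambda>n. pmf (p n) k) \<longlonglongrightarrow> pmf q k" and eps: "\<epsilon> > 0"
  shows "\<exists>n0. \<forall>n\<ge>n0. \<forall>g::nat\<Rightarrow>real. (\<forall>k. 0 \<le> g k \<and> g k \<le> 1) \<longrightarrow>
     \<bar>expect (p n) g - expect q g\<bar> \<le> \<epsilon>"
proof -
  define \<delta> where "\<delta> = \<epsilon> / 4"
  have d: "\<delta> > 0" using eps by (simp add: \<delta>_def)
  have split: "\<bar>expect w g - (\<Sum>k\<le>J. pmf w k * g k)\<bar> \<le> 1 - (\<Sum>k\<le>J. pmf w k)"
    if g: "\<And>k. 0 \<le> g k \<and> g k \<le> 1" for w :: "nat pmf" and g :: "nat \<Rightarrow> real" and J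
  proof -
    have i: "integrable (measure_pmf w) (\<lambda>k. g k * of_bool (P k))" "integrable (measure_pmf w) (\<lambda>k. of_bool (P k) :: real)" for P
      using g by (auto intro!: integrable_pmf_bounded[where B = 1] simp: abs_mult)
    have fin: "expect w (\<lambda>k. h k * of_bool (k \<le> J)) = (\<Sum>k\<le>J. pmf w k * h k)" for h :: "nat \<Rightarrow> real"
      by (subst integral_measure_pmf[where A = "{..J}"]) auto
    have "expect w g = expect w (\<lambda>k. g k * of_bool (k \<le> J) + g k * of_bool (\<not> k \<le> J))"
      by (intro expectation_cong) auto
    also have "\<dots> = (\<Sum>k\<le>J. pmf w k * g k) + expect w (\<lambda>k. g k * of_bool (\<not> k \<le> J))"
      by (simp only: Bochner_Integration.integral_add[OF i(1) i(1)] fin)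
    finally have 1: "expect w g - (\<Sum>k\<le>J. pmf w k * g k) = expect w (\<lambda>k. g k * of_bool (\<not> k \<le> J))"
      by simp
    have "expect w (\<lambda>k. g k * of_bool (\<not> k \<le> J)) \<le> expect w (\<lambda>k. 1 - 1 * of_bool (k \<le> J))"
      using g i[of "\<lambda>k. k \<le> J"] i[of "\<lambda>k. \<not> k \<le> J"] by (intro expectation_mono) auto
    also have "\<dots> = 1 - (\<Sum>k\<le>J. pmf w k)"
      using i[of "\<lambda>k. k \<le> J"] fin[of "\<lambda>_. 1"] by simp
    moreover have "0 \<le> expect w (\<lambda>k. g k * of_bool (\<not> k \<le> J))"
      using g by simp
    ultimately show ?thesis using 1 by linarith
  qed
  have "(\<lambda>J. \<Sum>k\<le>J. pmf q k) \<longlonglongrightarrow> 1"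
  proof -
    have "(\<lambda>i. measure (measure_pmf q) {i}) sums measure (measure_pmf q) (\<Union>i. {i})"
      by (intro measure_pmf.finite_measure_UNION) (auto simp: disjoint_family_on_def)
    then have "(\<lambda>i. measure (measure_pmf q) {i}) sums measure (measure_pmf q) UNIV"
      by (simp only: UN_singleton)
    then have "pmf q sums 1"
      by (simp add: measure_pmf_single)
    then show ?thesis by (simp add: sums_def_le)
  qed
  then have "\<forall>\<^sub>F J in sequentially. 1 - \<delta> < (\<Sum>k\<le>J. pmf q k)"
    using d by (intro order_tendstoD(1)) auto
  \<comment> \<open>All but \<open>\<delta>\<close> of the mass of \<open>q\<close> lies below \<open>J\<close>, and so does nearly all the mass of \<open>p n\<close>.\<close>
  then obtain J where J: "1 - \<delta> < (\<Sum>k\<le>J. pmf q k)" by (auto simp: eventually_sequentially)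
  have "(\<lambda>n. \<Sum>k\<le>J. \<bar>pmf (p n) k - pmf q k\<bar>) \<longlonglongrightarrow> (\<Sum>k\<le>J. \<bar>pmf q k - pmf q k\<bar>)"
    by (intro tendsto_intros lim)
  then have "\<forall>\<^sub>F n in sequentially. (\<Sum>k\<le>J. \<bar>pmf (p n) k - pmf q k\<bar>) < \<delta>"
    using d by (intro order_tendstoD(2)) auto
  then obtain n0 where n0: "\<And>n. n \<ge> n0 \<Longrightarrow> (\<Sum>k\<le>J. \<bar>pmf (p n) k - pmf q k\<bar>) < \<delta>"
    by (auto simp: eventually_sequentially)
  have "\<bar>expect (p n) g - expect q g\<bar> \<le> \<epsilon>"
    if n: "n \<ge> n0" and g: "\<And>k. 0 \<le> g k \<and> g k \<le> 1" for n and g :: "nat \<Rightarrow> real"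
  proof -
    have "(\<Sum>k\<le>J. pmf q k) - (\<Sum>k\<le>J. pmf (p n) k) \<le> (\<Sum>k\<le>J. \<bar>pmf (p n) k - pmf q k\<bar>)"
      unfolding sum_subtractf[symmetric] by (intro sum_mono) auto
    moreover have "\<bar>(\<Sum>k\<le>J. pmf (p n) k * g k) - (\<Sum>k\<le>J. pmf q k * g k)\<bar> \<le> (\<Sum>k\<le>J. \<bar>pmf (p n) k - pmf q k\<bar>)"
    proof -
      have "\<bar>\<Sum>k\<le>J. pmf (p n) k * g k - pmf q k * g k\<bar> \<le> (\<Sum>k\<le>J. \<bar>pmf (p n) k * g k - pmf q k * g k\<bar>)"
        by (rule sum_abs)
      also have "\<dots> \<le> (\<Sum>k\<le>J. \<bar>pmf (p n) k - pmf q k\<bar>)"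
        using g by (intro sum_mono) (auto simp: left_diff_distrib[symmetric] abs_mult intro!: mult_left_le)
      finally show ?thesis by (simp add: sum_subtractf)
    qed
    ultimately show ?thesis
      using split[of g "p n" J, OF g] split[of g q J, OF g] n0[OF n] J unfolding \<delta>_def by linarith
  qed
  then show ?thesis by blast
qed

lemma binomial_tendsto_poisson:
  assumes c: "c > 0"
  shows "(\<lambda>n. pmf (binomial_pmf (n - d) (c / real n)) k) \<longlonglongrightarrow> pmf (poisson_pmf c) k"
proof -
  have one: "(\<lambda>n. (real n - a) / real n) \<longlonglongrightarrow> 1" for a
  proof -
    have "(\<lambda>n. 1 - a * inverse (real n)) \<longlonglongrightarrow> 1 - a * 0"
      by (intro tendsto_intros lim_inverse_n)
    moreover have "\<forall>\<^sub>F n in sequentially. 1 - a * inverse (real n) = (real n - a) / real n"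
      using eventually_gt_at_top[of 0] by eventually_elim (simp add: field_simps)
    ultimately show ?thesis by (simp add: filterlim_cong)
  qed
  have "(\<lambda>n. \<Prod>i=0..<k. (real n - real (d + i)) / real n / real (k - i)) \<longlonglongrightarrow> (\<Prod>i=0..<k. 1 / real (k - i))"
    by (intro tendsto_prod tendsto_divide one tendsto_const) auto
  also have "(\<Prod>i=0..<k. 1 / real (k - i)) = 1 / fact k"
    by (simp add: prod_dividef fact_prod_rev)
  finally have L1: "(\<lambda>n. \<Prod>i=0..<k. (real n - real (d + i)) / real n / real (k - i)) \<longlonglongrightarrow> 1 / fact k" .
  have L2: "(\<lambda>n. (1 + (- c) / real n) ^ n) \<longlonglongrightarrow> exp (- c)"
    by (rule tendsto_exp_limit_sequentially)
  have L3: "(\<lambda>n. ((real n - c) / real n) ^ (d + k)) \<longlonglongrightarrow> 1 ^ (d + k)"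
    by (intro tendsto_intros one)
  have "(\<lambda>n. (\<Prod>i=0..<k. (real n - real (d + i)) / real n / real (k - i)) * c ^ k
        * ((1 + (- c) / real n) ^ n / ((real n - c) / real n) ^ (d + k))) \<longlonglongrightarrow> 1 / fact k * c ^ k * (exp (- c) / 1 ^ (d + k))"
    by (intro tendsto_mult tendsto_divide L1 L2 L3 tendsto_const) simp
  moreover have "\<forall>\<^sub>F n in sequentially. (\<Prod>i=0..<k. (real n - real (d + i)) / real n / real (k - i)) * c ^ k
        * ((1 + (- c) / real n) ^ n / ((real n - c) / real n) ^ (d + k)) = pmf (binomial_pmf (n - d) (c / real n)) k"
    using eventually_gt_at_top[of "d + k + nat \<lceil>c\<rceil>"]
  proof eventually_elim
    case (elim n)
    then have n: "real n > c" "n > d + k" "n > 0" using c by linarith+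
    have p: "0 \<le> c / real n" "c / real n \<le> 1" using n c by auto
    have "real (n - d choose k) = (\<Prod>i=0..<k. real (n - d - i) / real (k - i))"
      using n by (intro binomial_altdef_of_nat) auto
    also have "\<dots> = (\<Prod>i=0..<k. (real n - real (d + i)) / real (k - i))"
      using n by (intro prod.cong refl) (auto simp: of_nat_diff)
    finally have 1: "real (n - d choose k) / real n ^ k = (\<Prod>i=0..<k. (real n - real (d + i)) / real n / real (k - i))"
      by (simp add: prod_dividef prod.distrib)
    have b: "1 - c / real n = 1 + (- c) / real n" "(real n - c) / real n = 1 - c / real n" "1 - c / real n \<noteq> 0"
      using n by (auto simp: field_simps)
    have "n = (n - d - k) + (d + k)" using n by auto
    then have "(1 - c / real n) ^ n = (1 - c / real n) ^ (n - d - k) * (1 - c / real n) ^ (d + k)"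
      by (metis power_add)
    moreover have "(1 - c / real n) ^ (d + k) \<noteq> 0" by (rule power_not_zero[OF b(3)])
    ultimately have "(1 - c / real n) ^ n / (1 - c / real n) ^ (d + k) = (1 - c / real n) ^ (n - d - k)"
      by (metis nonzero_mult_div_cancel_right)
    then have 2: "(1 + (- c) / real n) ^ n / ((real n - c) / real n) ^ (d + k) = (1 - c / real n) ^ (n - d - k)"
      unfolding b(1)[symmetric] b(2) .
    show ?case
      unfolding 2 1[symmetric] using p by (simp add: power_divide)
  qed
  ultimately have "(\<lambda>n. pmf (binomial_pmf (n - d) (c / real n)) k) \<longlonglongrightarrow> 1 / fact k * c ^ k * (exp (- c) / 1 ^ (d + k))"
    by (rule Lim_transform_eventually)
  then show ?thesis using c by simp
qed

section \<open>Local convergence to a Poisson tree\<close>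

text \<open>
  The law of \<open>local_val\<close> at the root of the limiting tree, in which each cell lies in a Poisson number of
  further faces and each of these has \<open>d\<close> further facets with independent subtrees.
\<close>

primrec tree_law :: "real \<Rightarrow> nat \<Rightarrow> ('b list list \<Rightarrow> 'b) \<Rightarrow> 'b \<Rightarrow> nat \<Rightarrow> 'b pmf" where
  "tree_law c d G b 0 = return_pmf b"
| "tree_law c d G b (Suc r) = bind_pmf (poisson_pmf c)
     (\<lambda>k. map_pmf G (replicate_pmf k (replicate_pmf d (tree_law c d G b r))))"

text \<open>
  Closeness of the joint law of local values to independent tree values, for roots of two consecutive
  depths. The mixture of depths makes an induction possible: revealing the star of a root of depth
  \<open>r + 1\<close> replaces it by its children, which are roots of depth \<open>r\<close>.
\<close>

definition close_at :: "real \<Rightarrow> nat \<Rightarrow> ('b list list \<Rightarrow> 'b) \<Rightarrow> 'b \<Rightarrow> nat \<Rightarrow> nat \<Rightarrow> nat \<Rightarrow> nat \<Rightarrow> real \<Rightarrow> bool" where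
  "close_at c d G b r a k n \<epsilon> \<longleftrightarrow> (\<forall>es fs. \<forall>f::'b list \<Rightarrow> 'b list \<Rightarrow> real.
     length es = a \<longrightarrow> length fs = k \<longrightarrow> set (es @ fs) \<subseteq> cells n d \<longrightarrow> distinct (es @ fs) \<longrightarrow>
     (\<forall>xs ys. 0 \<le> f xs ys \<and> f xs ys \<le> 1) \<longrightarrow>
     \<bar>EF d c n (\<lambda>X. f (map (\<lambda>e. local_val G b (Suc r) e X) es) (map (\<lambda>e. local_val G b r e X) fs))
      - expect (replicate_pmf a (tree_law c d G b (Suc r)))
          (\<lambda>xs. expect (replicate_pmf k (tree_law c d G b r)) (f xs))\<bar> \<le> \<epsilon>)"

definition close_law :: "real \<Rightarrow> nat \<Rightarrow> ('b list list \<Rightarrow> 'b) \<Rightarrow> 'b \<Rightarrow> nat \<Rightarrow> nat \<Rightarrow> nat \<Rightarrow> bool" where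
  "close_law c d G b r a k \<longleftrightarrow> (\<forall>\<epsilon>>0. \<exists>n0. \<forall>n\<ge>n0. close_at c d G b r a k n \<epsilon>)"

text \<open>
  Passes from the values at the children, listed as further roots, back to one group for each face.
\<close>

primrec chunks :: "nat \<Rightarrow> nat \<Rightarrow> 'b list \<Rightarrow> 'b list list" where
  "chunks 0 d ys = []"
| "chunks (Suc j) d ys = take d ys # chunks j d (drop d ys)"

lemma chunks_concat:
  "(\<And>zs. zs \<in> set zss \<Longrightarrow> length zs = d) \<Longrightarrow> chunks (length zss) d (concat zss @ ys) = zss"
  by (induction zss) auto

lemma drop_concat:
  "(\<And>zs. zs \<in> set zss \<Longrightarrow> length zs = d) \<Longrightarrow> drop (length zss * d) (concat zss @ ys) = ys"
  by (induction zss) auto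

lemma replicate_pmf_flatten:
  "replicate_pmf (j * d + k) p
    = bind_pmf (replicate_pmf j (replicate_pmf d p)) (\<lambda>zss. map_pmf (\<lambda>ys. concat zss @ ys) (replicate_pmf k p))"
proof (induction j)
  case 0
  show ?case by (simp add: bind_return_pmf map_pmf_def bind_return_pmf')
next
  case (Suc j)
  have "replicate_pmf (Suc j * d + k) p = replicate_pmf (d + (j * d + k)) p" by (simp add: add.assoc)
  also have "\<dots> = bind_pmf (replicate_pmf d p) (\<lambda>zs. bind_pmf (replicate_pmf (j * d + k) p) (\<lambda>ys. return_pmf (zs @ ys)))"
    by (rule replicate_pmf_distrib)
  finally show ?case
    by (simp add: Suc bind_assoc_pmf bind_return_pmf map_pmf_def)
qed

lemma expectation_swap:
  fixes f :: "'a \<Rightarrow> 'b \<Rightarrow> real"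
  assumes "\<And>x y. x \<in> set_pmf p \<Longrightarrow> y \<in> set_pmf q \<Longrightarrow> \<bar>f x y\<bar> \<le> B"
  shows "expect p (\<lambda>x. expect q (f x))
    = expect q (\<lambda>y. expect p (\<lambda>x. f x y))"
proof -
  have "expect p (\<lambda>x. expect q (f x))
      = expect (pair_pmf p q) (\<lambda>(x, y). f x y)"
    by (subst expectation_pair[where B = B]) (use assms in auto)
  also have "pair_pmf p q = map_pmf (\<lambda>(y, x). (x, y)) (pair_pmf q p)"
    by (rule pair_commute_pmf)
  also have "expect (map_pmf (\<lambda>(y, x). (x, y)) (pair_pmf q p)) (\<lambda>(x, y). f x y)
      = expect (pair_pmf q p) (\<lambda>(y, x). f x y)"
    by (simp add: case_prod_unfold)
  also have "\<dots> = expect q (\<lambda>y. expect p (\<lambda>x. f x y))"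
    by (subst expectation_pair[where B = B]) (use assms in auto)
  finally show ?thesis .
qed

lemma expectation_01:
  fixes f :: "'a \<Rightarrow> real"
  assumes "\<And>x. 0 \<le> f x \<and> f x \<le> 1"
  shows "0 \<le> expect p f \<and> expect p f \<le> 1"
proof -
  have "expect p f \<le> expect p (\<lambda>_. 1)"
    using assms by (intro expectation_mono integrable_pmf_bounded[where B = 1]) auto
  then show ?thesis using assms by simp
qed

definition children :: "'a::linorder set \<Rightarrow> 'a set \<Rightarrow> 'a set list list" where
  "children e V = map (\<lambda>v. map (flip e v) (sorted_list_of_set e)) (sorted_list_of_set V)"

lemma local_val_Suc:
  "local_val G b (Suc r) e X = G (map (map (\<lambda>g. local_val G b r g (del e X))) (children e (link e X)))"
  by (simp add: children_def comp_def)

declare local_val.simps(2) [simp del]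

text \<open>
  The limit value when one root of depth \<open>r + 1\<close> is known to have \<open>j\<close> faces: its \<open>j * d\<close> children have
  been added to the roots of depth \<open>r\<close>.
\<close>

definition unfolded :: "real \<Rightarrow> nat \<Rightarrow> ('b list list \<Rightarrow> 'b) \<Rightarrow> 'b \<Rightarrow> nat \<Rightarrow> nat \<Rightarrow> nat
    \<Rightarrow> ('b list \<Rightarrow> 'b list \<Rightarrow> real) \<Rightarrow> nat \<Rightarrow> real" where
  "unfolded c d G b r a k f j = expect (replicate_pmf a (tree_law c d G b (Suc r)))
     (\<lambda>xs. expect (replicate_pmf (j * d + k) (tree_law c d G b r))
        (\<lambda>ys. f (G (chunks j d ys) # xs) (drop (j * d) ys)))"

lemma expectation_unfolded:
  assumes f: "\<And>xs ys. 0 \<le> f xs ys \<and> f xs ys \<le> 1"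
  shows "expect (poisson_pmf c) (unfolded c d G b r a k f)
    = expect (replicate_pmf (Suc a) (tree_law c d G b (Suc r)))
          (\<lambda>xs. expect (replicate_pmf k (tree_law c d G b r)) (f xs))"
proof -
  let ?L = "tree_law c d G b r" and ?L' = "tree_law c d G b (Suc r)"
  let ?E = "expect"
  have fb: "\<bar>f xs ys\<bar> \<le> 1" for xs ys using f[of xs ys] by auto
  have b1: "\<bar>?E p (f xs)\<bar> \<le> 1" for p xs by (rule expectation_abs_le) (rule fb)
  have b2: "\<bar>?E q (\<lambda>xs. ?E p (f (h xs)))\<bar> \<le> 1" for p and q :: "'c pmf" and h
    by (rule expectation_abs_le) (rule b1)
  have unf: "unfolded c d G b r a k f j
    = ?E (replicate_pmf j (replicate_pmf d ?L)) (\<lambda>zss. ?E (replicate_pmf a ?L') (\<lambda>xs. ?E (replicate_pmf k ?L) (f (G zss # xs))))" for j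
  proof -
    have "unfolded c d G b r a k f j
      = ?E (replicate_pmf a ?L') (\<lambda>xs. ?E (replicate_pmf j (replicate_pmf d ?L)) (\<lambda>zss. ?E (replicate_pmf k ?L)
            (\<lambda>ys. f (G (chunks j d (concat zss @ ys)) # xs) (drop (j * d) (concat zss @ ys)))))"
      unfolding unfolded_def replicate_pmf_flatten
      by (subst expectation_bind[where B = 1]) (auto simp: fb)
    also have "\<dots> = ?E (replicate_pmf a ?L') (\<lambda>xs. ?E (replicate_pmf j (replicate_pmf d ?L)) (\<lambda>zss. ?E (replicate_pmf k ?L)
            (f (G zss # xs))))"
    proof (intro expectation_cong)
      fix zss xs ys assume "zss \<in> set_pmf (replicate_pmf j (replicate_pmf d ?L))"
      then have z: "length zss = j" "\<And>zs. zs \<in> set zss \<Longrightarrow> length zs = d"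
        by (auto simp: set_replicate_pmf)
      show "f (G (chunks j d (concat zss @ ys)) # xs) (drop (j * d) (concat zss @ ys)) = f (G zss # xs) ys"
        using chunks_concat[of zss d ys, OF z(2)] drop_concat[of zss d ys, OF z(2)] z(1) by simp
    qed
    also have "\<dots> = ?E (replicate_pmf j (replicate_pmf d ?L)) (\<lambda>zss. ?E (replicate_pmf a ?L') (\<lambda>xs. ?E (replicate_pmf k ?L) (f (G zss # xs))))"
      by (rule expectation_swap[where B = 1]) (rule b1)
    finally show ?thesis .
  qed
  have "?E (replicate_pmf (Suc a) ?L') (\<lambda>xs. ?E (replicate_pmf k ?L) (f xs))
      = ?E ?L' (\<lambda>x. ?E (replicate_pmf a ?L') (\<lambda>xs. ?E (replicate_pmf k ?L) (f (x # xs))))"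
    by (rule expectation_replicate_Suc[where B = 1]) (rule b1)
  also have "\<dots> = ?E (poisson_pmf c) (\<lambda>j. ?E (map_pmf G (replicate_pmf j (replicate_pmf d ?L)))
      (\<lambda>x. ?E (replicate_pmf a ?L') (\<lambda>xs. ?E (replicate_pmf k ?L) (f (x # xs)))))"
    unfolding tree_law.simps(2)[of c d G b r] by (rule expectation_bind[where B = 1]) (rule b2)
  finally show ?thesis unfolding unf integral_map_pmf by (rule sym)
qed

lemma children_distinct:
  assumes e: "finite e" and V: "V \<inter> e = {}"
  shows "distinct (concat (children e V))"
proof -
  let ?vs = "sorted_list_of_set V" and ?us = "sorted_list_of_set e"
  have "concat (children e V) = map (\<lambda>(v, u). flip e v u) (List.product ?vs ?us)"
    unfolding children_def by (induction ?vs arbitrary: V) (auto simp: product_concat_map map_concat comp_def)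
  moreover have "inj_on (\<lambda>(v, u). flip e v u) (set (List.product ?vs ?us))"
  proof (rule inj_onI, clarify)
    fix v u v' u' assume "(v, u) \<in> set (List.product ?vs ?us)" "(v', u') \<in> set (List.product ?vs ?us)"
      and eq: "flip e v u = flip e v' u'"
    then have "v \<in> V" "v' \<in> V" "u \<in> e" "u' \<in> e"
      using e by (auto, (cases "finite V"; simp)+)
    then show "v = v' \<and> u = u'" using flip_inj[of v e u v' u'] eq V by auto
  qed
  ultimately show ?thesis by (simp add: distinct_map distinct_product)
qed

lemma set_children:
  assumes "finite e" "finite V"
  shows "set (concat (children e V)) = {flip e v u |v u. v \<in> V \<and> u \<in> e}"
  using assms by (auto simp: children_def)

lemma length_children:
  assumes "finite V"
  shows "length (children e V) = card V" "\<And>zs. zs \<in> set (children e V) \<Longrightarrow> length zs = card e"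
    "length (concat (children e V)) = card V * card e"
proof -
  show 1: "length (children e V) = card V" "\<And>zs. zs \<in> set (children e V) \<Longrightarrow> length zs = card e"
    using assms by (auto simp: children_def)
  have "length (concat zss) = length zss * m" if "\<And>zs. zs \<in> set zss \<Longrightarrow> length zs = m" for zss :: "'x list list" and m
    using that by (induction zss) auto
  then show "length (concat (children e V)) = card V * card e" using 1 by metis
qed

lemma EF_add: "EF d c n (\<lambda>X. f X + g X) = EF d c n f + EF d c n g"
  by simp

lemma EF_sum: "EF d c n (\<lambda>X. \<Sum>i\<in>I. f i X) = (\<Sum>i\<in>I. EF d c n (f i))"
  by (rule Bochner_Integration.integral_sum) simp

lemma EF_card_link_le:
  assumes e: "e \<in> cells n d" and n: "0 < n" and c: "0 \<le> c" "c \<le> real n"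
  shows "EF d c n (\<lambda>X. real (card (link e X))) \<le> c"
proof -
  have p: "0 \<le> c / real n" "c / real n \<le> 1" using c by (auto simp: divide_le_eq_1)
  have sub: "star n e \<subseteq> cells n (Suc d)" using e by (auto simp: star_def cells_def)
  have "EF d c n (\<lambda>X. real (card (link e X))) = EF d c n (\<lambda>X. real (card (X \<inter> star n e)))"
    using card_link[OF e] set_random_faces by (intro expectation_cong) auto
  also have "\<dots> = expect (random_subset (star n e) (c / real n)) (\<lambda>X. real (card X))"
    unfolding random_faces_def random_subset_Int[OF finite_cells sub, symmetric] by simp
  also have "\<dots> = c / real n * real (n - d)"
    using expectation_card_random_subset[of "star n e"] p card_star[OF e] finite_subset[OF sub] by simp
  also have "\<dots> \<le> c / real n * real n" using p by (intro mult_left_mono) auto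
  finally show ?thesis using n by simp
qed

lemma PF_link_meets_le:
  assumes e: "e \<in> cells n d" and n: "0 < n" and c: "0 \<le> c" "c \<le> real n" and B: "finite B" "B \<inter> e = {}"
  shows "PF d c n (\<lambda>X. link e X \<inter> B \<noteq> {}) \<le> real (card B) * (c / real n)"
proof -
  have p: "0 \<le> c / real n" "c / real n \<le> 1" using c by (auto simp: divide_le_eq_1)
  have "PF d c n (\<lambda>X. link e X \<inter> B \<noteq> {}) \<le> PF d c n (\<lambda>X. \<exists>v\<in>B \<inter> {..<n}. {insert v e} \<subseteq> X)"
  proof (rule PF_mono)
    fix X assume X: "X \<subseteq> cells n (Suc d)" and "link e X \<inter> B \<noteq> {}"
    then obtain v where "v \<in> link e X" "v \<in> B \<inter> {..<n}" using link_less[OF X] by auto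
    then show "\<exists>v\<in>B \<inter> {..<n}. {insert v e} \<subseteq> X" by (auto simp: link_def)
  qed
  also have "\<dots> \<le> (\<Sum>v\<in>B \<inter> {..<n}. PF d c n (\<lambda>X. {insert v e} \<subseteq> X))"
    by (rule PF_union) (use B in simp)
  also have "\<dots> = (\<Sum>v\<in>B \<inter> {..<n}. c / real n)"
  proof (rule sum.cong[OF refl])
    fix v assume "v \<in> B \<inter> {..<n}"
    then have "{insert v e} \<subseteq> cells n (Suc d)" using insert_cells[OF e, of v] B by auto
    then show "PF d c n (\<lambda>X. {insert v e} \<subseteq> X) = c / real n"
      unfolding random_faces_def using prob_subset_random_subset[OF finite_cells, of "{insert v e}" n "Suc d"] p by simp
  qed
  also have "\<dots> = real (card (B \<inter> {..<n})) * (c / real n)" by simp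
  also have "\<dots> \<le> real (card B) * (c / real n)"
    using B p by (intro mult_right_mono) (auto intro!: card_mono)
  finally show ?thesis .
qed

lemma EF_diff_le:
  assumes "\<And>X. X \<subseteq> cells n (Suc d) \<Longrightarrow> \<bar>f X - g X\<bar> \<le> h X"
  shows "\<bar>EF d c n f - EF d c n g\<bar> \<le> EF d c n h"
proof -
  have "EF d c n f - EF d c n g \<le> EF d c n h" "EF d c n g - EF d c n f \<le> EF d c n h"
    unfolding Bochner_Integration.integral_diff[OF integrable_random_faces integrable_random_faces, symmetric]
    using assms by (intro EF_mono; force simp: abs_le_iff)+
  then show ?thesis by (simp add: abs_le_iff)
qed

text \<open>
  The star of \<open>e\<close> is independent of the other faces, so the link of \<open>e\<close> may be taken from a second,
  independent complex \<open>Y\<close>.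
\<close>

lemma EF_link_decouple:
  assumes e: "e \<in> cells n d"
  shows "EF d c n (\<lambda>X. H (link e X) (del e X)) = EF d c n (\<lambda>Y. EF d c n (\<lambda>X. H (link e Y) (del e X)))"
proof -
  have sS: "star n e \<subseteq> cells n (Suc d)" using e by (auto simp: star_def cells_def)
  have lk: "link e (Y \<inter> star n e) = link e Y" if "Y \<subseteq> cells n (Suc d)" for Y
    using that e by (auto simp: link_def star_def cells_def)
  have dl: "X - star n e = del e X" if "X \<subseteq> cells n (Suc d)" for X
    by (rule del_eq_star[OF e that, symmetric])
  have "EF d c n (\<lambda>X. H (link e X) (del e X)) = EF d c n (\<lambda>X. H (link e (X \<inter> star n e)) (X - star n e))"
    using set_random_faces by (intro expectation_cong) (simp add: lk dl)
  also have "\<dots> = EF d c n (\<lambda>Y. EF d c n (\<lambda>X. H (link e (Y \<inter> star n e)) (X - star n e)))"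
    unfolding random_faces_def
    by (rule expectation_decouple[OF finite_cells sS, of _ "\<lambda>U Z. H (link e U) Z"])
  also have "\<dots> = EF d c n (\<lambda>Y. EF d c n (\<lambda>X. H (link e Y) (del e X)))"
    using set_random_faces by (intro expectation_cong) (simp add: lk dl)
  finally show ?thesis .
qed

text \<open>
  Peeling off the root \<open>e\<close>. Up to an event of probability \<open>O(1 / n)\<close> the other roots do not reach \<open>e\<close>, so
  all values can be computed from the link of \<open>e\<close> and from \<open>del e X\<close>, which are independent. For a fixed
  link \<open>V\<close> the star of \<open>e\<close> may be put back, since the children do not reach \<open>e\<close> either, and the hypothesis
  applies to the children of \<open>e\<close> together with the remaining roots. These cells are distinct if \<open>V\<close> avoids
  the vertices of the remaining roots, and the error is uniform over \<open>V\<close> of bounded size; a link of large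
  size is unlikely by Markov's inequality. Finally the degree of \<open>e\<close> is nearly a Poisson variable.
\<close>

lemma close_law_step:
  fixes G :: "'b list list \<Rightarrow> 'b"
  assumes c: "0 < c" and IH: "\<And>k'. close_law c d G b r a k'"
  shows "close_law c d G b r (Suc a) k"
  unfolding close_law_def
proof (intro allI impI)
  fix \<epsilon> :: real assume "\<epsilon> > 0"
  define \<delta> where "\<delta> = \<epsilon> / 4"
  have \<delta>: "\<delta> > 0" using \<open>\<epsilon> > 0\<close> by (simp add: \<delta>_def)
  let ?L = "tree_law c d G b r" and ?L' = "tree_law c d G b (Suc r)"
  let ?T = "local_val G b r" and ?T' = "local_val G b (Suc r)"
  obtain C0 where C0: "C0 \<ge> 0" "\<And>n e e'. 0 < n \<Longrightarrow> c \<le> real n \<Longrightarrow> e \<in> cells n d \<Longrightarrow> e' \<in> cells n d \<Longrightarrow>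
      e' \<noteq> e \<Longrightarrow> PF d c n (\<lambda>X. e' \<in> reach r e X) \<le> C0 / real n"
    using reach_prob[of c d r] c by auto
  obtain C1 where C1: "C1 \<ge> 0" "\<And>n e e'. 0 < n \<Longrightarrow> c \<le> real n \<Longrightarrow> e \<in> cells n d \<Longrightarrow> e' \<in> cells n d \<Longrightarrow>
      e' \<noteq> e \<Longrightarrow> PF d c n (\<lambda>X. e' \<in> reach (Suc r) e X) \<le> C1 / real n"
    using reach_prob[of c d "Suc r"] c by auto
  define C where "C = C0 + C1"
  have C: "C \<ge> 0" using C0 C1 by (simp add: C_def)
  \<comment> \<open>Links with more than \<open>J\<close> vertices are rare, and only finitely many sizes remain for the hypothesis.\<close>
  define J where "J = nat \<lceil>c / \<delta>\<rceil> + 1"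
  have J: "c / real J \<le> \<delta>" "J > 0"
  proof -
    show "J > 0" by (simp add: J_def)
    have "c / \<delta> \<le> real J" by (simp add: J_def) linarith
    then show "c / real J \<le> \<delta>" using \<delta> \<open>J > 0\<close> by (simp add: field_simps)
  qed
  \<comment> \<open>Collects the errors of order \<open>1 / n\<close>.\<close>
  define M where "M = real (a + k) * C + (real d * c + real (a + k)) * C + real ((a + k) * d) * c"
  have "\<forall>j. \<exists>n0. \<forall>n\<ge>n0. close_at c d G b r a (j * d + k) n \<delta>"
    using IH \<delta> unfolding close_law_def by blast
  then obtain N where N: "\<And>j n. n \<ge> N j \<Longrightarrow> close_at c d G b r a (j * d + k) n \<delta>"
    by metis
  obtain N' where N': "\<And>n g. n \<ge> N' \<Longrightarrow> (\<And>k::nat. 0 \<le> g k \<and> g k \<le> (1::real)) \<Longrightarrow>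
     \<bar>expect (binomial_pmf (n - d) (c / real n)) g - expect (poisson_pmf c) g\<bar> \<le> \<delta>"
    using pmf_nat_limit_uniform[OF binomial_tendsto_poisson[OF c, of d] \<delta>] by blast
  define n0 where "n0 = Max (N ` {..J}) + N' + nat \<lceil>c\<rceil> + nat \<lceil>M / \<delta>\<rceil> + 1"
  show "\<exists>n0. \<forall>n\<ge>n0. close_at c d G b r (Suc a) k n \<epsilon>"
    unfolding close_at_def
  proof (intro exI[of _ n0] allI impI)
    fix n es0 fs and f :: "'b list \<Rightarrow> 'b list \<Rightarrow> real"
    assume n: "n0 \<le> n" and len: "length es0 = Suc a" "length fs = k"
      and sub0: "set (es0 @ fs) \<subseteq> cells n d" and dist0: "distinct (es0 @ fs)"
      and f: "\<forall>xs ys. 0 \<le> f xs ys \<and> f xs ys \<le> 1"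
    obtain e es where es0: "es0 = e # es" "length es = a" using len(1) by (auto simp: length_Suc_conv)
    have e: "e \<in> cells n d" and sub: "set (es @ fs) \<subseteq> cells n d" and dist: "distinct (es @ fs)"
      and nin: "e \<notin> set es" "e \<notin> set fs"
      using sub0 dist0 by (auto simp: es0)
    have fine: "finite e" and carde: "card e = d" using e cells_finite[OF e] by (auto simp: cells_def)
    have nb: "n > 0" "c \<le> real n" "n \<ge> N'" "M / \<delta> \<le> real n" using n unfolding n0_def by linarith+
    have nN: "n \<ge> N j" if "j \<le> J" for j
    proof -
      have "N j \<le> Max (N ` {..J})" using that by (intro Max_ge) auto
      then show ?thesis using n unfolding n0_def by linarith
    qed
    have M: "M / real n \<le> \<delta>" using nb \<delta> by (simp add: field_simps)
    have Cn: "C / real n \<ge> 0" using C by simp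
    define F where "F = (\<lambda>X. f (map (\<lambda>e. ?T' e X) es0) (map (\<lambda>e. ?T e X) fs))"
    \<comment> \<open>The test function with \<open>V\<close> in place of the link of \<open>e\<close> and all other values computed in \<open>Z\<close>.\<close>
    define H where "H = (\<lambda>V Z. f (G (map (map (\<lambda>g. ?T g Z)) (children e V)) # map (\<lambda>g. ?T' g Z) es) (map (\<lambda>g. ?T g Z) fs))"
    define val where "val = unfolded c d G b r a k f"
    have F01: "0 \<le> F X \<and> F X \<le> 1" for X using f by (simp add: F_def)
    have H01: "0 \<le> H V X \<and> H V X \<le> 1" for V X using f by (simp add: H_def)
    have val01: "0 \<le> val j \<and> val j \<le> 1" for j
      unfolding val_def unfolded_def using f by (intro expectation_01) auto
    \<comment> \<open>The star of \<open>e\<close> is visible from another root or from a child of \<open>e\<close> at a link \<open>V\<close>; the choice \<open>V = {}\<close> leaves the other roots.\<close>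
    define R where "R = (\<lambda>V X. (\<exists>g\<in>set (concat (children e V)) \<union> set fs. e \<in> reach r g X) \<or> (\<exists>g\<in>set es. e \<in> reach (Suc r) g X))"
    have other: "finite g \<and> card e = card g" if "g \<in> cells n d" for g
      using that cells_finite[OF that] carde by (auto simp: cells_def)
    have chcells: "set (concat (children e V)) \<subseteq> cells n d" "e \<notin> set (concat (children e V))"
      if "V \<subseteq> {..<n} - e" for V
    proof -
      have fV: "finite V" using that finite_subset by blast
      show "set (concat (children e V)) \<subseteq> cells n d"
        unfolding set_children[OF fine fV] using that flip_cells[OF e] by auto
      show "e \<notin> set (concat (children e V))"
        unfolding set_children[OF fine fV] using that flip_neq[of _ e] by blast
    qed
    have loc: "local_val G b s g (del e X) = local_val G b s g X" if "g \<in> cells n d" "e \<notin> reach s g X" for s g X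
      using other[OF that(1)] that(2) by (intro unreached_del(2)) auto
    have fixed: "map (\<lambda>g. ?T' g (del e X)) es = map (\<lambda>g. ?T' g X) es" "map (\<lambda>g. ?T g (del e X)) fs = map (\<lambda>g. ?T g X) fs"
      if "\<not> R V X" for V X
      using that sub by (auto simp: R_def simp del: reach.simps intro!: loc)
    have HR: "H V (del e X) = H V X" if "\<not> R V X" "V \<subseteq> {..<n} - e" for V X
    proof -
      have "map (map (\<lambda>g. ?T g (del e X))) (children e V) = map (map (\<lambda>g. ?T g X)) (children e V)"
        using that(1) chcells(1)[OF that(2)] by (fastforce simp: R_def simp del: reach.simps intro!: loc)
      then show ?thesis by (simp only: H_def fixed[OF that(1)])
    qed
    have FR: "F X = H (link e X) (del e X)" if "\<not> R {} X" for X
      by (simp only: H_def F_def es0 list.map local_val_Suc[of G b r e X] fixed[OF that])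
    have PR: "PF d c n (\<lambda>X. R V X) \<le> (real d * real (card V) + real (a + k)) * (C / real n)"
      if V: "V \<subseteq> {..<n} - e" for V
    proof -
      have fV: "finite V" using that finite_subset by blast
      let ?A = "set (concat (children e V)) \<union> set fs"
      have "PF d c n (\<lambda>X. R V X) \<le> PF d c n (\<lambda>X. \<exists>g\<in>?A. e \<in> reach r g X) + PF d c n (\<lambda>X. \<exists>g\<in>set es. e \<in> reach (Suc r) g X)"
        unfolding R_def by (rule PF_disj)
      also have "\<dots> \<le> (\<Sum>g\<in>?A. PF d c n (\<lambda>X. e \<in> reach r g X)) + (\<Sum>g\<in>set es. PF d c n (\<lambda>X. e \<in> reach (Suc r) g X))"
        by (intro add_mono PF_union) auto
      also have "\<dots> \<le> (\<Sum>g\<in>?A. C / real n) + (\<Sum>g\<in>set es. C / real n)"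
      proof (intro add_mono sum_mono)
        fix g assume g: "g \<in> ?A"
        then have "g \<in> cells n d" "e \<noteq> g" using chcells[OF V] sub nin by auto
        then have "PF d c n (\<lambda>X. e \<in> reach r g X) \<le> C0 / real n" using nb e by (intro C0(2)) auto
        also have "\<dots> \<le> C / real n" using C1 by (intro divide_right_mono) (auto simp: C_def)
        finally show "PF d c n (\<lambda>X. e \<in> reach r g X) \<le> C / real n" .
      next
        fix g assume g: "g \<in> set es"
        then have "g \<in> cells n d" "e \<noteq> g" using sub nin by auto
        then have "PF d c n (\<lambda>X. e \<in> reach (Suc r) g X) \<le> C1 / real n" using nb e by (intro C1(2)) auto
        also have "\<dots> \<le> C / real n" using C0 by (intro divide_right_mono) (auto simp: C_def)
        finally show "PF d c n (\<lambda>X. e \<in> reach (Suc r) g X) \<le> C / real n" .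
      qed
      also have "\<dots> = (real (card ?A) + real (card (set es))) * (C / real n)" by (simp add: algebra_simps)
      also have "\<dots> \<le> (real d * real (card V) + real (a + k)) * (C / real n)"
      proof (intro mult_right_mono Cn)
        have "card ?A \<le> card (set (concat (children e V))) + card (set fs)" by (rule card_Un_le)
        also have "\<dots> \<le> card V * d + k"
          using card_length[of "concat (children e V)"] card_length[of fs]
            length_children(3)[OF fV, of e, unfolded carde] len(2) by linarith
        finally have "card ?A + card (set es) \<le> card V * d + k + a" using card_length[of es] es0 by linarith
        then have "real (card ?A + card (set es)) \<le> real (card V * d + k + a)" by (rule of_nat_mono)
        then show "real (card ?A) + real (card (set es)) \<le> real d * real (card V) + real (a + k)" by (simp add: mult.commute)
      qed
      finally show ?thesis .
    qed
    \<comment> \<open>A link that avoids these vertices has children different from all other roots.\<close>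
    define bad where "bad = \<Union>(set (es @ fs)) - e"
    have bad: "finite bad" "bad \<inter> e = {}" "card bad \<le> (a + k) * d"
    proof -
      have fg: "finite g" if "g \<in> set (es @ fs)" for g using that sub cells_finite by blast
      then have fU: "finite (\<Union>g\<in>set (es @ fs). g)" by (intro finite_UN_I) auto
      then show "finite bad" unfolding bad_def by simp
      show "bad \<inter> e = {}" by (auto simp: bad_def)
      have "card bad \<le> card (\<Union>g\<in>set (es @ fs). g)"
        using fU by (intro card_mono) (auto simp: bad_def)
      also have "\<dots> \<le> (\<Sum>g\<in>set (es @ fs). card g)" by (rule card_UN_le) auto
      also have "\<dots> = (\<Sum>g\<in>set (es @ fs). d)" using sub by (intro sum.cong) (auto simp: cells_def)
      also have "\<dots> \<le> (a + k) * d" using card_length[of "es @ fs"] es0 len by simp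
      finally show "card bad \<le> (a + k) * d" .
    qed
    have step4: "\<bar>EF d c n (H V) - val (card V)\<bar> \<le> \<delta>" if V: "V \<subseteq> {..<n} - e" "V \<inter> bad = {}" "card V \<le> J" for V
    proof -
      have fV: "finite V" using V finite_subset by blast
      let ?ch = "concat (children e V)" and ?j = "card V"
      define f' where "f' = (\<lambda>xs ys. f (G (chunks ?j d ys) # xs) (drop (?j * d) ys))"
      have chV: "g \<inter> V \<noteq> {}" if g: "g \<in> set ?ch" for g
        using g V unfolding set_children[OF fine fV] by (auto simp: flip_def)
      have other: "g \<inter> V = {}" if g: "g \<in> set (es @ fs)" for g
        using g V by (auto simp: bad_def)
      have A: "set (es @ ?ch @ fs) \<subseteq> cells n d" using chcells[OF V(1)] sub by auto
      have B: "distinct (es @ ?ch @ fs)"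
      proof -
        have "set ?ch \<inter> set (es @ fs) = {}" using chV other by blast
        moreover have "distinct ?ch" using V by (intro children_distinct[OF fine]) auto
        ultimately show ?thesis using dist unfolding distinct_append set_append by blast
      qed
      have L: "length (?ch @ fs) = ?j * d + k" using length_children(3)[OF fV, of e] len carde by simp
      have "\<bar>EF d c n (\<lambda>X. f' (map (\<lambda>e. ?T' e X) es) (map (\<lambda>e. ?T e X) (?ch @ fs)))
      - expect (replicate_pmf a ?L')
          (\<lambda>xs. expect (replicate_pmf (?j * d + k) ?L) (f' xs))\<bar> \<le> \<delta>"
        by (rule N[OF nN[OF V(3)], unfolded close_at_def, rule_format, OF es0(2) L A B]) (use f in \<open>simp add: f'_def\<close>)
      moreover have "f' (map (\<lambda>e. ?T' e X) es) (map (\<lambda>e. ?T e X) (?ch @ fs)) = H V X" for X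
      proof -
        let ?zss = "map (map (\<lambda>g. ?T g X)) (children e V)"
        have m: "map (\<lambda>e. ?T e X) (?ch @ fs) = concat ?zss @ map (\<lambda>e. ?T e X) fs" by (simp add: map_concat)
        have lz: "length ?zss = ?j" using length_children(1)[OF fV, of e] by simp
        have l: "length zs = d" if "zs \<in> set ?zss" for zs
          using that length_children(2)[OF fV, of _ e] carde by auto
        show ?thesis
          unfolding m f'_def H_def
          using chunks_concat[of ?zss d "map (\<lambda>e. ?T e X) fs", OF l] drop_concat[of ?zss d "map (\<lambda>e. ?T e X) fs", OF l]
          unfolding lz by simp
      qed
      ultimately show ?thesis unfolding val_def unfolded_def f'_def by simp
    qed
    have cnn: "0 \<le> c" using c by simp
    have s1: "\<bar>EF d c n F - EF d c n (\<lambda>X. H (link e X) (del e X))\<bar> \<le> real (a + k) * (C / real n)"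
    proof -
      have "\<bar>EF d c n F - EF d c n (\<lambda>X. H (link e X) (del e X))\<bar> \<le> PF d c n (\<lambda>X. R {} X)"
      proof (rule EF_diff_le)
        fix X
        show "\<bar>F X - H (link e X) (del e X)\<bar> \<le> of_bool (R {} X)"
        proof (cases "R {} X")
          case True
          then show ?thesis using F01[of X] H01[of "link e X" "del e X"] by (simp add: abs_le_iff)
        qed (simp add: FR)
      qed
      also have "\<dots> \<le> real (a + k) * (C / real n)" using PR[of "{}"] by simp
      finally show ?thesis .
    qed
    have s2: "EF d c n (\<lambda>X. H (link e X) (del e X)) = EF d c n (\<lambda>Y. EF d c n (\<lambda>X. H (link e Y) (del e X)))"
      by (rule EF_link_decouple[OF e])
    have s3: "\<bar>EF d c n (\<lambda>Y. EF d c n (\<lambda>X. H (link e Y) (del e X))) - EF d c n (\<lambda>Y. val (card (link e Y)))\<bar>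
       \<le> (real d * c + real (a + k)) * (C / real n) + \<delta> + c / real J + real ((a + k) * d) * (c / real n)"
    proof -
      have "\<bar>EF d c n (\<lambda>Y. EF d c n (\<lambda>X. H (link e Y) (del e X))) - EF d c n (\<lambda>Y. val (card (link e Y)))\<bar>
        \<le> EF d c n (\<lambda>Y. (real d * (C / real n) + 1 / real J) * real (card (link e Y)) + (real (a + k) * (C / real n) + \<delta>)
            + of_bool (link e Y \<inter> bad \<noteq> {}))"
      proof (rule EF_diff_le)
        fix Y assume Y: "Y \<subseteq> cells n (Suc d)"
        define V where "V = link e Y"
        have V: "V \<subseteq> {..<n} - e" using link_less[OF Y, of _ e] by (auto simp: V_def link_def)
        have "\<bar>EF d c n (\<lambda>X. H V (del e X)) - EF d c n (H V)\<bar> \<le> PF d c n (\<lambda>X. R V X)"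
        proof (rule EF_diff_le)
          fix X
          show "\<bar>H V (del e X) - H V X\<bar> \<le> of_bool (R V X)"
          proof (cases "R V X")
            case True
            then show ?thesis using H01[of V X] H01[of V "del e X"] by (simp add: abs_le_iff)
          qed (simp add: HR V)
        qed
        also have "\<dots> \<le> (real d * real (card V) + real (a + k)) * (C / real n)" by (rule PR[OF V])
        finally have 1: "\<bar>EF d c n (\<lambda>X. H V (del e X)) - EF d c n (H V)\<bar> \<le> (real d * real (card V) + real (a + k)) * (C / real n)" .
        have 2: "\<bar>EF d c n (H V) - val (card V)\<bar> \<le> \<delta> + 1 / real J * real (card V) + of_bool (V \<inter> bad \<noteq> {})"
        proof (cases "V \<inter> bad = {} \<and> card V \<le> J")
          case True
          then have "\<bar>EF d c n (H V) - val (card V)\<bar> \<le> \<delta>" using step4[OF V] by simp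
          then show ?thesis by (simp add: True add_increasing2)
        next
          case False
          have "0 \<le> EF d c n (H V) \<and> EF d c n (H V) \<le> 1" by (intro expectation_01 H01)
          then have "\<bar>EF d c n (H V) - val (card V)\<bar> \<le> 1" using val01[of "card V"] by (simp add: abs_le_iff)
          also have "1 \<le> \<delta> + 1 / real J * real (card V) + of_bool (V \<inter> bad \<noteq> {})"
          proof (cases "V \<inter> bad = {}")
            case True
            then have "real J \<le> real (card V)" using False by simp
            then have "1 \<le> 1 / real J * real (card V)" using J by (simp add: field_simps)
            then show ?thesis using \<delta> True by simp
          next
            case False
            have "0 \<le> 1 / real J * real (card V)" by simp
            then show ?thesis using False \<delta> by simp
          qed
          finally show ?thesis .
        qed
        have "\<bar>EF d c n (\<lambda>X. H V (del e X)) - val (card V)\<bar> \<le> (real d * real (card V) + real (a + k)) * (C / real n)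
           + (\<delta> + 1 / real J * real (card V) + of_bool (V \<inter> bad \<noteq> {}))" using 1 2 by linarith
        also have "\<dots> = (real d * (C / real n) + 1 / real J) * real (card V) + (real (a + k) * (C / real n) + \<delta>)
            + of_bool (V \<inter> bad \<noteq> {})" by (simp only: distrib_right distrib_left mult_ac add_ac)
        finally show "\<bar>EF d c n (\<lambda>X. H (link e Y) (del e X)) - val (card (link e Y))\<bar>
            \<le> (real d * (C / real n) + 1 / real J) * real (card (link e Y)) + (real (a + k) * (C / real n) + \<delta>)
            + of_bool (link e Y \<inter> bad \<noteq> {})" by (simp only: V_def)
      qed
      also have "\<dots> = (real d * (C / real n) + 1 / real J) * EF d c n (\<lambda>Y. real (card (link e Y))) + (real (a + k) * (C / real n) + \<delta>)
            + PF d c n (\<lambda>Y. link e Y \<inter> bad \<noteq> {})" by simp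
      also have "\<dots> \<le> (real d * (C / real n) + 1 / real J) * c + (real (a + k) * (C / real n) + \<delta>)
            + real ((a + k) * d) * (c / real n)"
      proof (intro add_mono mult_left_mono order_refl)
        show "EF d c n (\<lambda>Y. real (card (link e Y))) \<le> c" by (rule EF_card_link_le[OF e nb(1) cnn nb(2)])
        show "0 \<le> real d * (C / real n) + 1 / real J" using C by simp
        have "PF d c n (\<lambda>Y. link e Y \<inter> bad \<noteq> {}) \<le> real (card bad) * (c / real n)"
          by (rule PF_link_meets_le[OF e nb(1) cnn nb(2) bad(1,2)])
        also have "\<dots> \<le> real ((a + k) * d) * (c / real n)"
          using bad(3) cnn by (intro mult_right_mono of_nat_mono) auto
        finally show "PF d c n (\<lambda>Y. link e Y \<inter> bad \<noteq> {}) \<le> real ((a + k) * d) * (c / real n)" .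
      qed simp
      finally show ?thesis by (simp add: algebra_simps)
    qed
    have s4: "\<bar>EF d c n (\<lambda>Y. val (card (link e Y))) - expect (poisson_pmf c) val\<bar> \<le> \<delta>"
    proof -
      have "EF d c n (\<lambda>Y. val (card (link e Y))) = expect (binomial_pmf (n - d) (c / real n)) val"
        unfolding degree_distribution[OF e cnn nb(2), symmetric] by simp
      then show ?thesis using N'[OF nb(3), of val] val01 by simp
    qed
    have "expect (poisson_pmf c) val = expect (replicate_pmf (Suc a) ?L')
          (\<lambda>xs. expect (replicate_pmf k ?L) (f xs))"
      unfolding val_def by (rule expectation_unfolded) (use f in auto)
    moreover have "real (a + k) * (C / real n) + ((real d * c + real (a + k)) * (C / real n) + \<delta> + c / real J + real ((a + k) * d) * (c / real n)) + \<delta>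
      = M / real n + 2 * \<delta> + c / real J"
      by (simp add: M_def add_divide_distrib)
    moreover have "M / real n + 2 * \<delta> + c / real J \<le> \<epsilon>" using M J unfolding \<delta>_def by linarith
    ultimately show "\<bar>EF d c n (\<lambda>X. f (map (\<lambda>e. ?T' e X) es0) (map (\<lambda>e. ?T e X) fs))
      - expect (replicate_pmf (Suc a) ?L')
          (\<lambda>xs. expect (replicate_pmf k ?L) (f xs))\<bar> \<le> \<epsilon>"
      using s1 s2 s3 s4 unfolding F_def[symmetric] by linarith
  qed
qed

text \<open>
  With no roots of the larger depth, the statement at depth \<open>r + 1\<close> is the one at depth \<open>r\<close> with all
  roots moved to the other list.
\<close>

lemma close_law_0:
  assumes "\<And>k. close_law c d G b r k 0"
  shows "close_law c d G b (Suc r) 0 k"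
  unfolding close_law_def
proof (intro allI impI)
  fix \<epsilon> :: real assume "\<epsilon> > 0"
  then obtain n0 where n0: "\<And>n. n \<ge> n0 \<Longrightarrow> close_at c d G b r k 0 n \<epsilon>"
    using assms[of k] unfolding close_law_def by blast
  show "\<exists>n0. \<forall>n\<ge>n0. close_at c d G b (Suc r) 0 k n \<epsilon>"
    unfolding close_at_def
  proof (intro exI[of _ n0] allI impI)
    fix n es fs and f :: "'a list \<Rightarrow> 'a list \<Rightarrow> real"
    assume *: "n0 \<le> n" "length es = 0" "length fs = k" "set (es @ fs) \<subseteq> cells n d" "distinct (es @ fs)"
      "\<forall>xs ys. 0 \<le> f xs ys \<and> f xs ys \<le> 1"
    show "\<bar>EF d c n (\<lambda>X. f (map (\<lambda>e. local_val G b (Suc (Suc r)) e X) es) (map (\<lambda>e. local_val G b (Suc r) e X) fs))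
      - expect (replicate_pmf 0 (tree_law c d G b (Suc (Suc r))))
          (\<lambda>xs. expect (replicate_pmf k (tree_law c d G b (Suc r))) (f xs))\<bar> \<le> \<epsilon>"
      using n0[OF *(1), unfolded close_at_def, rule_format, of fs "[]" "\<lambda>xs ys. f [] xs"] *
      by (simp del: tree_law.simps)
  qed
qed

lemma close_law_base: "close_law c d G b 0 0 k"
proof -
  have "replicate_pmf k (return_pmf b) = return_pmf (replicate k b)"
    by (induction k) (simp_all add: bind_return_pmf)
  moreover have "map (\<lambda>e. b) fs = replicate (length fs) b" for fs :: "nat set list"
    by (rule map_replicate_const)
  ultimately show ?thesis
    unfolding close_law_def close_at_def by auto
qed

theorem close_law_all:
  assumes c: "0 < c"
  shows "close_law c d G b r a k"
proof -
  have "\<forall>k. close_law c d G b r 0 k \<and> close_law c d G b r a k" for a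
  proof (induction r arbitrary: a)
    case 0
    show ?case
    proof (induction a)
      case (Suc a)
      then show ?case using close_law_step[OF c, of d G b 0 a] close_law_base by blast
    qed (simp add: close_law_base)
  next
    case (Suc r)
    have base: "close_law c d G b (Suc r) 0 k" for k
      by (rule close_law_0) (use Suc in blast)
    show ?case
    proof (induction a)
      case (Suc a)
      then show ?case using close_law_step[OF c, of d G b "Suc r" a] base by blast
    qed (simp add: base)
  qed
  then show ?thesis by blast
qed

theorem local_limit:
  fixes f :: "'b list \<Rightarrow> real"
  assumes c: "0 < c" and eps: "\<epsilon> > 0"
  shows "\<exists>n0. \<forall>n\<ge>n0. \<forall>es. \<forall>f::'b list \<Rightarrow> real. length es = k \<longrightarrow> set es \<subseteq> cells n d \<longrightarrow> distinct es \<longrightarrow>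
     (\<forall>xs. 0 \<le> f xs \<and> f xs \<le> 1) \<longrightarrow>
     \<bar>EF d c n (\<lambda>X. f (map (\<lambda>e. local_val G b r e X) es))
      - expect (replicate_pmf k (tree_law c d G b r)) f\<bar> \<le> \<epsilon>"
proof -
  obtain n0 where n0: "\<And>n. n \<ge> n0 \<Longrightarrow> close_at c d G b r 0 k n \<epsilon>"
    using close_law_all[OF c, of d G b r 0 k] eps unfolding close_law_def by blast
  show ?thesis
  proof (intro exI[of _ n0] allI impI)
    fix n es and f :: "'b list \<Rightarrow> real"
    assume *: "n0 \<le> n" "length es = k" "set es \<subseteq> cells n d" "distinct es" "\<forall>xs. 0 \<le> f xs \<and> f xs \<le> 1"
    show "\<bar>EF d c n (\<lambda>X. f (map (\<lambda>e. local_val G b r e X) es))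
      - expect (replicate_pmf k (tree_law c d G b r)) f\<bar> \<le> \<epsilon>"
      using n0[OF *(1), unfolded close_at_def, rule_format, of "[]" es "\<lambda>_. f"] *
      by (simp del: tree_law.simps)
  qed
qed

corollary local_limit_single:
  fixes f :: "'b \<Rightarrow> real"
  assumes c: "0 < c" and eps: "\<epsilon> > 0"
  shows "\<exists>n0. \<forall>n\<ge>n0. \<forall>e\<in>cells n d. \<forall>f. (\<forall>x. 0 \<le> f x \<and> f x \<le> 1) \<longrightarrow>
     \<bar>EF d c n (\<lambda>X. f (local_val G b r e X)) - expect (tree_law c d G b r) f\<bar> \<le> \<epsilon>"
proof -
  obtain n0 where n0: "\<And>n es f. n \<ge> n0 \<Longrightarrow> length es = 1 \<Longrightarrow> set es \<subseteq> cells n d \<Longrightarrow> distinct es \<Longrightarrow>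
     (\<And>xs. 0 \<le> f xs \<and> f xs \<le> 1) \<Longrightarrow>
     \<bar>EF d c n (\<lambda>X. f (map (\<lambda>e. local_val G b r e X) es)) - expect (replicate_pmf 1 (tree_law c d G b r)) f\<bar> \<le> \<epsilon>"
    using local_limit[OF c eps, of 1 d G b r] by blast
  have "\<bar>EF d c n (\<lambda>X. f (local_val G b r e X)) - expect (tree_law c d G b r) f\<bar> \<le> \<epsilon>"
    if "n \<ge> n0" "e \<in> cells n d" "\<And>x. 0 \<le> f x \<and> f x \<le> 1" for n e f
    using n0[of n "[e]" "\<lambda>xs. f (hd xs)"] that unfolding replicate_pmf_1 by simp
  then show ?thesis by blast
qed

section \<open>The law of the mass on the Poisson tree\<close>

text \<open>
  One step of the recursion for the least squared distance from a cell to the boundaries: if the faces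
  through \<open>e\<close> carry total masses \<open>ss\<close> on their other facets, then the mass of \<open>e\<close> is \<open>eff ss\<close>. In the language of
  electrical networks this is a unit resistance in parallel with the resistances \<open>ss\<close>.
\<close>

definition eff :: "real list \<Rightarrow> real" where
  "eff ss = 1 / (1 + sum_list (map inverse ss))"

lemma replicate_map_pmf: "replicate_pmf n (map_pmf f p) = map_pmf (map f) (replicate_pmf n p)"
  by (induction n) (simp_all add: map_bind_pmf bind_map_pmf)

lemma sum_list_inverse_nonneg: "(\<And>s. s \<in> set ss \<Longrightarrow> 0 < s) \<Longrightarrow> 0 \<le> sum_list (map inverse (ss :: real list))"
  by (intro sum_list_nonneg) (auto intro: less_imp_le)

lemma eff_bounds:
  assumes "\<And>s. s \<in> set ss \<Longrightarrow> 0 < s"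
  shows "0 < eff ss" "eff ss \<le> 1"
  using sum_list_inverse_nonneg[of ss, OF assms] by (simp_all add: eff_def add_pos_nonneg)

lemma eff_le_entry:
  assumes pos: "\<And>s. s \<in> set ss \<Longrightarrow> 0 < s" and s: "s \<in> set ss"
  shows "eff ss < s"
proof -
  have "inverse s \<le> sum_list (map inverse ss)"
    using pos s by (intro member_le_sum_list) (auto intro: less_imp_le)
  then have "inverse s < 1 + sum_list (map inverse ss)" by simp
  moreover have "0 < inverse s" using pos[OF s] by simp
  ultimately have "inverse (1 + sum_list (map inverse ss)) < inverse (inverse s)"
    by (rule less_imp_inverse_less)
  then show ?thesis by (simp add: eff_def inverse_eq_divide)
qed

lemma eff_mono:
  assumes "list_all2 (\<lambda>x y. 0 < x \<and> x \<le> y) xs ys"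
  shows "0 < eff xs \<and> eff xs \<le> eff ys"
proof -
  have "sum_list (map inverse ys) \<le> sum_list (map inverse xs) \<and> 0 \<le> sum_list (map inverse ys)"
    using assms by (induction rule: list_all2_induct) (auto intro!: add_mono le_imp_inverse_le add_nonneg_nonneg)
  then show ?thesis by (auto simp: eff_def intro!: divide_left_mono)
qed

definition mass_law :: "real \<Rightarrow> nat \<Rightarrow> nat \<Rightarrow> real pmf" where
  "mass_law c d r = tree_law c d (\<lambda>xss. eff (map sum_list xss)) 1 r"

definition mass_step :: "real \<Rightarrow> real pmf \<Rightarrow> real pmf" where
  "mass_step c S = bind_pmf (poisson_pmf c) (\<lambda>k. map_pmf eff (replicate_pmf k S))"

lemma mass_law_0: "mass_law c d 0 = return_pmf 1"
  by (simp add: mass_law_def)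

lemma mass_law_Suc: "mass_law c d (Suc r) = mass_step c (map_pmf sum_list (replicate_pmf d (mass_law c d r)))"
  by (simp add: mass_law_def mass_step_def replicate_map_pmf map_pmf_comp)

lemma rel_pmf_replicate:
  "rel_pmf R p q \<Longrightarrow> rel_pmf (\<lambda>xs ys. list_all2 R xs ys \<and> length xs = n) (replicate_pmf n p) (replicate_pmf n q)"
proof (induction n)
  case (Suc n)
  show ?case
    unfolding replicate_pmf.simps
    by (rule rel_pmf_bindI[OF Suc.prems], rule rel_pmf_bindI[OF Suc.IH[OF Suc.prems]]) simp
qed simp

abbreviation below :: "real \<Rightarrow> real \<Rightarrow> bool" where
  "below \<equiv> \<lambda>x y. 0 < x \<and> x \<le> y"

lemma set_mass_step:
  assumes "\<And>s. s \<in> set_pmf S \<Longrightarrow> 0 < s"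
  shows "set_pmf (mass_step c S) \<subseteq> {0<..1}"
  unfolding mass_step_def using eff_bounds assms
  by (auto simp: set_replicate_pmf subset_iff in_lists_conv_set; blast)

lemma set_sum_replicate:
  assumes "set_pmf q \<subseteq> {0<..(1::real)}" "d \<ge> 1" "s \<in> set_pmf (map_pmf sum_list (replicate_pmf d q))"
  shows "0 < s"
proof -
  obtain xs where xs: "s = sum_list xs" "length xs = d" "set xs \<subseteq> set_pmf q"
    using assms(3) by (auto simp: set_replicate_pmf in_lists_conv_set)
  then obtain y ys where "xs = y # ys" using assms(2) by (cases xs) auto
  moreover have "0 \<le> sum_list ys" using xs assms(1) \<open>xs = y # ys\<close> by (intro sum_list_nonneg) force
  moreover have "0 < y" using xs assms(1) \<open>xs = y # ys\<close> by auto
  ultimately show ?thesis using xs by simp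
qed

lemma set_mass_law: "d \<ge> 1 \<Longrightarrow> set_pmf (mass_law c d r) \<subseteq> {0<..1}"
proof (induction r)
  case (Suc r)
  show ?case unfolding mass_law_Suc
    by (rule set_mass_step) (rule set_sum_replicate[OF Suc.IH[OF Suc.prems] Suc.prems])
qed (simp add: mass_law_0)

lemma list_all2_below_sum:
  assumes "list_all2 below xs ys" "xs \<noteq> []"
  shows "below (sum_list xs) (sum_list ys)"
proof -
  have "list_all2 below xs ys \<Longrightarrow> sum_list xs \<le> sum_list ys \<and> (xs \<noteq> [] \<longrightarrow> 0 < sum_list xs) \<and> 0 \<le> sum_list xs"
    by (induction rule: list_all2_induct) auto
  then show ?thesis using assms by auto
qed

text \<open>
  A deeper exploration offers more boundaries to approximate the root cell, so the mass decreases. The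
  induction starts from the initial mass \<open>1\<close>, the largest possible, and uses that a step of the recursion
  is monotone.
\<close>

lemma mass_law_decreasing:
  assumes d: "d \<ge> 1"
  shows "rel_pmf below (mass_law c d (Suc r)) (mass_law c d r)"
proof (induction r)
  case 0
  show ?case
    using set_mass_law[OF d, of c "Suc 0"] unfolding mass_law_0 rel_pmf_return_pmf2 by auto
next
  case (Suc r)
  let ?S = "\<lambda>q. map_pmf sum_list (replicate_pmf d q)"
  have "rel_pmf below (?S (mass_law c d (Suc r))) (?S (mass_law c d r))"
    unfolding pmf.rel_map by (rule pmf.rel_mono_strong[OF rel_pmf_replicate[OF Suc]]) (use list_all2_below_sum d in fastforce)
  note S = this
  have "rel_pmf below (map_pmf eff (replicate_pmf k (?S (mass_law c d (Suc r))))) (map_pmf eff (replicate_pmf k (?S (mass_law c d r))))" for k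
    unfolding pmf.rel_map by (rule pmf.rel_mono_strong[OF rel_pmf_replicate[OF S]]) (use eff_mono in blast)
  then show ?case
    unfolding mass_law_Suc[of c d "Suc r"] mass_law_Suc[of c d r] mass_step_def
    by (intro rel_pmf_bindI[where R = "(=)"]) (auto intro: rel_pmf_reflI)
qed

section \<open>Exchangeability and Poisson identities\<close>

lemma sum_list_abs_le:
  fixes g :: "'a \<Rightarrow> real"
  assumes "\<And>x. \<bar>g x\<bar> \<le> B"
  shows "\<bar>\<Sum>x\<leftarrow>xs. g x\<bar> \<le> real (length xs) * B"
proof (induction xs)
  case (Cons x xs)
  then show ?case using assms[of x] abs_triangle_ineq[of "g x" "\<Sum>x\<leftarrow>xs. g x"]
    by (simp add: algebra_simps)
qed simp

text \<open>
  By exchangeability each of the \<open>n\<close> independent entries contributes the same amount to a sum in which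
  an entry is compared with the multiset of all of them.
\<close>

lemma expectation_sum_exchange:
  fixes g :: "'a \<Rightarrow> 'a multiset \<Rightarrow> real"
  assumes "\<And>x M. \<bar>g x M\<bar> \<le> B"
  shows "expect (replicate_pmf n p) (\<lambda>xs. \<Sum>x\<leftarrow>xs. g x (mset xs))
    = real n * expect p (\<lambda>x. expect (replicate_pmf (n - 1) p) (\<lambda>xs. g x (mset (x # xs))))"
  using assms
proof (induction n arbitrary: g)
  case (Suc m)
  let ?E = "expect"
  have B: "0 \<le> B" using Suc.prems abs_ge_zero order_trans by blast
  have sb: "\<bar>\<Sum>x\<leftarrow>xs. h x\<bar> \<le> real (length xs) * B" if "\<And>x. \<bar>h x\<bar> \<le> B" for h :: "'a \<Rightarrow> real" and xs
    using that by (rule sum_list_abs_le)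
  have b2: "\<bar>\<Sum>x\<leftarrow>xs. g x (mset xs)\<bar> \<le> real (Suc m) * B" if "length xs = Suc m" for xs
    using sb[of "\<lambda>x. g x (mset xs)" xs] Suc.prems that by auto
  have "?E (replicate_pmf (Suc m) p) (\<lambda>xs. \<Sum>x\<leftarrow>xs. g x (mset xs))
     = ?E p (\<lambda>x. ?E (replicate_pmf m p) (\<lambda>xs. g x (mset (x # xs)) + (\<Sum>y\<leftarrow>xs. g y (add_mset x (mset xs)))))"
    by (subst expectation_replicate_Suc[where B = "real (Suc m) * B"]) (use b2 in auto)
  also have "\<dots> = ?E p (\<lambda>x. ?E (replicate_pmf m p) (\<lambda>xs. g x (mset (x # xs)))
      + ?E (replicate_pmf m p) (\<lambda>xs. \<Sum>y\<leftarrow>xs. g y (add_mset x (mset xs))))"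
  proof (intro expectation_cong Bochner_Integration.integral_add)
    fix x
    show "integrable (measure_pmf (replicate_pmf m p)) (\<lambda>xs. g x (mset (x # xs)))"
      by (rule integrable_pmf_bounded[where B = B]) (rule Suc.prems)
    show "integrable (measure_pmf (replicate_pmf m p)) (\<lambda>xs. \<Sum>y\<leftarrow>xs. g y (add_mset x (mset xs)))"
    proof (rule integrable_pmf_bounded[where B = "real m * B"])
      fix xs assume "xs \<in> set_pmf (replicate_pmf m p)"
      then show "\<bar>\<Sum>y\<leftarrow>xs. g y (add_mset x (mset xs))\<bar> \<le> real m * B"
        using sb[of "\<lambda>y. g y (add_mset x (mset xs))" xs] Suc.prems by (simp add: set_replicate_pmf)
    qed
  qed
  also have "\<dots> = ?E p (\<lambda>x. ?E (replicate_pmf m p) (\<lambda>xs. g x (mset (x # xs)))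
      + real m * ?E p (\<lambda>y. ?E (replicate_pmf (m - 1) p) (\<lambda>xs. g y (add_mset x (mset (y # xs))))))"
  proof (rule expectation_cong)
    fix x
    show "?E (replicate_pmf m p) (\<lambda>xs. g x (mset (x # xs))) + ?E (replicate_pmf m p) (\<lambda>xs. \<Sum>y\<leftarrow>xs. g y (add_mset x (mset xs)))
      = ?E (replicate_pmf m p) (\<lambda>xs. g x (mset (x # xs)))
      + real m * ?E p (\<lambda>y. ?E (replicate_pmf (m - 1) p) (\<lambda>xs. g y (add_mset x (mset (y # xs)))))"
      using Suc.IH[of "\<lambda>y M. g y (add_mset x M)"] Suc.prems by simp
  qed
  also have "\<dots> = ?E p (\<lambda>x. ?E (replicate_pmf m p) (\<lambda>xs. g x (mset (x # xs))))
      + real m * ?E p (\<lambda>x. ?E p (\<lambda>y. ?E (replicate_pmf (m - 1) p) (\<lambda>xs. g y (add_mset x (mset (y # xs))))))"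
  proof -
    have i1: "integrable (measure_pmf p) (\<lambda>x. ?E (replicate_pmf m p) (\<lambda>xs. g x (mset (x # xs))))"
      by (rule integrable_pmf_bounded[where B = B]) (rule expectation_abs_le, rule Suc.prems)
    have i2: "integrable (measure_pmf p) (\<lambda>x. ?E p (\<lambda>y. ?E (replicate_pmf (m - 1) p) (\<lambda>xs. g y (add_mset x (mset (y # xs))))))"
      by (rule integrable_pmf_bounded[where B = B]) (rule expectation_abs_le, rule expectation_abs_le, rule Suc.prems)
    show ?thesis using i1 i2 by simp
  qed
  also have "real m * ?E p (\<lambda>x. ?E p (\<lambda>y. ?E (replicate_pmf (m - 1) p) (\<lambda>xs. g y (add_mset x (mset (y # xs))))))
    = real m * ?E p (\<lambda>x. ?E (replicate_pmf m p) (\<lambda>xs. g x (mset (x # xs))))"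
  proof (cases m)
    case (Suc l)
    have "?E p (\<lambda>x. ?E p (\<lambda>y. ?E (replicate_pmf l p) (\<lambda>xs. g y (add_mset x (mset (y # xs))))))
      = ?E p (\<lambda>y. ?E p (\<lambda>x. ?E (replicate_pmf l p) (\<lambda>xs. g y (add_mset x (mset (y # xs))))))"
      by (rule expectation_swap[where B = B]) (rule expectation_abs_le, rule Suc.prems)
    also have "\<dots> = ?E p (\<lambda>y. ?E (replicate_pmf (Suc l) p) (\<lambda>xs. g y (mset (y # xs))))"
      by (subst expectation_replicate_Suc[where B = B]) (use Suc.prems in \<open>auto simp: add_mset_commute\<close>)
    finally show ?thesis using Suc by simp
  qed simp
  finally show ?case by (simp add: algebra_simps)
qed simp

lemma expectation_replicate_all:
  "expect (replicate_pmf n p) (\<lambda>xs. of_bool (\<forall>x\<in>set xs. Q x) :: real)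
    = expect p (\<lambda>x. of_bool (Q x)) ^ n"
proof (induction n)
  case (Suc n)
  have "expect (replicate_pmf (Suc n) p) (\<lambda>xs. of_bool (\<forall>x\<in>set xs. Q x) :: real)
    = expect p (\<lambda>x. expect (replicate_pmf n p) (\<lambda>xs. of_bool (Q x) * of_bool (\<forall>x\<in>set xs. Q x)))"
    by (subst expectation_replicate_Suc[where B = 1]) (auto simp: of_bool_conj)
  then show ?case using Suc by simp
qed simp

lemma expectation_nat_sums:
  fixes f :: "nat \<Rightarrow> real"
  assumes "\<And>k. \<bar>f k\<bar> \<le> B"
  shows "(\<lambda>k. pmf p k * f k) sums expect p f"
proof -
  have "integrable (measure_pmf p) f" by (rule integrable_pmf_bounded) (rule assms)
  then have "integrable (count_space UNIV) (\<lambda>k. pmf p k * f k)"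
    unfolding measure_pmf_eq_density by (subst (asm) integrable_density) auto
  then have "(\<lambda>k. pmf p k * f k) sums (\<integral>k. pmf p k * f k \<partial>count_space UNIV)"
    by (rule sums_integral_count_space_nat)
  also have "(\<integral>k. pmf p k * f k \<partial>count_space UNIV) = expect p f"
    unfolding measure_pmf_eq_density by (subst integral_density) auto
  finally show ?thesis .
qed

text \<open>
  From \<open>k * pmf k = c * pmf (k - 1)\<close>: seen from a typical one of its points, a Poisson number of points
  consists of that point and an independent Poisson number of others.
\<close>

lemma poisson_size_bias:
  fixes u :: "nat \<Rightarrow> real"
  assumes c: "0 < c" and u: "\<And>k. \<bar>u k\<bar> \<le> B" and ku: "\<And>k. \<bar>real k * u (k - 1)\<bar> \<le> B'"
  shows "expect (poisson_pmf c) (\<lambda>k. real k * u (k - 1)) = c * expect (poisson_pmf c) u"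
proof -
  have "(\<lambda>k. pmf (poisson_pmf c) k * (real k * u (k - 1))) sums expect (poisson_pmf c) (\<lambda>k. real k * u (k - 1))"
    by (rule expectation_nat_sums[OF ku])
  then have "(\<lambda>k. pmf (poisson_pmf c) (Suc k) * (real (Suc k) * u k)) sums expect (poisson_pmf c) (\<lambda>k. real k * u (k - 1))"
    using sums_Suc_iff[of "\<lambda>k. pmf (poisson_pmf c) k * (real k * u (k - 1))"] by simp
  moreover have "pmf (poisson_pmf c) (Suc k) * (real (Suc k) * u k) = c * (pmf (poisson_pmf c) k * u k)" for k
    using c by (simp del: of_nat_Suc add: field_simps)
  ultimately have "(\<lambda>k. c * (pmf (poisson_pmf c) k * u k)) sums expect (poisson_pmf c) (\<lambda>k. real k * u (k - 1))"
    by (simp only:)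
  moreover have "(\<lambda>k. c * (pmf (poisson_pmf c) k * u k)) sums (c * expect (poisson_pmf c) u)"
    by (rule sums_mult[OF expectation_nat_sums[OF u]])
  ultimately show ?thesis by (rule sums_unique2)
qed

lemma poisson_generating:
  assumes c: "0 < c" and p: "0 \<le> p" "p \<le> 1"
  shows "expect (poisson_pmf c) (\<lambda>k. p ^ k) = exp (- c * (1 - p))"
proof -
  have "(\<lambda>k. pmf (poisson_pmf c) k * p ^ k) sums expect (poisson_pmf c) (\<lambda>k. p ^ k)"
    by (rule expectation_nat_sums[where B = 1]) (use p in \<open>simp add: power_le_one\<close>)
  moreover have "(\<lambda>k. (c * p) ^ k /\<^sub>R fact k * exp (- c)) sums (exp (c * p) * exp (- c))"
    by (rule sums_mult2[OF exp_converges])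
  moreover have "(c * p) ^ k /\<^sub>R fact k * exp (- c) = pmf (poisson_pmf c) k * p ^ k" for k
    using c by (simp add: power_mult_distrib field_simps)
  ultimately have "expect (poisson_pmf c) (\<lambda>k. p ^ k) = exp (c * p) * exp (- c)"
    by (simp add: sums_unique2)
  then show ?thesis by (simp add: exp_add[symmetric] algebra_simps)
qed

section \<open>The recursion for the mean mass\<close>

abbreviation tail :: "real pmf \<Rightarrow> real \<Rightarrow> real" where
  "tail q t \<equiv> expect q (\<lambda>h. of_bool (t < h))"

text \<open>
  The proportion \<open>h / (h + s)\<close>, counted as \<open>0\<close> when \<open>h\<close> or \<open>s\<close> does not exceed the cutoff. The function
  \<open>h / (h + s)\<close> is not uniformly continuous near \<open>h = s = 0\<close>; above the cutoff it is Lipschitz.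
\<close>

definition share :: "real \<Rightarrow> real \<Rightarrow> real \<Rightarrow> real" where
  "share \<eta> s h = of_bool (\<eta> < s) * of_bool (\<eta> < h) * (h / (h + s))"

lemma share_bounds: "0 < \<eta> \<Longrightarrow> 0 \<le> share \<eta> s h \<and> share \<eta> s h \<le> 1"
  by (auto simp: share_def divide_le_eq_1)

lemma tail_01: "0 \<le> tail q t \<and> tail q t \<le> 1"
  by (rule expectation_01) auto

lemma expectation_mass_step:
  fixes f :: "real \<Rightarrow> real"
  assumes "\<And>xs. set xs \<subseteq> set_pmf S \<Longrightarrow> \<bar>f (eff xs)\<bar> \<le> B"
  shows "expect (mass_step c S) f
    = expect (poisson_pmf c) (\<lambda>k. expect (replicate_pmf k S) (\<lambda>xs. f (eff xs)))"
  unfolding mass_step_def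
  by (subst expectation_bind[where B = B]) (use assms in \<open>auto simp: set_replicate_pmf in_lists_conv_set subset_iff\<close>)

lemma sum_mset_inverse_nonneg:
  "(\<And>y. y \<in># M \<Longrightarrow> 0 < y) \<Longrightarrow> 0 \<le> (\<Sum>y\<in>#M. inverse (y :: real))"
  by (induction M) (auto intro!: add_nonneg_nonneg intro: less_imp_le)

text \<open>
  Write \<open>h = 1 / (1 + (\<Sum>v. 1 / s\<^sub>v))\<close>. If some \<open>s\<^sub>v\<close> is at most \<open>\<eta>\<close>, then \<open>h < \<eta>\<close>. Otherwise
  \<open>1 - h\<close> is the sum over \<open>v\<close> of \<open>(1 / s\<^sub>v) / (1 + (\<Sum>w. 1 / s\<^sub>w))\<close>. All \<open>s\<^sub>v\<close> exceed \<open>\<eta>\<close> with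
  probability \<open>exp (- c * (1 - tail S \<eta>))\<close>; the expected sum is, by size bias, \<open>c\<close> times the expectation
  of the summand for a distinguished \<open>s\<close> and the mass \<open>h'\<close> formed by the others, and there the summand is
  \<open>h' / (h' + s)\<close>.
\<close>

lemma mass_step_le:
  assumes c: "0 < c" and S: "\<And>s. s \<in> set_pmf S \<Longrightarrow> 0 < s" and \<eta>: "0 < \<eta>"
  shows "expect (mass_step c S) (\<lambda>h. h)
    \<le> \<eta> + exp (- c * (1 - tail S \<eta>))
      - c * expect S (\<lambda>s. expect (mass_step c S) (share \<eta> s))"
proof -
  let ?E = "expect" and ?P = "poisson_pmf c"
  \<comment> \<open>The summand of \<open>1 - h\<close> for the entry \<open>x\<close> of the multiset \<open>M\<close>.\<close>
  define g where "g = (\<lambda>x M. of_bool (\<forall>y\<in>#M. \<eta> < y) * of_bool (\<eta> < x) * (inverse x / (1 + (\<Sum>y\<in>#M. inverse y))))"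
  have gb: "\<bar>g x M\<bar> \<le> inverse \<eta>" for x M
  proof (cases "(\<forall>y\<in>#M. \<eta> < y) \<and> \<eta> < x")
    case True
    have "0 \<le> (\<Sum>y\<in>#M. inverse y)" using True \<eta> by (intro sum_mset_inverse_nonneg) force
    moreover have "0 \<le> inverse x" "inverse x \<le> inverse \<eta>" using True \<eta> by auto
    moreover have "u / (1 + v) \<le> w \<and> 0 \<le> u / (1 + v)" if "0 \<le> v" "0 \<le> u" "u \<le> w" for u v w :: real
    proof -
      have "u * 1 \<le> w * (1 + v)" using that by (intro mult_mono) auto
      then show ?thesis using that by (simp add: divide_le_eq)
    qed
    ultimately have "0 \<le> g x M \<and> g x M \<le> inverse \<eta>" using True by (simp add: g_def)
    then show ?thesis by simp
  qed (use \<eta> in \<open>auto simp: g_def\<close>)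
  have total: "(\<Sum>x\<leftarrow>xs. g x (mset xs)) = of_bool (\<forall>x\<in>set xs. \<eta> < x) * (1 - eff xs)" if pos: "\<And>x. x \<in> set xs \<Longrightarrow> 0 < x" for xs
  proof (cases "\<forall>x\<in>set xs. \<eta> < x")
    case True
    have "(\<Sum>x\<leftarrow>xs. g x (mset xs)) = (\<Sum>x\<leftarrow>xs. inverse x * eff xs)"
      using True by (intro arg_cong[where f = sum_list] map_cong refl)
        (simp add: g_def eff_def sum_mset_sum_list flip: mset_map)
    also have "\<dots> = sum_list (map inverse xs) * eff xs" by (simp add: sum_list_mult_const)
    also have "\<dots> = 1 - eff xs"
      using sum_list_inverse_nonneg[of xs, OF pos] by (simp add: eff_def field_simps)
    finally show ?thesis using True by simp
  next
    case False
    then have "(\<Sum>x\<leftarrow>xs. g x (mset xs)) = (\<Sum>x\<leftarrow>xs. 0)"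
      by (intro arg_cong[where f = sum_list] map_cong refl) (auto simp: g_def)
    then show ?thesis using False by simp
  qed
  have pos: "0 < x" if "xs \<in> set_pmf (replicate_pmf k S)" "x \<in> set xs" for xs k x
    using that S by (auto simp: set_replicate_pmf in_lists_conv_set)
  have tot: "(\<Sum>x\<leftarrow>xs. g x (mset xs)) = of_bool (\<forall>x\<in>set xs. \<eta> < x) * (1 - eff xs)"
    if "xs \<in> set_pmf (replicate_pmf k S)" for xs k
    by (rule total) (use pos[OF that] in blast)
  have eff01: "0 < eff xs" "eff xs \<le> 1" if "xs \<in> set_pmf (replicate_pmf k S)" for xs k
    using eff_bounds[of xs] pos[OF that] by auto
  have pw: "eff xs \<le> \<eta> + of_bool (\<forall>x\<in>set xs. \<eta> < x) - (\<Sum>x\<leftarrow>xs. g x (mset xs))" if xs: "xs \<in> set_pmf (replicate_pmf k S)" for xs k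
  proof (cases "\<forall>x\<in>set xs. \<eta> < x")
    case True
    then show ?thesis using tot[OF xs] \<eta> by simp
  next
    case False
    then obtain s where "s \<in> set xs" "s \<le> \<eta>" by force
    then have "eff xs \<le> \<eta>" using eff_le_entry[of xs s] pos[OF xs] by force
    moreover have "(\<Sum>x\<leftarrow>xs. g x (mset xs)) = 0"
      using tot[OF xs] False by (simp only: of_bool_eq mult_zero_left)
    ultimately show ?thesis using False by (simp only: of_bool_eq)
  qed
  define u where "u = (\<lambda>m. ?E S (\<lambda>x. ?E (replicate_pmf m S) (\<lambda>xs. g x (mset (x # xs)))))"
  have ub: "\<bar>u m\<bar> \<le> inverse \<eta>" for m
    unfolding u_def by (intro expectation_abs_le gb)
  have ku: "real k * u (k - 1) = ?E (replicate_pmf k S) (\<lambda>xs. \<Sum>x\<leftarrow>xs. g x (mset xs))" for k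
    unfolding u_def by (rule expectation_sum_exchange[symmetric]) (rule gb)
  have kub: "\<bar>real k * u (k - 1)\<bar> \<le> 1" for k
    unfolding ku
  proof (rule expectation_abs_le)
    fix xs assume xs: "xs \<in> set_pmf (replicate_pmf k S)"
    show "\<bar>\<Sum>x\<leftarrow>xs. g x (mset xs)\<bar> \<le> 1"
      unfolding tot[OF xs] using eff01[OF xs] by auto
  qed
  let ?a = "tail S \<eta>"
  have "?E (mass_step c S) (\<lambda>h. h) = ?E ?P (\<lambda>k. ?E (replicate_pmf k S) eff)"
    by (rule expectation_mass_step[where B = 1]) (use eff_bounds S in \<open>auto simp: subset_iff abs_le_iff; smt (verit)\<close>)
  also have "\<dots> \<le> ?E ?P (\<lambda>k. \<eta> + ?a ^ k - real k * u (k - 1))"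
  proof (rule expectation_mono)
    fix k
    have i: "integrable (measure_pmf (replicate_pmf k S)) (\<lambda>xs. \<Sum>x\<leftarrow>xs. g x (mset xs))"
    proof (rule integrable_pmf_bounded[where B = 1])
      fix xs assume xs: "xs \<in> set_pmf (replicate_pmf k S)"
      show "\<bar>\<Sum>x\<leftarrow>xs. g x (mset xs)\<bar> \<le> 1"
        unfolding tot[OF xs] using eff01[OF xs] by auto
    qed
    have j: "integrable (measure_pmf (replicate_pmf k S)) (\<lambda>xs. of_bool (\<forall>x\<in>set xs. \<eta> < x) :: real)"
      by (rule integrable_pmf_bounded[where B = 1]) auto
    have l: "integrable (measure_pmf (replicate_pmf k S)) eff"
      by (rule integrable_pmf_bounded[where B = 1]) (use eff01 in \<open>auto simp: abs_le_iff; smt (verit)\<close>)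
    have "?E (replicate_pmf k S) eff \<le> ?E (replicate_pmf k S) (\<lambda>xs. \<eta> + of_bool (\<forall>x\<in>set xs. \<eta> < x) - (\<Sum>x\<leftarrow>xs. g x (mset xs)))"
      by (rule expectation_mono[OF l _ pw]) (use i j in auto)
    also have "\<dots> = \<eta> + ?a ^ k - real k * u (k - 1)"
      unfolding ku using i j by (simp add: expectation_replicate_all)
    finally show "?E (replicate_pmf k S) eff \<le> \<eta> + ?a ^ k - real k * u (k - 1)" .
  next
    show "integrable (measure_pmf ?P) (\<lambda>k. ?E (replicate_pmf k S) eff)"
      by (rule integrable_pmf_bounded[where B = 1], rule expectation_abs_le)
        (use eff01 in \<open>auto simp: abs_le_iff; smt (verit)\<close>)
    have "integrable (measure_pmf ?P) (\<lambda>k. ?a ^ k)"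
      by (rule integrable_pmf_bounded[where B = 1]) (use tail_01[of S \<eta>] in \<open>auto simp: power_le_one\<close>)
    moreover have "integrable (measure_pmf ?P) (\<lambda>k. real k * u (k - 1))"
      by (rule integrable_pmf_bounded) (rule kub)
    ultimately show "integrable (measure_pmf ?P) (\<lambda>k. \<eta> + ?a ^ k - real k * u (k - 1))" by simp
  qed
  also have "\<dots> = \<eta> + exp (- c * (1 - ?a)) - c * ?E ?P u"
  proof -
    have "integrable (measure_pmf ?P) (\<lambda>k. ?a ^ k)"
      by (rule integrable_pmf_bounded[where B = 1]) (use tail_01[of S \<eta>] in \<open>auto simp: power_le_one\<close>)
    moreover have "integrable (measure_pmf ?P) (\<lambda>k. real k * u (k - 1))"
      by (rule integrable_pmf_bounded) (rule kub)
    ultimately have "?E ?P (\<lambda>k. \<eta> + ?a ^ k - real k * u (k - 1)) = \<eta> + ?E ?P (\<lambda>k. ?a ^ k) - ?E ?P (\<lambda>k. real k * u (k - 1))"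
      by simp
    then show ?thesis
      using poisson_generating[OF c, of ?a] tail_01[of S \<eta>] poisson_size_bias[OF c ub kub] by simp
  qed
  finally have "?E (mass_step c S) (\<lambda>h. h) \<le> \<eta> + exp (- c * (1 - ?a)) - c * ?E ?P u" .
  moreover have "c * ?E ?P u \<ge> c * ?E S (\<lambda>s. ?E (mass_step c S) (share \<eta> s))"
  proof (rule mult_left_mono)
    have sb: "\<bar>share \<eta> s h\<bar> \<le> 1" for s h using share_bounds[OF \<eta>, of s h] by simp
    have "?E S (\<lambda>s. ?E (mass_step c S) (share \<eta> s)) = ?E S (\<lambda>s. ?E ?P (\<lambda>k. ?E (replicate_pmf k S) (\<lambda>xs. share \<eta> s (eff xs))))"
      by (subst expectation_mass_step[where B = 1]) (auto intro: sb)
    also have "\<dots> = ?E ?P (\<lambda>k. ?E S (\<lambda>s. ?E (replicate_pmf k S) (\<lambda>xs. share \<eta> s (eff xs))))"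
      by (rule expectation_swap[where B = 1]) (rule expectation_abs_le, rule sb)
    also have "\<dots> \<le> ?E ?P u"
      unfolding u_def
    proof (intro expectation_mono)
      fix k s xs assume s: "s \<in> set_pmf S" and xs: "xs \<in> set_pmf (replicate_pmf k S)"
      show "share \<eta> s (eff xs) \<le> g s (mset (s # xs))"
      proof (cases "\<eta> < s \<and> \<eta> < eff xs")
        case True
        have "\<eta> < x" if "x \<in> set xs" for x using eff_le_entry[of xs x] pos[OF xs] that True by force
        then have "g s (mset (s # xs)) = inverse s / (1 + (inverse s + sum_list (map inverse xs)))"
          using True by (simp add: g_def sum_mset_sum_list flip: mset_map)
        moreover have "1 + sum_list (map inverse xs) = inverse (eff xs)" by (simp add: eff_def)
        ultimately have "g s (mset (s # xs)) = inverse s / (inverse s + inverse (eff xs))" by (simp add: add_ac)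
        also have "\<dots> = eff xs / (eff xs + s)"
          using S[OF s] eff01[OF xs] by (simp add: field_simps)
        finally show ?thesis using True by (simp add: share_def)
      next
        case False
        have "0 \<le> g s (mset (s # xs))"
        proof -
          have "0 \<le> (\<Sum>y\<in>#mset (s # xs). inverse y)"
            using S[OF s] pos[OF xs] by (intro sum_mset_inverse_nonneg) auto
          then show ?thesis using S[OF s] by (auto simp: g_def intro!: divide_nonneg_nonneg)
        qed
        then show ?thesis using False by (auto simp: share_def)
      qed
    qed (auto intro!: integrable_pmf_bounded[where B = "max 1 (inverse \<eta>)"] expectation_abs_le
          intro: order_trans[OF sb] order_trans[OF gb])
    finally show "?E S (\<lambda>s. ?E (mass_step c S) (share \<eta> s)) \<le> ?E ?P u" .
  qed (use c in simp)
  ultimately show ?thesis by linarith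
qed

text \<open>
  Replaces the law \<open>q'\<close> at depth \<open>r + 1\<close> by the law \<open>q\<close> at depth \<open>r\<close>. Above the cutoff the share is
  \<open>1 / \<eta>\<close>-Lipschitz in \<open>h\<close>; the jump at the cutoff costs the difference of the tails. Both error terms vanish as
  \<open>r\<close> grows because the laws decrease.
\<close>

lemma share_coupling:
  assumes \<eta>: "0 < \<eta>" and rel: "rel_pmf below q' q" and q: "set_pmf q \<subseteq> {0<..1}" and s: "0 < s"
  shows "expect q (share \<eta> s) - expect q' (share \<eta> s)
    \<le> (tail q \<eta> - tail q' \<eta>) + (expect q (\<lambda>h. h) - expect q' (\<lambda>h. h)) / \<eta>"
proof -
  obtain w where w: "\<And>x y. (x, y) \<in> set_pmf w \<Longrightarrow> below x y" "map_pmf fst w = q'" "map_pmf snd w = q"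
    using rel by (auto elim: rel_pmf.cases)
  let ?E = "expect w"
  have y1: "y \<le> 1" if "(x, y) \<in> set_pmf w" for x y using that q unfolding w(3)[symmetric] by force
  have i: "integrable (measure_pmf w) (\<lambda>z. f (fst z))" "integrable (measure_pmf w) (\<lambda>z. f (snd z))"
    if "\<And>x. 0 < x \<Longrightarrow> x \<le> 1 \<Longrightarrow> \<bar>f x\<bar> \<le> 1" for f :: "real \<Rightarrow> real"
    using that w(1) y1 by (auto intro!: integrable_pmf_bounded[where B = 1]) (metis fst_conv snd_conv order_trans order_less_le_trans prod.collapse)+
  note ih = i[of "share \<eta> s"] and it = i[of "\<lambda>h. of_bool (\<eta> < h)"] and ii = i[of "\<lambda>h. h"]
  have sb: "\<bar>share \<eta> s h\<bar> \<le> 1" for h using share_bounds[OF \<eta>, of s h] by simp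
  have "?E (\<lambda>z. share \<eta> s (snd z) - share \<eta> s (fst z))
    \<le> ?E (\<lambda>z. (of_bool (\<eta> < snd z) - of_bool (\<eta> < fst z)) + (snd z - fst z) / \<eta>)"
  proof (rule expectation_mono)
    fix z assume "z \<in> set_pmf w"
    obtain x y where z: "z = (x, y)" by force
    then have xy: "0 < x" "x \<le> y" using w(1) \<open>z \<in> set_pmf w\<close> by auto
    have nn: "0 \<le> (y - x) / \<eta>" using xy \<eta> by simp
    have "share \<eta> s y - share \<eta> s x \<le> (of_bool (\<eta> < y) - of_bool (\<eta> < x)) + (y - x) / \<eta>"
    proof (cases "\<eta> < s \<and> \<eta> < x")
      case True
      have "y / (y + s) - x / (x + s) = s * (y - x) / ((y + s) * (x + s))"
        using xy s by (simp add: field_simps)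
      also have "\<dots> \<le> s * (y - x) / (s * \<eta>)"
        using xy s True \<eta> by (intro divide_left_mono mult_mono) auto
      also have "\<dots> = (y - x) / \<eta>" using s by simp
      finally show ?thesis using True xy by (simp add: share_def)
    next
      case False
      then have "share \<eta> s x = 0" by (auto simp: share_def)
      moreover have "share \<eta> s y \<le> of_bool (\<eta> < y)" using share_bounds[OF \<eta>, of s y] by (auto simp: share_def)
      moreover have "\<eta> < x \<Longrightarrow> share \<eta> s y = 0" using False by (auto simp: share_def)
      moreover have "\<eta> < x \<Longrightarrow> \<eta> < y" using xy by simp
      moreover have "\<not> \<eta> < x \<Longrightarrow> (of_bool (\<eta> < x) :: real) = 0" "\<eta> < x \<Longrightarrow> (of_bool (\<eta> < x) :: real) = 1"
        "\<eta> < y \<Longrightarrow> (of_bool (\<eta> < y) :: real) = 1" by auto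
      ultimately show ?thesis using nn by linarith
    qed
    then show "share \<eta> s (snd z) - share \<eta> s (fst z) \<le> (of_bool (\<eta> < snd z) - of_bool (\<eta> < fst z)) + (snd z - fst z) / \<eta>"
      by (simp add: z)
  qed (use ih it ii sb in auto)
  also have "\<dots> = (?E (\<lambda>z. of_bool (\<eta> < snd z)) - ?E (\<lambda>z. of_bool (\<eta> < fst z))) + (?E snd - ?E fst) / \<eta>"
    using it ii by simp
  finally show ?thesis
    using ih sb unfolding w(2,3)[symmetric] by simp
qed

lemma coupling_mono:
  assumes rel: "rel_pmf below q' q" and q: "set_pmf q \<subseteq> {0<..1}"
  shows "tail q' t \<le> tail q t" "expect q' (\<lambda>h. h) \<le> expect q (\<lambda>h. h)"
proof -
  obtain w where w: "\<And>x y. (x, y) \<in> set_pmf w \<Longrightarrow> below x y" "map_pmf fst w = q'" "map_pmf snd w = q"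
    using rel by (auto elim: rel_pmf.cases)
  have y1: "y \<le> 1" if "(x, y) \<in> set_pmf w" for x y using that q unfolding w(3)[symmetric] by force
  show "tail q' t \<le> tail q t"
    unfolding w(2,3)[symmetric] integral_map_pmf using w(1)
    by (intro expectation_mono integrable_pmf_bounded[where B = 1]) force+
  show "expect q' (\<lambda>h. h) \<le> expect q (\<lambda>h. h)"
    unfolding w(2,3)[symmetric] integral_map_pmf using w(1) y1
    by (intro expectation_mono integrable_pmf_bounded[where B = 1]) force+
qed

lemma expectation_of_not: "expect q (\<lambda>h. of_bool (\<not> P h) :: real) = 1 - expect q (\<lambda>h. of_bool (P h))"
proof -
  have i: "integrable (measure_pmf q) (\<lambda>h. of_bool (P h) :: real)"
    by (rule integrable_pmf_bounded[where B = 1]) auto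
  have "expect q (\<lambda>h. of_bool (\<not> P h) :: real) = expect q (\<lambda>h. 1 - of_bool (P h))"
    by (intro expectation_cong) auto
  then show ?thesis using i by simp
qed

text \<open>
  For \<open>d + 1\<close> independent masses with sum \<open>T\<close> the proportions \<open>x / T\<close> add up to \<open>1\<close>, and they have the same
  expectation. So the expected proportion of one of them is \<open>1 / (d + 1)\<close> times the probability that not
  all masses vanish, minus the probability that it is the only one that does not vanish, as then the
  sum of the others is cut off. With a cutoff \<open>\<eta>\<close> the proportions of the entries below \<open>\<eta>\<close> are lost; they
  amount to at most \<open>sqrt \<eta>\<close> if \<open>T\<close> exceeds \<open>(d + 1) * sqrt \<eta>\<close>.
\<close>

lemma share_symmetric_lower:
  assumes d: "d \<ge> 1" and q: "set_pmf q \<subseteq> {0<..1}" and \<eta>: "0 < \<eta>" "\<eta> \<le> 1"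
  shows "(1 - sqrt \<eta>) / (real d + 1) * (1 - (1 - tail q ((real d + 1) * sqrt \<eta>)) ^ (d + 1))
      - tail q \<eta> * (1 - tail q \<eta>) ^ d
    \<le> expect (map_pmf sum_list (replicate_pmf d q)) (\<lambda>s. expect q (share \<eta> s))"
proof -
  let ?E = "expect" and ?R = "replicate_pmf (Suc d) q"
  \<comment> \<open>The share of the entry \<open>x\<close> against the sum of the others, and the event that \<open>x\<close> is the only large entry.\<close>
  define g :: "real \<Rightarrow> real multiset \<Rightarrow> real"
    where "g = (\<lambda>x M. share \<eta> (\<Sum>\<^sub># M - x) x)"
  define k :: "real \<Rightarrow> real multiset \<Rightarrow> real"
    where "k = (\<lambda>x M. of_bool (\<eta> < x) * of_bool (\<forall>y\<in>#M - {#x#}. \<not> \<eta> < y))"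
  have gb: "\<bar>g x M\<bar> \<le> 1" for x M using share_bounds[OF \<eta>(1), of "\<Sum>\<^sub># M - x" x] by (simp add: g_def)
  have kb: "\<bar>k x M\<bar> \<le> 1" for x M by (simp add: k_def)
  let ?J = "?E (map_pmf sum_list (replicate_pmf d q)) (\<lambda>s. ?E q (share \<eta> s))"
  have sb: "\<bar>share \<eta> s h\<bar> \<le> 1" for s h using share_bounds[OF \<eta>(1), of s h] by simp
  have J: "real (Suc d) * ?J = ?E ?R (\<lambda>xs. \<Sum>x\<leftarrow>xs. g x (mset xs))"
  proof -
    have "?J = ?E (replicate_pmf d q) (\<lambda>xs. ?E q (\<lambda>h. share \<eta> (sum_list xs) h))" by simp
    also have "\<dots> = ?E q (\<lambda>h. ?E (replicate_pmf d q) (\<lambda>xs. share \<eta> (sum_list xs) h))"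
      by (rule expectation_swap[where B = 1]) (rule sb)
    also have "\<dots> = ?E q (\<lambda>x. ?E (replicate_pmf (Suc d - 1) q) (\<lambda>xs. g x (mset (x # xs))))"
      by (simp add: g_def sum_mset_sum_list)
    finally show ?thesis using expectation_sum_exchange[of g 1 "Suc d" q] gb by simp
  qed
  have K: "?E ?R (\<lambda>xs. \<Sum>x\<leftarrow>xs. k x (mset xs)) = real (Suc d) * (tail q \<eta> * (1 - tail q \<eta>) ^ d)"
  proof -
    have "?E ?R (\<lambda>xs. \<Sum>x\<leftarrow>xs. k x (mset xs)) = real (Suc d) * ?E q (\<lambda>x. ?E (replicate_pmf d q) (\<lambda>xs. k x (mset (x # xs))))"
      using expectation_sum_exchange[of k 1 "Suc d" q] kb by simp
    also have "?E q (\<lambda>x. ?E (replicate_pmf d q) (\<lambda>xs. k x (mset (x # xs)))) = ?E q (\<lambda>x. of_bool (\<eta> < x) * (1 - tail q \<eta>) ^ d)"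
      by (simp add: k_def expectation_replicate_all expectation_of_not del: not_less)
    also have "\<dots> = tail q \<eta> * (1 - tail q \<eta>) ^ d" by simp
    finally show ?thesis .
  qed
  let ?\<theta> = "(real d + 1) * sqrt \<eta>"
  have sq: "0 < sqrt \<eta>" "sqrt \<eta> \<le> 1" "\<eta> = sqrt \<eta> * sqrt \<eta>" using \<eta> by auto
  have ub: "(1 - sqrt \<eta>) * of_bool P \<le> 1 - sqrt \<eta>" for P using sq by (cases P) auto
  have th: "\<eta> \<le> ?\<theta>"
  proof -
    have "\<eta> \<le> 1 * sqrt \<eta>" using mult_right_mono[of "sqrt \<eta>" 1 "sqrt \<eta>"] sq by linarith
    also have "\<dots> \<le> ?\<theta>" using sq by (intro mult_right_mono) auto
    finally show ?thesis .
  qed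
  have pw: "(1 - sqrt \<eta>) * of_bool (\<not> (\<forall>x\<in>set xs. \<not> ?\<theta> < x)) - (\<Sum>x\<leftarrow>xs. k x (mset xs)) \<le> (\<Sum>x\<leftarrow>xs. g x (mset xs))"
    if xs: "xs \<in> set_pmf ?R" for xs
  proof -
    have pos: "0 < x" if "x \<in> set xs" for x
      using xs that q by (auto simp: set_replicate_pmf in_lists_conv_set simp del: replicate_pmf.simps)
    have len: "length xs = Suc d" using xs by (simp add: set_replicate_pmf del: replicate_pmf.simps)
    have gnn: "0 \<le> (\<Sum>x\<leftarrow>xs. g x (mset xs))"
      by (intro sum_list_nonneg) (auto simp: g_def share_bounds \<eta>)
    have knn: "0 \<le> (\<Sum>x\<leftarrow>xs. k x (mset xs))"
      by (intro sum_list_nonneg) (auto simp: k_def)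
    show ?thesis
    proof (cases "\<exists>x\<in>set xs. ?\<theta> < x")
      case False
      then show ?thesis using gnn knn by auto
    next
      case True
      then obtain x0 where x0: "x0 \<in> set xs" "?\<theta> < x0" by blast
      show ?thesis
      proof (cases "\<exists>x\<in>set xs. k x (mset xs) = 1")
        case True
        then obtain x1 where x1: "x1 \<in> set xs" "k x1 (mset xs) = 1" by blast
        have "k x1 (mset xs) \<le> (\<Sum>x\<leftarrow>xs. k x (mset xs))"
          using x1 by (intro member_le_sum_list) (auto simp: k_def)
        then show ?thesis using x1(2) gnn ub[of "\<not> (\<forall>x\<in>set xs. \<not> ?\<theta> < x)"] sq(1) by linarith
      next
        case False
        define T where "T = sum_list xs"
        have "x0 \<le> T" unfolding T_def using x0 pos by (intro member_le_sum_list) (auto intro: less_imp_le)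
        then have T: "?\<theta> < T" "0 < T" using x0 pos[OF x0(1)] by auto
        have other: "\<eta> < T - x" if x: "x \<in> set xs" "\<eta> < x" for x
        proof -
          have "\<not> (\<forall>y\<in>#mset xs - {#x#}. \<not> \<eta> < y)" using False x by (auto simp: k_def)
          then obtain y where y: "y \<in># mset xs - {#x#}" "\<eta> < y" by blast
          have "T - x = \<Sum>\<^sub># (mset xs - {#x#})"
            using x by (simp add: T_def sum_mset_sum_list[symmetric] sum_mset_diff)
          also have "mset xs - {#x#} = mset (remove1 x xs)" by simp
          finally have "T - x = sum_list (remove1 x xs)" by (simp only: sum_mset_sum_list)
          moreover have "y \<in> set (remove1 x xs)" using y by (metis mset_remove1 set_mset_mset)
          then have "y \<le> sum_list (remove1 x xs)"
            using pos by (intro member_le_sum_list) (auto intro: less_imp_le dest: notin_set_remove1)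
          ultimately show ?thesis using y by simp
        qed
        have gx: "x / T - of_bool (x \<le> \<eta>) * (\<eta> / T) \<le> g x (mset xs)" if x: "x \<in> set xs" for x
        proof (cases "\<eta> < x")
          case True
          then show ?thesis using other[OF x] T by (simp add: g_def share_def sum_mset_sum_list T_def)
        next
          case False
          then have "x / T \<le> \<eta> / T" using T by (intro divide_right_mono) auto
          then show ?thesis using False by (simp add: g_def share_def)
        qed
        have "(\<Sum>x\<leftarrow>xs. x / T - of_bool (x \<le> \<eta>) * (\<eta> / T)) \<le> (\<Sum>x\<leftarrow>xs. g x (mset xs))"
          by (intro sum_list_mono gx)
        moreover have "(\<Sum>x\<leftarrow>xs. x / T - 1 * (\<eta> / T)) \<le> (\<Sum>x\<leftarrow>xs. x / T - of_bool (x \<le> \<eta>) * (\<eta> / T))"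
          using T \<eta> by (intro sum_list_mono diff_left_mono mult_right_mono) auto
        moreover have "(\<Sum>x\<leftarrow>xs. x / T - 1 * (\<eta> / T)) = T / T - real (length xs) * (\<eta> / T)"
        proof -
          have "(\<Sum>x\<leftarrow>ys. x / T - 1 * (\<eta> / T)) = sum_list ys / T - real (length ys) * (\<eta> / T)" for ys
            by (induction ys) (simp_all add: field_simps add_divide_distrib)
          then show ?thesis by (simp add: T_def)
        qed
        moreover have "real (length xs) * (\<eta> / T) \<le> sqrt \<eta>"
        proof -
          have "sqrt \<eta> * ?\<theta> = (real d + 1) * (sqrt \<eta> * sqrt \<eta>)" by (simp only: mult_ac)
          also have "\<dots> = (real d + 1) * \<eta>" by (simp only: sq(3)[symmetric])
          finally have "real (length xs) * \<eta> = sqrt \<eta> * ?\<theta>" by (simp only: len of_nat_Suc add.commute)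
          also have "\<dots> \<le> sqrt \<eta> * T" using T sq by (intro mult_left_mono) auto
          finally show ?thesis using T by (simp add: field_simps)
        qed
        ultimately have "1 - sqrt \<eta> \<le> (\<Sum>x\<leftarrow>xs. g x (mset xs))" using T by simp
        then show ?thesis using knn ub[of "\<not> (\<forall>x\<in>set xs. \<not> ?\<theta> < x)"] by linarith
      qed
    qed
  qed
  have ig: "integrable (measure_pmf ?R) (\<lambda>xs. \<Sum>x\<leftarrow>xs. f x (mset xs))" if fb: "\<And>x M. \<bar>f x M\<bar> \<le> (1::real)" for f
  proof (rule integrable_pmf_bounded[where B = "real (Suc d)"])
    fix xs assume xs: "xs \<in> set_pmf ?R"
    have "\<bar>\<Sum>x\<leftarrow>xs. f x (mset xs)\<bar> \<le> real (length xs) * 1" by (rule sum_list_abs_le) (rule fb)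
    then show "\<bar>\<Sum>x\<leftarrow>xs. f x (mset xs)\<bar> \<le> real (Suc d)"
      using xs by (simp add: set_replicate_pmf del: replicate_pmf.simps)
  qed
  have io: "integrable (measure_pmf ?R) (\<lambda>xs. of_bool (P xs) :: real)" for P
    by (rule integrable_pmf_bounded[where B = 1]) auto
  have "?E ?R (\<lambda>xs. (1 - sqrt \<eta>) * of_bool (\<not> (\<forall>x\<in>set xs. \<not> ?\<theta> < x)) - (\<Sum>x\<leftarrow>xs. k x (mset xs)))
     \<le> ?E ?R (\<lambda>xs. \<Sum>x\<leftarrow>xs. g x (mset xs))"
    by (rule expectation_mono[OF _ ig[of g, OF gb] pw])
      (use ig[of k, OF kb] io in \<open>simp_all del: replicate_pmf.simps not_less\<close>)
  also have "?E ?R (\<lambda>xs. (1 - sqrt \<eta>) * of_bool (\<not> (\<forall>x\<in>set xs. \<not> ?\<theta> < x)) - (\<Sum>x\<leftarrow>xs. k x (mset xs)))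
     = (1 - sqrt \<eta>) * ?E ?R (\<lambda>xs. of_bool (\<not> (\<forall>x\<in>set xs. \<not> ?\<theta> < x))) - ?E ?R (\<lambda>xs. \<Sum>x\<leftarrow>xs. k x (mset xs))"
    using ig[of k, OF kb] io by (simp del: replicate_pmf.simps not_less)
  also have "?E ?R (\<lambda>xs. of_bool (\<not> (\<forall>x\<in>set xs. \<not> ?\<theta> < x)) :: real) = 1 - (1 - tail q ?\<theta>) ^ Suc d"
    unfolding expectation_of_not expectation_replicate_all ..
  finally have "(1 - sqrt \<eta>) * (1 - (1 - tail q ?\<theta>) ^ Suc d) - real (Suc d) * (tail q \<eta> * (1 - tail q \<eta>) ^ d) \<le> real (Suc d) * ?J"
    unfolding K J .
  then have "((1 - sqrt \<eta>) * (1 - (1 - tail q ?\<theta>) ^ Suc d) - real (Suc d) * (tail q \<eta> * (1 - tail q \<eta>) ^ d)) / real (Suc d) \<le> ?J"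
    by (simp only: pos_divide_le_eq[OF of_nat_0_less_iff[THEN iffD2, OF zero_less_Suc]] mult.commute)
  moreover have "((1 - sqrt \<eta>) * (1 - (1 - tail q ?\<theta>) ^ Suc d) - real (Suc d) * (tail q \<eta> * (1 - tail q \<eta>) ^ d)) / real (Suc d)
      = (1 - sqrt \<eta>) / (real d + 1) * (1 - (1 - tail q ?\<theta>) ^ (d + 1)) - tail q \<eta> * (1 - tail q \<eta>) ^ d"
  proof -
    have "(A * B - C * D) / C = A / C * B - D" if "C \<noteq> 0" for A B C D :: real
      using that by (simp add: field_simps)
    from this[of "real (Suc d)"] show ?thesis by (simp only: Suc_eq_plus1 of_nat_add of_nat_1)
  qed
  ultimately show ?thesis by linarith
qed

text \<open>
  The bound on the mean mass for a positive cutoff. The three arguments \<open>x\<close>, \<open>y\<close>, \<open>z\<close> are tail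
  probabilities at three thresholds; they have a common limit as \<open>\<eta>\<close> tends to \<open>0\<close>.
\<close>

definition cutoff_potential :: "nat \<Rightarrow> real \<Rightarrow> real \<Rightarrow> real \<Rightarrow> real \<Rightarrow> real \<Rightarrow> real" where
  "cutoff_potential d c \<eta> x y z = \<eta> + exp (- c * (1 - x) ^ d)
     - c * ((1 - sqrt \<eta>) / (real d + 1) * (1 - (1 - y) ^ (d + 1)) - z * (1 - z) ^ d)"

lemma cutoff_potential_0: "cutoff_potential d c 0 x x x = potential d c x"
  by (simp add: cutoff_potential_def potential_def right_diff_distrib mult.assoc)

lemma tendsto_cutoff_potential:
  assumes "(h \<longlongrightarrow> \<eta>) F" "(f \<longlongrightarrow> x) F" "(g \<longlongrightarrow> y) F" "(k \<longlongrightarrow> z) F"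
  shows "((\<lambda>i. cutoff_potential d c (h i) (f i) (g i) (k i)) \<longlongrightarrow> cutoff_potential d c \<eta> x y z) F"
  unfolding cutoff_potential_def by (intro tendsto_intros assms) (simp add: add_nonneg_eq_0_iff)

text \<open>
  If a sum of \<open>d\<close> masses exceeds \<open>\<eta>\<close>, then one of them exceeds \<open>\<eta> / d\<close>; this bounds the probability that
  all faces at the root have sums above the cutoff.
\<close>

lemma mean_mass_step_le:
  assumes c: "0 < c" and d: "d \<ge> 1" and q: "set_pmf q \<subseteq> {0<..1}" and \<eta>: "0 < \<eta>" "\<eta> \<le> 1"
    and q': "q' = mass_step c (map_pmf sum_list (replicate_pmf d q))" and rel: "rel_pmf below q' q"
  shows "expect q' (\<lambda>h. h)
    \<le> cutoff_potential d c \<eta> (tail q (\<eta> / real d)) (tail q ((real d + 1) * sqrt \<eta>)) (tail q \<eta>)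
      + c * ((tail q \<eta> - tail q' \<eta>) + (expect q (\<lambda>h. h) - expect q' (\<lambda>h. h)) / \<eta>)"
proof -
  let ?E = "expect"
  let ?S = "map_pmf sum_list (replicate_pmf d q)"
  let ?D = "(tail q \<eta> - tail q' \<eta>) + (?E q (\<lambda>h. h) - ?E q' (\<lambda>h. h)) / \<eta>"
  have S: "0 < s" if "s \<in> set_pmf ?S" for s by (rule set_sum_replicate[OF q d that])
  have sb: "\<bar>share \<eta> s h\<bar> \<le> 1" for s h using share_bounds[OF \<eta>(1), of s h] by simp
  have i: "integrable (measure_pmf ?S) (\<lambda>s. ?E p (share \<eta> s))" for p
    by (rule integrable_pmf_bounded[where B = 1], rule expectation_abs_le, rule sb)
  have "?E ?S (\<lambda>s. ?E q (share \<eta> s) - ?D) \<le> ?E ?S (\<lambda>s. ?E q' (share \<eta> s))"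
  proof (rule expectation_mono)
    fix s assume "s \<in> set_pmf ?S"
    from share_coupling[OF \<eta>(1) rel q S[OF this]]
    show "?E q (share \<eta> s) - ?D \<le> ?E q' (share \<eta> s)" by linarith
  qed (use i in auto)
  then have J: "?E ?S (\<lambda>s. ?E q (share \<eta> s)) - ?D \<le> ?E ?S (\<lambda>s. ?E q' (share \<eta> s))"
    using i[of q] by simp
  have tS: "tail ?S \<eta> \<le> 1 - (1 - tail q (\<eta> / real d)) ^ d"
  proof -
    have "tail ?S \<eta> = ?E (replicate_pmf d q) (\<lambda>xs. of_bool (\<eta> < sum_list xs))" by simp
    also have "\<dots> \<le> ?E (replicate_pmf d q) (\<lambda>xs. of_bool (\<not> (\<forall>x\<in>set xs. \<not> \<eta> / real d < x)))"
    proof (rule expectation_mono)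
      fix xs assume "xs \<in> set_pmf (replicate_pmf d q)"
      then have len: "length xs = d" by (simp add: set_replicate_pmf)
      have "sum_list xs \<le> \<eta>" if "\<forall>x\<in>set xs. \<not> \<eta> / real d < x"
      proof -
        have "sum_list xs = (\<Sum>x\<leftarrow>xs. x)" by simp
        also have "\<dots> \<le> (\<Sum>x\<leftarrow>xs. \<eta> / real d)" using that by (intro sum_list_mono) auto
        also have "\<dots> = \<eta>" using len d by (simp add: sum_list_triv)
        finally show ?thesis .
      qed
      then show "of_bool (\<eta> < sum_list xs) \<le> (of_bool (\<not> (\<forall>x\<in>set xs. \<not> \<eta> / real d < x)) :: real)"
        by (cases "\<forall>x\<in>set xs. \<not> \<eta> / real d < x") (simp_all only: of_bool_eq, simp_all)
    qed (auto intro!: integrable_pmf_bounded[where B = 1])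
    also have "\<dots> = 1 - (1 - tail q (\<eta> / real d)) ^ d"
      unfolding expectation_of_not expectation_replicate_all ..
    finally show ?thesis .
  qed
  have "?E q' (\<lambda>h. h) \<le> \<eta> + exp (- c * (1 - tail ?S \<eta>)) - c * ?E ?S (\<lambda>s. ?E q' (share \<eta> s))"
    unfolding q' by (rule mass_step_le[OF c S \<eta>(1)])
  also have "exp (- c * (1 - tail ?S \<eta>)) \<le> exp (- c * (1 - tail q (\<eta> / real d)) ^ d)"
    using tS c by simp
  finally have A: "?E q' (\<lambda>h. h) \<le> \<eta> + exp (- c * (1 - tail q (\<eta> / real d)) ^ d) - c * ?E ?S (\<lambda>s. ?E q' (share \<eta> s))"
    by simp
  have "c * (((1 - sqrt \<eta>) / (real d + 1) * (1 - (1 - tail q ((real d + 1) * sqrt \<eta>)) ^ (d + 1)) - tail q \<eta> * (1 - tail q \<eta>) ^ d) - ?D)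
      \<le> c * ?E ?S (\<lambda>s. ?E q' (share \<eta> s))"
    using share_symmetric_lower[OF d q \<eta>] J c by (intro mult_left_mono) linarith+
  then show ?thesis using A unfolding cutoff_potential_def right_diff_distrib[of c _ ?D] by linarith
qed

text \<open>
  Applied to the limiting tail function \<open>X\<close>: evaluated at any thresholds tending to \<open>0\<close> it has the same
  limit, the probability \<open>x\<close> of a positive limiting mass.
\<close>

lemma antimono_tendsto_at_zero:
  fixes X :: "real \<Rightarrow> real"
  assumes anti: "\<And>s t. 0 < s \<Longrightarrow> s \<le> t \<Longrightarrow> X t \<le> X s" and bd: "\<And>s. 0 < s \<Longrightarrow> X s \<le> B"
  obtains x where "\<And>a. (\<And>k::nat. 0 < a k) \<Longrightarrow> a \<longlonglongrightarrow> 0 \<Longrightarrow> (\<lambda>k. X (a k)) \<longlonglongrightarrow> x"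
proof
  let ?x = "SUP s\<in>{0<..}. X s"
  have bdd: "bdd_above (X ` {0<..})" using bd by (intro bdd_aboveI[of _ B]) auto
  fix a :: "nat \<Rightarrow> real" assume a: "\<And>k. 0 < a k" "a \<longlonglongrightarrow> 0"
  show "(\<lambda>k. X (a k)) \<longlonglongrightarrow> ?x"
  proof (rule order_tendstoI)
    fix l assume "l < ?x"
    then obtain s where s: "0 < s" "l < X s" using less_cSUP_iff[OF _ bdd, of l] by auto
    have "\<forall>\<^sub>F k in sequentially. a k < s" using order_tendstoD(2)[OF a(2) s(1)] .
    then show "\<forall>\<^sub>F k in sequentially. l < X (a k)"
      by eventually_elim (use anti[OF a(1)] s in \<open>meson less_imp_le less_le_trans\<close>)
  next
    fix u assume u: "?x < u"
    have "X (a k) \<le> ?x" for k using a(1) by (intro cSUP_upper bdd) auto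
    then show "\<forall>\<^sub>F k in sequentially. X (a k) < u" using u by (intro always_eventually allI) (rule le_less_trans)
  qed
qed

text \<open>
  The limit \<open>r \<rightarrow> \<infinity>\<close> is taken first, at a fixed cutoff, and removes the difference between consecutive
  depths; then the cutoff tends to \<open>0\<close>.
\<close>

theorem mean_mass_limit:
  assumes c: "0 < c" and d: "d \<ge> 1"
  shows "\<exists>m x. (\<lambda>r. expect (mass_law c d r) (\<lambda>h. h)) \<longlonglongrightarrow> m \<and> 0 \<le> x \<and> x \<le> 1 \<and> m \<le> potential d c x"
proof -
  let ?E = "\<lambda>r. expect (mass_law c d r) (\<lambda>h. h)"
  let ?T = "\<lambda>r t. tail (mass_law c d r) t"
  note q = set_mass_law[OF d, of c] and rel = mass_law_decreasing[OF d, of c]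
  have E0: "0 \<le> ?E r" for r
    by (rule Bochner_Integration.integral_nonneg_AE) (use q[of r] in \<open>auto simp: AE_measure_pmf_iff subset_iff intro: less_imp_le\<close>)
  have "decseq ?E" by (rule decseq_SucI) (rule coupling_mono(2)[OF rel q])
  then obtain m where m: "?E \<longlonglongrightarrow> m" using decseq_convergent[of ?E 0] E0 by blast
  have "\<exists>L. (\<lambda>r. ?T r t) \<longlonglongrightarrow> L" for t
  proof -
    have dec: "decseq (\<lambda>r. ?T r t)" by (rule decseq_SucI) (rule coupling_mono(1)[OF rel q])
    obtain L where "(\<lambda>r. ?T r t) \<longlonglongrightarrow> L"
      by (rule decseq_convergent[OF dec, of 0]) (use tail_01 in auto)
    then show ?thesis by blast
  qed
  \<comment> \<open>The limiting tail function; the laws decrease with \<open>r\<close>.\<close>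
  then obtain X where X: "\<And>t. (\<lambda>r. ?T r t) \<longlonglongrightarrow> X t" by metis
  have X01: "0 \<le> X t" "X t \<le> 1" for t
    using tail_01 by (auto intro!: LIMSEQ_le_const[OF X] LIMSEQ_le_const2[OF X])
  have Xanti: "X t \<le> X s" if "s \<le> t" for s t
  proof (rule LIMSEQ_le[OF X X], intro exI allI impI)
    fix r show "?T r t \<le> ?T r s"
      using that by (intro expectation_mono integrable_pmf_bounded[where B = 1]) (auto simp: of_bool_def)
  qed
  have bound: "m \<le> cutoff_potential d c \<eta> (X (\<eta> / real d)) (X ((real d + 1) * sqrt \<eta>)) (X \<eta>)"
    if \<eta>: "0 < \<eta>" "\<eta> \<le> 1" for \<eta>
  proof -
    have XS: "(\<lambda>r. ?T (Suc r) t) \<longlonglongrightarrow> X t" for t using LIMSEQ_Suc[OF X[of t]] .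
    have mS: "(\<lambda>r. ?E (Suc r)) \<longlonglongrightarrow> m" using LIMSEQ_Suc[OF m] .
    have "(\<lambda>r. cutoff_potential d c \<eta> (?T r (\<eta> / real d)) (?T r ((real d + 1) * sqrt \<eta>)) (?T r \<eta>)
      + c * ((?T r \<eta> - ?T (Suc r) \<eta>) + (?E r - ?E (Suc r)) / \<eta>))
     \<longlonglongrightarrow> cutoff_potential d c \<eta> (X (\<eta> / real d)) (X ((real d + 1) * sqrt \<eta>)) (X \<eta>)
      + c * ((X \<eta> - X \<eta>) + (m - m) / \<eta>)"
      using \<eta> by (intro tendsto_intros tendsto_cutoff_potential X XS m mS) auto
    then have "m \<le> cutoff_potential d c \<eta> (X (\<eta> / real d)) (X ((real d + 1) * sqrt \<eta>)) (X \<eta>)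
      + c * ((X \<eta> - X \<eta>) + (m - m) / \<eta>)"
      using mean_mass_step_le[OF c d q \<eta> mass_law_Suc rel] by (intro LIMSEQ_le[OF mS]) auto
    then show ?thesis by simp
  qed
  obtain x where x: "\<And>a. (\<And>k::nat. 0 < a k) \<Longrightarrow> a \<longlonglongrightarrow> 0 \<Longrightarrow> (\<lambda>k. X (a k)) \<longlonglongrightarrow> x"
    using antimono_tendsto_at_zero[of X 1] Xanti X01 by blast
  define a :: "nat \<Rightarrow> real" where "a = (\<lambda>k. inverse (real (Suc k)))"
  have a: "0 < a k" "a k \<le> 1" for k by (auto simp: a_def field_simps)
  have a0: "a \<longlonglongrightarrow> 0" unfolding a_def by (rule LIMSEQ_inverse_real_of_nat)
  have s0: "(\<lambda>k. sqrt (a k)) \<longlonglongrightarrow> 0" using tendsto_real_sqrt[OF a0] by simp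
  have L1: "(\<lambda>k. X (a k)) \<longlonglongrightarrow> x" by (rule x) (use a a0 in auto)
  have L2: "(\<lambda>k. X (a k / real d)) \<longlonglongrightarrow> x"
  proof (rule x)
    show "(\<lambda>k. a k / real d) \<longlonglongrightarrow> 0" using tendsto_divide[OF a0 tendsto_const[of "real d"]] d by simp
  qed (use a d in auto)
  have L3: "(\<lambda>k. X ((real d + 1) * sqrt (a k))) \<longlonglongrightarrow> x"
  proof (rule x)
    show "(\<lambda>k. (real d + 1) * sqrt (a k)) \<longlonglongrightarrow> 0" using tendsto_mult[OF tendsto_const s0, of "real d + 1"] by simp
  qed (use a in \<open>auto intro!: mult_pos_pos add_nonneg_pos\<close>)
  have x01: "0 \<le> x" "x \<le> 1"
    using X01 by (auto intro!: LIMSEQ_le_const[OF L1] LIMSEQ_le_const2[OF L1])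
  have "(\<lambda>k. cutoff_potential d c (a k) (X (a k / real d)) (X ((real d + 1) * sqrt (a k))) (X (a k)))
      \<longlonglongrightarrow> cutoff_potential d c 0 x x x"
    by (intro tendsto_cutoff_potential a0 L1 L2 L3)
  then have "m \<le> cutoff_potential d c 0 x x x"
    by (rule LIMSEQ_le_const) (use bound a in blast)
  then show ?thesis using m x01 unfolding cutoff_potential_0 by blast
qed

section \<open>The core left by collapsing\<close>

text \<open>
  A face survives if each of its other facets lies in a further surviving face; the value at a cell is
  the number of its surviving faces.
\<close>

definition alive :: "nat list list \<Rightarrow> nat" where
  "alive xss = length (filter (\<lambda>xs. \<forall>x\<in>set xs. 1 \<le> x) xss)"

abbreviation degree_after :: "nat \<Rightarrow> nat set \<Rightarrow> nat set set \<Rightarrow> nat" where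
  "degree_after \<equiv> local_val alive 1"

lemma degree_after_Suc:
  assumes "finite e" "finite (link e X)"
  shows "degree_after (Suc r) e X = card {v \<in> link e X. \<forall>u\<in>e. 1 \<le> degree_after r (flip e v u) (del e X)}"
proof -
  let ?P = "\<lambda>v. \<forall>u\<in>e. 1 \<le> degree_after r (flip e v u) (del e X)"
  have "degree_after (Suc r) e X = length (filter ?P (sorted_list_of_set (link e X)))"
    using assms by (simp add: local_val_Suc alive_def children_def filter_map comp_def)
  also have "\<dots> = card (set (filter ?P (sorted_list_of_set (link e X))))"
    by (rule distinct_card[symmetric]) simp
  also have "\<dots> = card {v \<in> link e X. ?P v}" using assms by simp
  finally show ?thesis .
qed

text \<open>
  Longer collapsing leaves less.
\<close>

lemma degree_after_antimono:
  assumes "finite e" "finite X" "1 \<le> degree_after (Suc r) e X"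
  shows "1 \<le> degree_after r e X"
  using assms
proof (induction r arbitrary: e X)
  case (Suc r)
  have fl: "finite (link e X)"
  proof -
    have "link e X \<subseteq> \<Union>{\<sigma> \<in> X. finite \<sigma>}"
      using Suc.prems by (auto simp: link_def)
    then show ?thesis by (rule finite_subset) (use Suc.prems in auto)
  qed
  have fd: "finite (del e X)" using Suc.prems finite_subset[OF del_subset] by auto
  let ?A = "\<lambda>r. {v \<in> link e X. \<forall>u\<in>e. 1 \<le> degree_after r (flip e v u) (del e X)}"
  have "?A (Suc r) \<subseteq> ?A r"
  proof (intro subsetI CollectI conjI ballI)
    fix v u assume v: "v \<in> ?A (Suc r)" and u: "u \<in> e"
    have "finite (flip e v u)" using v u Suc.prems(1) by (intro flip_card(2)) (auto simp: link_def)
    then show "1 \<le> degree_after r (flip e v u) (del e X)" using Suc.IH[OF _ fd] v u by blast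
  qed auto
  then have "card (?A (Suc r)) \<le> card (?A r)" using fl by (intro card_mono) auto
  then show ?case
    using Suc.prems unfolding degree_after_Suc[OF Suc.prems(1) fl] by simp
qed simp

definition facets :: "'a set \<Rightarrow> 'a set set" where
  "facets \<sigma> = (\<lambda>v. \<sigma> - {v}) ` \<sigma>"

lemma facets_cells: "\<sigma> \<in> cells n (Suc d) \<Longrightarrow> facets \<sigma> \<subseteq> cells n d"
  by (auto simp: facets_def cells_def)

lemma card_facets: "\<sigma> \<in> cells n (Suc d) \<Longrightarrow> card (facets \<sigma>) = Suc d"
  unfolding facets_def by (subst card_image) (auto simp: inj_on_def cells_def)

text \<open>
  Each facet \<open>e\<close> of \<open>\<sigma>\<close> has a surviving face other than \<open>\<sigma>\<close>. It remains to see that \<open>\<sigma>\<close> itself survives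
  when it is seen from \<open>e\<close>: its other facets have surviving faces in \<open>X - {\<sigma>}\<close>, which stay so after the
  deletion of the star of \<open>e\<close>, because \<open>e\<close> is not reached from these facets.
\<close>

lemma core_face:
  assumes \<sigma>: "\<sigma> \<in> cells n (Suc d)" and X: "X \<subseteq> cells n (Suc d)" "\<sigma> \<in> X"
    and deg: "\<And>e. e \<in> facets \<sigma> \<Longrightarrow> 1 \<le> degree_after (Suc r) e (X - {\<sigma>})"
    and far: "\<And>e e'. e \<in> facets \<sigma> \<Longrightarrow> e' \<in> facets \<sigma> \<Longrightarrow> e \<noteq> e' \<Longrightarrow> e' \<notin> reach (Suc r) e (X - {\<sigma>})"
    and e: "e \<in> facets \<sigma>"
  shows "2 \<le> degree_after (Suc r) e X"
proof -
  let ?Z = "X - {\<sigma>}"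
  obtain v where v: "v \<in> \<sigma>" "e = \<sigma> - {v}" using e by (auto simp: facets_def)
  have finX: "finite X" "finite ?Z" using finite_subset[OF X(1)] by auto
  have ec: "e \<in> cells n d" using facets_cells[OF \<sigma>] e by auto
  have fe: "finite e" by (rule cells_finite[OF ec])
  have fl: "finite (link e X)" "finite (link e ?Z)"
    using finite_link[of X n d e] finite_link[of ?Z n d e] X by auto
  have del: "del e ?Z = del e X" using v by (auto simp: del_def)
  have ins: "insert v e = \<sigma>" using v by auto
  have lk: "link e X = insert v (link e ?Z)" "v \<notin> link e ?Z"
    using X(2) v ins by (auto simp: link_def)
  let ?A = "\<lambda>X. {v \<in> link e X. \<forall>u\<in>e. 1 \<le> degree_after r (flip e v u) (del e X)}"
  have "1 \<le> degree_after r (flip e v u) (del e X)" if u: "u \<in> e" for u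
  proof -
    have f: "flip e v u = \<sigma> - {u}" using ins by (simp add: flip_def)
    then have f': "flip e v u \<in> facets \<sigma>" using u v by (auto simp: facets_def)
    have ne: "flip e v u \<noteq> e" using u f by auto
    have fc: "flip e v u \<in> cells n d" using f' facets_cells[OF \<sigma>] by auto
    have "degree_after (Suc r) (flip e v u) (del e ?Z) = degree_after (Suc r) (flip e v u) ?Z"
    proof (rule unreached_del(2))
      show "finite (flip e v u)" by (rule cells_finite[OF fc])
      show "card e = card (flip e v u)" using fc ec by (simp add: cells_def)
      show "e \<notin> reach (Suc r) (flip e v u) ?Z" by (rule far[OF f' e ne])
    qed
    then have "1 \<le> degree_after (Suc r) (flip e v u) (del e X)" using deg[OF f'] by (simp add: del)
    then show ?thesis
      by (rule degree_after_antimono[OF cells_finite[OF fc] finite_subset[OF del_subset finX(1)]])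
  qed
  then have "insert v (?A ?Z) \<subseteq> ?A X" unfolding del lk(1) by blast
  then have "card (insert v (?A ?Z)) \<le> card (?A X)" using fl by (intro card_mono) auto
  moreover have "card (insert v (?A ?Z)) = Suc (card (?A ?Z))"
    using lk(2) fl(2) by (intro card_insert_disjoint) auto
  moreover have "1 \<le> card (?A ?Z)" using deg[OF e] unfolding degree_after_Suc[OF fe fl(2)] .
  ultimately show ?thesis unfolding degree_after_Suc[OF fe fl(1)] by simp
qed

abbreviation core_law :: "real \<Rightarrow> nat \<Rightarrow> nat \<Rightarrow> nat pmf" where
  "core_law c d \<equiv> tree_law c d alive 1"

lemma expectation_core_law_Suc:
  assumes f: "\<And>k. \<bar>f k\<bar> \<le> (1::real)"
  shows "expect (core_law c d (Suc r)) f
    = expect (poisson_pmf c) (\<lambda>k. expect (replicate_pmf k (replicate_pmf d (core_law c d r)))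
        (\<lambda>xss. f (alive xss)))"
  unfolding tree_law.simps by (subst expectation_bind[where B = 1]) (auto simp: f)

text \<open>
  The root has no surviving face if each of its Poisson many faces has a facet without surviving faces.
\<close>

lemma prob_core_law_pos:
  assumes c: "0 < c"
  shows "expect (core_law c d r) (\<lambda>k. of_bool (1 \<le> k)) = 1 - collapse_prob d c r"
proof (induction r)
  case (Suc r)
  let ?E = "expect" and ?W = "replicate_pmf d (core_law c d r)"
  let ?a = "?E ?W (\<lambda>xs. of_bool (\<forall>x\<in>set xs. 1 \<le> x)) :: real"
  have a: "?a = (1 - collapse_prob d c r) ^ d" unfolding expectation_replicate_all Suc ..
  have a01: "0 \<le> ?a" "?a \<le> 1" using expectation_01[of "\<lambda>xs. of_bool (\<forall>x\<in>set xs. 1 \<le> x)" ?W] by auto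
  have "?E (core_law c d (Suc r)) (\<lambda>k. of_bool (1 \<le> k))
    = ?E (core_law c d (Suc r)) (\<lambda>k. of_bool (\<not> (k < 1)) :: real)"
    by (intro expectation_cong) auto
  also have "\<dots> = 1 - ?E (core_law c d (Suc r)) (\<lambda>k. of_bool (k < 1))" by (rule expectation_of_not)
  also have "?E (core_law c d (Suc r)) (\<lambda>k. of_bool (k < 1) :: real) =
     ?E (poisson_pmf c) (\<lambda>k. ?E (replicate_pmf k ?W) (\<lambda>xss. of_bool (alive xss < 1)))"
    by (rule expectation_core_law_Suc) simp
  also have "(\<lambda>k. ?E (replicate_pmf k ?W) (\<lambda>xss. of_bool (alive xss < 1) :: real))
     = (\<lambda>k. (?E ?W (\<lambda>xs. of_bool (\<not> (\<forall>x\<in>set xs. 1 \<le> x))) :: real) ^ k)"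
    unfolding expectation_replicate_all[symmetric]
    by (intro ext expectation_cong) (auto simp: alive_def filter_empty_conv)
  also have "\<dots> = (\<lambda>k. (1 - ?a) ^ k)" unfolding expectation_of_not ..
  also have "?E (poisson_pmf c) (\<lambda>k. (1 - ?a) ^ k) = exp (- c * (1 - (1 - ?a)))"
    using a01 by (intro poisson_generating c) auto
  finally show ?case unfolding a by simp
qed simp

lemma replicate_exactly_one:
  "expect (replicate_pmf k W) (\<lambda>xs. of_bool (length (filter P xs) = 1))
    = real k * (expect W (\<lambda>x. of_bool (P x)) * (1 - expect W (\<lambda>x. of_bool (P x))) ^ (k - 1))"
proof (induction k)
  case (Suc k)
  let ?E = "expect"
  let ?a = "?E W (\<lambda>x. of_bool (P x)) :: real"
  have z: "?E (replicate_pmf k W) (\<lambda>xs. of_bool (length (filter P xs) = 0) :: real) = (1 - ?a) ^ k"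
  proof -
    have "?E (replicate_pmf k W) (\<lambda>xs. of_bool (length (filter P xs) = 0) :: real)
       = ?E (replicate_pmf k W) (\<lambda>xs. of_bool (\<forall>x\<in>set xs. \<not> P x))"
      by (intro expectation_cong) (auto simp: filter_empty_conv)
    then show ?thesis unfolding expectation_replicate_all expectation_of_not .
  qed
  have "?E (replicate_pmf (Suc k) W) (\<lambda>xs. of_bool (length (filter P xs) = 1) :: real)
    = ?E W (\<lambda>x. ?E (replicate_pmf k W) (\<lambda>xs. of_bool (length (filter P (x # xs)) = 1)))"
    by (rule expectation_replicate_Suc[where B = 1]) simp
  also have "\<dots> = ?E W (\<lambda>x. of_bool (P x) * (1 - ?a) ^ k + of_bool (\<not> P x) * (real k * (?a * (1 - ?a) ^ (k - 1))))"
  proof (rule expectation_cong)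
    fix x
    show "?E (replicate_pmf k W) (\<lambda>xs. of_bool (length (filter P (x # xs)) = 1))
      = of_bool (P x) * (1 - ?a) ^ k + of_bool (\<not> P x) * (real k * (?a * (1 - ?a) ^ (k - 1)))"
      using z Suc by (cases "P x") auto
  qed
  also have "\<dots> = ?a * (1 - ?a) ^ k + (1 - ?a) * (real k * (?a * (1 - ?a) ^ (k - 1)))"
  proof -
    have i: "integrable (measure_pmf W) (\<lambda>x. of_bool (Q x) :: real)" for Q
      by (rule integrable_pmf_bounded[where B = 1]) auto
    show ?thesis unfolding expectation_of_not[symmetric, of W P] using i by simp
  qed
  also have "\<dots> = real (Suc k) * (?a * (1 - ?a) ^ (Suc k - 1))"
    by (cases k) (simp_all add: algebra_simps)
  finally show ?case .
qed simp

text \<open>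
  The probability of exactly one surviving face comes from size bias: \<open>c\<close> times the probability that a
  distinguished face survives and that none of the others does.
\<close>

lemma prob_core_law_ge_two:
  assumes c: "0 < c"
  shows "expect (core_law c d (Suc r)) (\<lambda>k. of_bool (2 \<le> k))
    = 1 - collapse_prob d c (Suc r) - c * (1 - collapse_prob d c r) ^ d * collapse_prob d c (Suc r)"
proof -
  let ?E = "expect" and ?W = "replicate_pmf d (core_law c d r)"
  let ?P = "\<lambda>xs::nat list. \<forall>x\<in>set xs. 1 \<le> x"
  let ?a = "?E ?W (\<lambda>xs. of_bool (?P xs)) :: real"
  have a: "?a = (1 - collapse_prob d c r) ^ d" unfolding expectation_replicate_all prob_core_law_pos[OF c] ..
  have a01: "0 \<le> ?a" "?a \<le> 1" using expectation_01[of "\<lambda>xs. of_bool (?P xs)" ?W] by auto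
  have i: "integrable (measure_pmf (core_law c d (Suc r))) (\<lambda>x. of_bool (Q x) :: real)" for Q
    by (rule integrable_pmf_bounded[where B = 1]) auto
  define u where "u = (\<lambda>k::nat. ?a * (1 - ?a) ^ k)"
  have ub: "\<bar>u k\<bar> \<le> 1" for k using a01 by (simp add: u_def abs_mult mult_le_one power_le_one)
  have ku: "real k * u (k - 1) = ?E (replicate_pmf k ?W) (\<lambda>xss. of_bool (alive xss = 1))" for k
    unfolding u_def alive_def by (rule replicate_exactly_one[symmetric])
  have "?E (core_law c d (Suc r)) (\<lambda>k. of_bool (2 \<le> k) :: real) = ?E (core_law c d (Suc r)) (\<lambda>k. of_bool (1 \<le> k) - of_bool (k = 1))"
    by (intro expectation_cong) auto
  also have "\<dots> = (1 - collapse_prob d c (Suc r)) - ?E (core_law c d (Suc r)) (\<lambda>k. of_bool (k = 1))"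
    unfolding prob_core_law_pos[OF c, symmetric] using i by (simp del: tree_law.simps)
  also have "?E (core_law c d (Suc r)) (\<lambda>k. of_bool (k = 1) :: real) = ?E (poisson_pmf c) (\<lambda>k. real k * u (k - 1))"
    unfolding ku by (rule expectation_core_law_Suc) simp
  also have "\<dots> = c * ?E (poisson_pmf c) u"
  proof (rule poisson_size_bias[OF c ub])
    show "\<bar>real k * u (k - 1)\<bar> \<le> 1" for k unfolding ku by (rule expectation_abs_le) simp
  qed
  also have "?E (poisson_pmf c) u = ?a * exp (- c * (1 - (1 - ?a)))"
    unfolding u_def using poisson_generating[OF c, of "1 - ?a"] a01 by simp
  finally show ?thesis unfolding a by simp
qed

lemma EF_diff: "EF d c n (\<lambda>X. f X - g X) = EF d c n f - EF d c n g"
  by simp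

lemma PF_single_rest:
  assumes "\<sigma> \<in> cells n (Suc d)" "0 \<le> c" "c \<le> real n"
  shows "PF d c n (\<lambda>X. \<sigma> \<in> X \<and> P (X - {\<sigma>})) = c / real n * PF d c n (\<lambda>X. P (X - {\<sigma>}))"
    and "PF d c n (\<lambda>X. \<sigma> \<in> X) = c / real n"
proof -
  have p: "0 \<le> c / real n" "c / real n \<le> 1" using assms by (auto simp: divide_le_eq_1)
  have s: "{\<sigma>} \<subseteq> cells n (Suc d)" using assms by simp
  show "PF d c n (\<lambda>X. \<sigma> \<in> X \<and> P (X - {\<sigma>})) = c / real n * PF d c n (\<lambda>X. P (X - {\<sigma>}))"
    using expectation_subset_and_rest[OF finite_cells s order_refl p, of "\<lambda>Z. of_bool (P Z)"]
    by (simp add: random_faces_def of_bool_conj)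
  show "PF d c n (\<lambda>X. \<sigma> \<in> X) = c / real n"
    using prob_subset_random_subset[OF finite_cells s p] by (simp add: random_faces_def)
qed

lemma choose_Suc_real:
  assumes "d \<le> n"
  shows "real (n choose Suc d) * (real d + 1) = real (n choose d) * (real n - real d)"
proof -
  have "Suc d * (n choose Suc d) = (n - d) * (n choose d)"
    by (metis Suc_diff_Suc Suc_times_binomial_add add.commute assms binomial_absorb_comp binomial_absorption le_add_diff_inverse mult.commute)
  then have "real (Suc d) * real (n choose Suc d) = real (n - d) * real (n choose d)" by (metis of_nat_mult)
  then show ?thesis using assms by (simp add: of_nat_diff algebra_simps)
qed

definition core_faces :: "nat \<Rightarrow> nat \<Rightarrow> nat \<Rightarrow> nat set set \<Rightarrow> nat set set" where
  "core_faces n d r X = {e \<in> cells n d. 2 \<le> degree_after (Suc r) e X}"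

lemma expected_core_faces_le:
  assumes c: "0 < c" and eps: "\<epsilon> > 0"
  shows "\<exists>n0. \<forall>n\<ge>n0. EF d c n (\<lambda>X. real (card (core_faces n d r X)))
    \<le> real (n choose d) * (1 - collapse_prob d c (Suc r) - c * (1 - collapse_prob d c r) ^ d * collapse_prob d c (Suc r) + \<epsilon>)"
proof -
  let ?v = "1 - collapse_prob d c (Suc r) - c * (1 - collapse_prob d c r) ^ d * collapse_prob d c (Suc r)"
  obtain n0 where n0: "\<And>n e f. n \<ge> n0 \<Longrightarrow> e \<in> cells n d \<Longrightarrow> (\<And>x. 0 \<le> (f x :: real) \<and> f x \<le> 1) \<Longrightarrow>
     \<bar>EF d c n (\<lambda>X. f (degree_after (Suc r) e X)) - expect (core_law c d (Suc r)) f\<bar> \<le> \<epsilon>"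
    using local_limit_single[OF c eps, of d alive 1 "Suc r"] by blast
  have "EF d c n (\<lambda>X. real (card (core_faces n d r X))) \<le> real (n choose d) * (?v + \<epsilon>)" if n: "n \<ge> n0" for n
  proof -
    have one: "PF d c n (\<lambda>X. 2 \<le> degree_after (Suc r) e X) \<le> ?v + \<epsilon>" if e: "e \<in> cells n d" for e
      using n0[OF n e, of "\<lambda>x. of_bool (2 \<le> x)"] unfolding prob_core_law_ge_two[OF c] by simp
    have "EF d c n (\<lambda>X. real (card (core_faces n d r X))) = EF d c n (\<lambda>X. \<Sum>e\<in>cells n d. of_bool (2 \<le> degree_after (Suc r) e X))"
      by (simp add: core_faces_def Int_def)
    also have "\<dots> = (\<Sum>e\<in>cells n d. PF d c n (\<lambda>X. 2 \<le> degree_after (Suc r) e X))" by (rule EF_sum)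
    also have "\<dots> \<le> (\<Sum>e\<in>cells n d. ?v + \<epsilon>)" by (intro sum_mono one)
    finally show ?thesis by (simp add: card_cells)
  qed
  then show ?thesis by blast
qed

text \<open>
  Given \<open>\<sigma>\<close>, the other faces are independent of the presence of \<open>\<sigma>\<close>, and the values at the \<open>d + 1\<close> facets
  of \<open>\<sigma>\<close> are nearly independent, so all facets have surviving faces besides \<open>\<sigma>\<close> with probability about
  \<open>(1 - t)^(d + 1)\<close> for \<open>t = collapse_prob d c (Suc r)\<close>. The facets reach each other, and \<open>\<sigma>\<close> lies in \<open>X\<close>, with probability \<open>O(1 / n)\<close> only.
\<close>

lemma expected_core_cells_ge:
  assumes c: "0 < c" and eps: "\<epsilon> > 0"
  shows "\<exists>n0. \<forall>n\<ge>n0. EF d c n (\<lambda>X. real (card {\<sigma> \<in> X. facets \<sigma> \<subseteq> core_faces n d r X}))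
    \<ge> real (n choose Suc d) * (c / real n) * ((1 - collapse_prob d c (Suc r)) ^ Suc d - \<epsilon>)"
proof -
  let ?v = "(1 - collapse_prob d c (Suc r)) ^ Suc d"
  define \<delta> where "\<delta> = \<epsilon> / 2"
  have \<delta>: "\<delta> > 0" using eps by (simp add: \<delta>_def)
  obtain n1 where n1: "\<And>n es f. n \<ge> n1 \<Longrightarrow> length es = Suc d \<Longrightarrow> set es \<subseteq> cells n d \<Longrightarrow> distinct es \<Longrightarrow>
     (\<And>xs. 0 \<le> (f xs :: real) \<and> f xs \<le> 1) \<Longrightarrow>
     \<bar>EF d c n (\<lambda>X. f (map (\<lambda>e. degree_after (Suc r) e X) es))
      - expect (replicate_pmf (Suc d) (core_law c d (Suc r))) f\<bar> \<le> \<delta>"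
    using local_limit[OF c \<delta>, of "Suc d" d alive 1 "Suc r"] by blast
  obtain C where C: "C \<ge> 0" "\<And>n e e'. 0 < n \<Longrightarrow> c \<le> real n \<Longrightarrow> e \<in> cells n d \<Longrightarrow> e' \<in> cells n d \<Longrightarrow>
      e' \<noteq> e \<Longrightarrow> PF d c n (\<lambda>X. e' \<in> reach (Suc r) e X) \<le> C / real n"
    using reach_prob[of c d "Suc r"] c by auto
  define M where "M = real (Suc d * Suc d) * C + c"
  define n0 where "n0 = n1 + nat \<lceil>c\<rceil> + nat \<lceil>M / \<delta>\<rceil> + 1"
  have "real (n choose Suc d) * (c / real n) * (?v - \<epsilon>) \<le> EF d c n (\<lambda>X. real (card {\<sigma> \<in> X. facets \<sigma> \<subseteq> core_faces n d r X}))"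
    if n: "n \<ge> n0" for n
  proof -
    have nb: "n > 0" "c \<le> real n" "n \<ge> n1" "M / \<delta> \<le> real n" using n unfolding n0_def by linarith+
    have cnn: "0 \<le> c" using c by simp
    have Mn: "M / real n \<le> \<delta>" using nb \<delta> by (simp add: field_simps)
    \<comment> \<open>The hypotheses of \<open>core_face\<close>, as an event that does not depend on the presence of \<open>\<sigma>\<close>.\<close>
    define Q where "Q = (\<lambda>\<sigma> Z. (\<forall>e\<in>facets \<sigma>. 1 \<le> degree_after (Suc r) e Z) \<and>
        \<not> (\<exists>(e, e')\<in>facets \<sigma> \<times> facets \<sigma>. e \<noteq> e' \<and> e' \<in> reach (Suc r) e Z))"
    have one: "c / real n * (?v - \<epsilon>) \<le> PF d c n (\<lambda>X. \<sigma> \<in> X \<and> Q \<sigma> (X - {\<sigma>}))" if \<sigma>: "\<sigma> \<in> cells n (Suc d)" for \<sigma>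
    proof -
      have finf: "finite (facets \<sigma>)" using card_facets[OF \<sigma>] by (intro card_ge_0_finite) simp
      obtain es where es: "set es = facets \<sigma>" "distinct es" using finite_distinct_list[OF finf] by blast
      have len: "length es = Suc d" using distinct_card[OF es(2)] card_facets[OF \<sigma>] es by simp
      have "\<bar>PF d c n (\<lambda>X. \<forall>x\<in>set (map (\<lambda>e. degree_after (Suc r) e X) es). 1 \<le> x)
        - expect (replicate_pmf (Suc d) (core_law c d (Suc r))) (\<lambda>xs. of_bool (\<forall>x\<in>set xs. 1 \<le> x))\<bar> \<le> \<delta>"
        by (rule n1[OF nb(3) len _ es(2)]) (use facets_cells[OF \<sigma>] es in auto)
      then have 1: "?v - \<delta> \<le> PF d c n (\<lambda>X. \<forall>e\<in>facets \<sigma>. 1 \<le> degree_after (Suc r) e X)"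
        unfolding expectation_replicate_all prob_core_law_pos[OF c] by (simp add: es del: collapse_prob.simps power_Suc)
      define I where "I = {(e, e'). e \<in> facets \<sigma> \<and> e' \<in> facets \<sigma> \<and> e \<noteq> e'}"
      have I: "I \<subseteq> facets \<sigma> \<times> facets \<sigma>" by (auto simp: I_def)
      have fI: "finite I" using finite_subset[OF I] finf by simp
      have "card I \<le> Suc d * Suc d" using card_mono[OF _ I] finf card_facets[OF \<sigma>] by (simp add: card_cartesian_product)
      then have cI: "real (card I) \<le> real (Suc d * Suc d)" by (rule of_nat_mono)
      let ?I = "\<lambda>X. \<exists>i\<in>I. snd i \<in> reach (Suc r) (fst i) X"
      have 2: "PF d c n ?I \<le> real (Suc d * Suc d) * (C / real n)"
      proof -
        have "PF d c n ?I \<le> (\<Sum>i\<in>I. PF d c n (\<lambda>X. snd i \<in> reach (Suc r) (fst i) X))" by (rule PF_union[OF fI])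
        also have "\<dots> \<le> (\<Sum>i\<in>I. C / real n)"
          using facets_cells[OF \<sigma>] nb by (intro sum_mono) (auto simp: I_def simp del: reach.simps intro!: C(2))
        also have "\<dots> = real (card I) * (C / real n)" by simp
        also have "\<dots> \<le> real (Suc d * Suc d) * (C / real n)" using C(1) cI by (intro mult_right_mono) auto
        finally show ?thesis .
      qed
      have "PF d c n (\<lambda>X. \<forall>e\<in>facets \<sigma>. 1 \<le> degree_after (Suc r) e X)
        \<le> PF d c n (\<lambda>X. Q \<sigma> (X - {\<sigma>})) + PF d c n (\<lambda>X. ?I X \<or> \<sigma> \<in> X)"
      proof (rule PF_disj)
        fix X assume deg: "\<forall>e\<in>facets \<sigma>. 1 \<le> degree_after (Suc r) e X"
        show "Q \<sigma> (X - {\<sigma>}) \<or> (?I X \<or> \<sigma> \<in> X)"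
        proof (cases "\<sigma> \<in> X")
          case False
          then have "X - {\<sigma>} = X" by blast
          then show ?thesis using deg unfolding Q_def I_def by fastforce
        qed simp
      qed
      also have "PF d c n (\<lambda>X. ?I X \<or> \<sigma> \<in> X) \<le> PF d c n ?I + PF d c n (\<lambda>X. \<sigma> \<in> X)" by (rule PF_disj)
      finally have "?v - \<delta> - real (Suc d * Suc d) * (C / real n) - c / real n \<le> PF d c n (\<lambda>X. Q \<sigma> (X - {\<sigma>}))"
        using 1 2 PF_single_rest(2)[OF \<sigma> cnn nb(2)] by linarith
      then have "?v - \<epsilon> \<le> PF d c n (\<lambda>X. Q \<sigma> (X - {\<sigma>}))"
        using Mn by (simp add: M_def \<delta>_def add_divide_distrib del: power_Suc collapse_prob.simps)
      then have "c / real n * (?v - \<epsilon>) \<le> c / real n * PF d c n (\<lambda>X. Q \<sigma> (X - {\<sigma>}))"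
        using c by (intro mult_left_mono) auto
      then show ?thesis unfolding PF_single_rest(1)[OF \<sigma> cnn nb(2), of "Q \<sigma>"] .
    qed
    have "real (n choose Suc d) * (c / real n) * (?v - \<epsilon>) = (\<Sum>\<sigma>\<in>cells n (Suc d). c / real n * (?v - \<epsilon>))"
      by (simp add: card_cells del: binomial_Suc_Suc)
    also have "\<dots> \<le> (\<Sum>\<sigma>\<in>cells n (Suc d). PF d c n (\<lambda>X. \<sigma> \<in> X \<and> Q \<sigma> (X - {\<sigma>})))"
      by (intro sum_mono one)
    also have "\<dots> = EF d c n (\<lambda>X. \<Sum>\<sigma>\<in>cells n (Suc d). of_bool (\<sigma> \<in> X \<and> Q \<sigma> (X - {\<sigma>})))"
      by (rule EF_sum[symmetric])
    also have "\<dots> \<le> EF d c n (\<lambda>X. real (card {\<sigma> \<in> X. facets \<sigma> \<subseteq> core_faces n d r X}))"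
    proof (rule EF_mono)
      fix X assume X: "X \<subseteq> cells n (Suc d)"
      have "(\<Sum>\<sigma>\<in>cells n (Suc d). of_bool (\<sigma> \<in> X \<and> Q \<sigma> (X - {\<sigma>})) :: real)
          = real (card {\<sigma> \<in> cells n (Suc d). \<sigma> \<in> X \<and> Q \<sigma> (X - {\<sigma>})})"
        by (simp add: Int_def)
      also have "\<dots> \<le> real (card {\<sigma> \<in> X. facets \<sigma> \<subseteq> core_faces n d r X})"
      proof (intro of_nat_mono card_mono subsetI)
        show "finite {\<sigma> \<in> X. facets \<sigma> \<subseteq> core_faces n d r X}" using finite_subset[OF X] by simp
        fix \<sigma> assume "\<sigma> \<in> {\<sigma> \<in> cells n (Suc d). \<sigma> \<in> X \<and> Q \<sigma> (X - {\<sigma>})}"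
        then have \<sigma>: "\<sigma> \<in> cells n (Suc d)" "\<sigma> \<in> X" "Q \<sigma> (X - {\<sigma>})" by auto
        have "e \<in> core_faces n d r X" if e: "e \<in> facets \<sigma>" for e
        proof -
          have "2 \<le> degree_after (Suc r) e X"
            by (rule core_face[OF \<sigma>(1) X \<sigma>(2) _ _ e]) (use \<sigma>(3) in \<open>auto simp: Q_def simp del: reach.simps\<close>)
          then show ?thesis using facets_cells[OF \<sigma>(1)] e by (auto simp: core_faces_def)
        qed
        then show "\<sigma> \<in> {\<sigma> \<in> X. facets \<sigma> \<subseteq> core_faces n d r X}" using \<sigma> by auto
      qed
      finally show "(\<Sum>\<sigma>\<in>cells n (Suc d). of_bool (\<sigma> \<in> X \<and> Q \<sigma> (X - {\<sigma>}))) \<le> real (card {\<sigma> \<in> X. facets \<sigma> \<subseteq> core_faces n d r X})" .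
    qed
    finally show ?thesis .
  qed
  then show ?thesis by blast
qed

section \<open>Linear algebra of the boundary operator\<close>

abbreviation lookup :: "('a \<Rightarrow>\<^sub>0 real) \<Rightarrow> 'a \<Rightarrow> real" where
  "lookup \<equiv> Poly_Mapping.lookup"

lemma lookup_scaleR: "lookup (r *\<^sub>R f) x = r * lookup f x"
  for r :: real and f :: "'a \<Rightarrow>\<^sub>0 real"
proof -
  have "finite {i. r *\<^sub>R lookup f i \<noteq> 0}"
    by (rule finite_subset[OF _ finite_keys[of f]]) (auto simp: in_keys_iff)
  then show ?thesis by (simp add: scaleR_poly_mapping_def lookup_Abs_poly_mapping)
qed

lemma lookup_sum: "lookup (\<Sum>i\<in>I. f i) x = (\<Sum>i\<in>I. lookup (f i) x)"
  by (induction I rule: infinite_finite_induct) (auto simp: lookup_add)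

lemma boundary_superset:
  assumes "finite S" "Poly_Mapping.keys f \<subseteq> S"
  shows "boundary f = (\<Sum>\<sigma>\<in>S. lookup f \<sigma> *\<^sub>R boundary_face \<sigma>)"
  unfolding boundary_def using assms
  by (intro sum.mono_neutral_left) (auto simp: in_keys_iff)

lemma linear_boundary: "linear boundary"
proof (rule linearI)
  fix f g :: "'a set \<Rightarrow>\<^sub>0 real" and r :: real
  let ?S = "Poly_Mapping.keys f \<union> Poly_Mapping.keys g"
  have "Poly_Mapping.keys (f + g) \<subseteq> ?S" by (rule Poly_Mapping.keys_add)
  then show "boundary (f + g) = boundary f + boundary g"
    by (simp add: boundary_superset[of ?S] lookup_add scaleR_add_left sum.distrib)
  have "Poly_Mapping.keys (r *\<^sub>R f) \<subseteq> Poly_Mapping.keys f" by (auto simp: in_keys_iff lookup_scaleR)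
  then show "boundary (r *\<^sub>R f) = r *\<^sub>R boundary f"
    by (simp add: lookup_scaleR boundary_superset[of "Poly_Mapping.keys f"] scaleR_sum_right)
qed

lemma boundary_single: "boundary (Poly_Mapping.single \<sigma> 1) = boundary_face \<sigma>"
  by (simp add: boundary_def)

definition cycles :: "'a::linorder set set \<Rightarrow> ('a set \<Rightarrow>\<^sub>0 real) set" where
  "cycles X = {f. Poly_Mapping.keys f \<subseteq> X \<and> boundary f = 0}"

lemma top_homology_cycles: "top_homology d Y = cycles (faces d Y)"
  by (simp add: top_homology_def chains_def cycles_def)

abbreviation unit :: "'a \<Rightarrow> 'a \<Rightarrow>\<^sub>0 real" where
  "unit x \<equiv> Poly_Mapping.single x 1"

lemma single_scaleR: "Poly_Mapping.single x a = a *\<^sub>R unit x" for a :: real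
  by (rule poly_mapping_eqI) (simp add: lookup_scaleR lookup_single when_def)

lemma sum_squares_unit:
  assumes "finite E" "e \<in> E"
  shows "(\<Sum>x\<in>E. (lookup (unit e) x)\<^sup>2) = 1"
proof -
  have "(\<Sum>x\<in>E. (lookup (unit e) x)\<^sup>2) = (\<Sum>x\<in>E. if x = e then 1 else 0)"
    by (intro sum.cong) (auto simp: lookup_single when_def)
  then show ?thesis using assms by simp
qed

lemma sum_units: "finite S \<Longrightarrow> Poly_Mapping.keys f \<subseteq> S \<Longrightarrow> f = (\<Sum>x\<in>S. lookup f x *\<^sub>R unit x)"
  by (intro poly_mapping_eqI)
    (auto simp: lookup_sum lookup_scaleR lookup_single when_def in_keys_iff sum.delta' if_distrib cong: if_cong)

lemma subspace_keys: "subspace {f :: 'a \<Rightarrow>\<^sub>0 real. Poly_Mapping.keys f \<subseteq> S}"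
  unfolding subspace_def
proof (intro conjI ballI allI)
  fix f g :: "'a \<Rightarrow>\<^sub>0 real" and r :: real
  assume f: "f \<in> {f. Poly_Mapping.keys f \<subseteq> S}" and g: "g \<in> {f. Poly_Mapping.keys f \<subseteq> S}"
  show "f + g \<in> {f. Poly_Mapping.keys f \<subseteq> S}" using f g Poly_Mapping.keys_add[of f g] by auto
next
  fix f :: "'a \<Rightarrow>\<^sub>0 real" and r :: real
  assume f: "f \<in> {f. Poly_Mapping.keys f \<subseteq> S}"
  then show "r *\<^sub>R f \<in> {f. Poly_Mapping.keys f \<subseteq> S}" by (auto simp: in_keys_iff lookup_scaleR)
qed simp

lemma span_units: "finite S \<Longrightarrow> span (unit ` S) = {f :: 'a \<Rightarrow>\<^sub>0 real. Poly_Mapping.keys f \<subseteq> S}"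
proof (intro equalityI subsetI)
  fix f :: "'a \<Rightarrow>\<^sub>0 real" assume S: "finite S" "f \<in> {f. Poly_Mapping.keys f \<subseteq> S}"
  have "(\<Sum>x\<in>S. lookup f x *\<^sub>R unit x) \<in> span (unit ` S)"
    by (intro span_sum span_scale span_base imageI)
  then show "f \<in> span (unit ` S)" using sum_units[of S f] S by simp
next
  fix f :: "'a \<Rightarrow>\<^sub>0 real" assume "f \<in> span (unit ` S)"
  then show "f \<in> {f. Poly_Mapping.keys f \<subseteq> S}"
    by (rule span_induct) (auto intro: subspace_keys)
qed

lemma inj_unit: "inj unit"
  by (rule injI) (metis lookup_single_eq lookup_single_not_eq zero_neq_one)

lemma independent_units: "finite S \<Longrightarrow> independent (unit ` S)"
proof (rule real_vector.independent_if_scalars_zero)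
  assume "finite S"
  then show "finite (unit ` S)" by simp
  fix u and x :: "'a \<Rightarrow>\<^sub>0 real" assume z: "(\<Sum>x\<in>unit ` S. u x *\<^sub>R x) = 0" and x: "x \<in> unit ` S"
  then obtain y where y: "y \<in> S" "x = unit y" by auto
  have "0 = lookup (\<Sum>x\<in>unit ` S. u x *\<^sub>R x) y" using z by simp
  also have "\<dots> = (\<Sum>x\<in>S. u (unit x) * lookup (unit x) y)"
    using inj_unit by (subst sum.reindex) (auto simp: lookup_sum lookup_scaleR inj_on_def)
  also have "\<dots> = u x"
    using y \<open>finite S\<close> by (simp add: lookup_single when_def sum.delta' if_distrib cong: if_cong)
  finally show "u x = 0" by simp
qed

lemma card_units: "card (unit ` S) = card S"
  by (rule card_image) (rule inj_on_subset[OF inj_unit subset_UNIV])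

lemma subspace_cycles: "subspace (cycles X)"
proof -
  have "cycles X = {f. Poly_Mapping.keys f \<subseteq> X} \<inter> {f. boundary f = 0}" by (auto simp: cycles_def)
  then show ?thesis
    by (simp only: real_vector.subspace_inter subspace_keys linear_subspace_kernel[OF linear_boundary])
qed

text \<open>
  Rank and nullity, with a basis of the image that consists of boundaries of faces. A basis of the cycles
  is extended by basis chains \<open>unit \<sigma>\<close> for \<open>\<sigma>\<close> in a set \<open>B\<close>; the boundary operator is injective on
  their span.
\<close>

lemma kernel_complement:
  fixes X :: "'a::linorder set set"
  assumes X: "finite X"
  obtains B where "B \<subseteq> X" "card B + dim (cycles X) = card X"
    "boundary_face ` X \<subseteq> span (boundary_face ` B)" "card (boundary_face ` B) = card B"
    "independent (boundary_face ` B :: ('a set \<Rightarrow>\<^sub>0 real) set)"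
proof -
  let ?S = "unit ` X"
  obtain K where K: "K \<subseteq> cycles X" "independent K" "cycles X \<subseteq> span K" "card K = dim (cycles X)"
    by (rule real_vector.basis_exists)
  have KS: "K \<subseteq> span ?S" using K(1) by (auto simp: span_units[OF X] cycles_def)
  have finS: "finite ?S" using X by simp
  have finK: "finite K" using real_vector.independent_span_bound[OF finS K(2) KS] by simp
  obtain D where D: "K \<subseteq> D" "D \<subseteq> K \<union> ?S" "independent D" "K \<union> ?S \<subseteq> span D"
    using real_vector.maximal_independent_subset_extend[of K "K \<union> ?S"] K(2) by blast
  have finD: "finite D" using D(2) finK finS finite_subset by blast
  have "span D = span ?S"
    using D KS by (metis (no_types, lifting) Un_subset_iff span_eq span_superset subset_trans)
  then have "card D = card ?S"
    using D(3) independent_units[OF X] by (metis real_vector.dim_eq_card)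
  then have cD: "card D = card X" by (simp add: card_units)
  define B where "B = {\<sigma> \<in> X. unit \<sigma> \<in> D - K}"
  have DB: "D - K = unit ` B" using D(2) by (auto simp: B_def)
  have cB: "card B + card K = card X"
    using cD D(1) finD finK card_Diff_subset[of K D] card_mono[of D K] unfolding DB card_units by simp
  \<comment> \<open>\<open>D\<close> is independent, so the spans of its two parts meet only in \<open>0\<close>.\<close>
  have disj: "x = 0" if x: "x \<in> span (unit ` B)" "x \<in> span K" for x
  proof -
    have fB: "finite (unit ` B)" using X by (simp add: B_def)
    obtain u where u: "x = (\<Sum>v\<in>unit ` B. u v *\<^sub>R v)" using x(1) real_vector.span_finite[OF fB] by auto
    obtain w where w: "x = (\<Sum>v\<in>K. w v *\<^sub>R v)" using x(2) real_vector.span_finite[OF finK] by auto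
    have int: "K \<inter> unit ` B = {}" using DB by auto
    have un: "D = K \<union> unit ` B" using DB D(1) by auto
    have "(\<Sum>v\<in>D. (if v \<in> K then w v else - u v) *\<^sub>R v)
        = (\<Sum>v\<in>K. (if v \<in> K then w v else - u v) *\<^sub>R v) + (\<Sum>v\<in>unit ` B. (if v \<in> K then w v else - u v) *\<^sub>R v)"
      unfolding un by (rule sum.union_disjoint[OF finK fB int])
    also have "(\<Sum>v\<in>K. (if v \<in> K then w v else - u v) *\<^sub>R v) = x" unfolding w by (intro sum.cong) auto
    also have "(\<Sum>v\<in>unit ` B. (if v \<in> K then w v else - u v) *\<^sub>R v) = (\<Sum>v\<in>unit ` B. - (u v *\<^sub>R v))"
      using int by (intro sum.cong) auto
    also have "\<dots> = - x" unfolding u by (rule sum_negf)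
    finally have z: "(\<Sum>v\<in>D. (if v \<in> K then w v else - u v) *\<^sub>R v) = 0" by simp
    have "w v = 0" if "v \<in> K" for v
      using real_vector.independentD[OF D(3) finD order_refl z, of v] that D(1) by auto
    then show ?thesis unfolding w by simp
  qed
  have im: "boundary ` unit ` B = boundary_face ` B" by (simp add: image_image boundary_single)
  have inj: "inj_on boundary (span (unit ` B))"
    unfolding linear_injective_on_subspace_0[OF linear_boundary real_vector.subspace_span]
  proof (intro ballI impI)
    fix x assume x: "x \<in> span (unit ` B)" "boundary x = 0"
    have "B \<subseteq> X" by (auto simp: B_def)
    then have "Poly_Mapping.keys x \<subseteq> X" using x(1) span_units[of B] X finite_subset[of B X] by auto
    then have "x \<in> span K" using K(3) x(2) by (auto simp: cycles_def)
    then show "x = 0" using disj x(1) by blast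
  qed
  show ?thesis
  proof
    show "B \<subseteq> X" by (auto simp: B_def)
    show "card B + dim (cycles X) = card X" using cB K(4) by simp
    have iD: "independent (unit ` B)" using D(3) DB by (metis Diff_subset real_vector.independent_mono)
    show "independent (boundary_face ` B :: ('a set \<Rightarrow>\<^sub>0 real) set)"
      unfolding im[symmetric] by (rule linear_independent_injective_image[OF linear_boundary iD inj])
    have "card (boundary ` unit ` B) = card (unit ` B)"
      by (rule card_image) (rule inj_on_subset[OF inj real_vector.span_superset])
    then show "card (boundary_face ` B) = card B" unfolding im card_units .
    show "boundary_face ` X \<subseteq> span (boundary_face ` B)"
    proof
      fix y assume "y \<in> boundary_face ` X"
      then obtain \<sigma> where s: "\<sigma> \<in> X" "y = boundary (unit \<sigma>)" by (auto simp: boundary_single)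
      have "unit \<sigma> \<in> span D" using D(4) s by auto
      then have "boundary (unit \<sigma>) \<in> boundary ` span D" by (rule imageI)
      also have "\<dots> = span (boundary ` D)" by (rule linear_span_image[OF linear_boundary, symmetric])
      also have "\<dots> \<subseteq> span (boundary_face ` B)"
      proof (rule real_vector.span_minimal[OF _ real_vector.subspace_span], rule subsetI)
        fix z assume "z \<in> boundary ` D"
        then obtain x where x: "x \<in> D" "z = boundary x" by auto
        show "z \<in> span (boundary_face ` B)"
        proof (cases "x \<in> K")
          case True
          then have "z = 0" using K(1) x by (auto simp: cycles_def)
          then show ?thesis by (simp add: real_vector.span_zero)
        next
          case False
          then have "z \<in> boundary ` unit ` B" unfolding DB[symmetric] using x by blast
          then show ?thesis unfolding im by (rule real_vector.span_base)
        qed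
      qed
      finally show "y \<in> span (boundary_face ` B)" using s by simp
    qed
  qed
qed

lemma boundary_face_in_span:
  "finite \<sigma> \<Longrightarrow> boundary_face \<sigma> \<in> span (unit ` facets \<sigma>)"
  unfolding boundary_face_def
  by (subst single_scaleR, intro real_vector.span_sum real_vector.span_scale real_vector.span_base imageI)
    (auto simp: facets_def)

lemma cycles_subset_span: "finite X \<Longrightarrow> cycles X \<subseteq> span (unit ` X)"
  by (auto simp: span_units cycles_def)

lemma dim_mono_finite:
  fixes V :: "('b::real_vector) set"
  assumes "V \<subseteq> W" "W \<subseteq> span S" "finite S"
  shows "dim V \<le> dim W"
proof -
  obtain K where K: "K \<subseteq> V" "independent K" "V \<subseteq> span K" "card K = dim V" by (rule real_vector.basis_exists)
  obtain L where L: "L \<subseteq> W" "independent L" "W \<subseteq> span L" "card L = dim W" by (rule real_vector.basis_exists)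
  have "finite L" using real_vector.independent_span_bound[OF assms(3) L(2)] L(1) assms(2) by blast
  then have "card K \<le> card L" using real_vector.independent_span_bound[of L K] K L assms by blast
  then show ?thesis using K L by simp
qed

text \<open>
  The boundaries of the faces with all facets in \<open>A\<close> lie in a space of dimension \<open>card A\<close>.
\<close>

lemma dim_cycles_ge:
  assumes X: "finite X" and fin: "\<And>\<sigma>. \<sigma> \<in> X \<Longrightarrow> finite \<sigma>" and A: "finite A"
  shows "card {\<sigma> \<in> X. facets \<sigma> \<subseteq> A} \<le> dim (cycles X) + card A"
proof -
  let ?X = "{\<sigma> \<in> X. facets \<sigma> \<subseteq> A}"
  have fX: "finite ?X" using X by simp
  obtain B where B: "B \<subseteq> ?X" "card B + dim (cycles ?X) = card ?X"
    "boundary_face ` ?X \<subseteq> span (boundary_face ` B)" "card (boundary_face ` B) = card B"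
    "independent (boundary_face ` B :: ('a set \<Rightarrow>\<^sub>0 real) set)"
    by (rule kernel_complement[OF fX])
  have "boundary_face ` B \<subseteq> span (unit ` A)"
  proof
    fix y assume "y \<in> boundary_face ` B"
    then obtain \<sigma> where s: "\<sigma> \<in> X" "facets \<sigma> \<subseteq> A" "y = boundary_face \<sigma>" using B by auto
    then have "y \<in> span (unit ` facets \<sigma>)" using boundary_face_in_span fin by blast
    also have "\<dots> \<subseteq> span (unit ` A)" using s by (intro real_vector.span_mono image_mono)
    finally show "y \<in> span (unit ` A)" .
  qed
  then have "card (boundary_face ` B :: ('a set \<Rightarrow>\<^sub>0 real) set) \<le> card (unit ` A)"
    using real_vector.independent_span_bound[OF finite_imageI[OF A] B(5)] by blast
  then have "card B \<le> card A" using B(4) by (simp add: card_units)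
  moreover have "dim (cycles ?X) \<le> dim (cycles X)"
    by (rule dim_mono_finite[OF _ cycles_subset_span[OF X]]) (use X in \<open>auto simp: cycles_def\<close>)
  ultimately show ?thesis using B(2) by linarith
qed

text \<open>
  Two cycles that both use the new face \<open>\<sigma>\<close> differ, after scaling, by a cycle that avoids it.
\<close>

lemma dim_cycles_insert:
  assumes X: "finite X"
  shows "\<bar>real (dim (cycles (insert \<sigma> X))) - real (dim (cycles X))\<bar> \<le> 1"
proof -
  have ge: "dim (cycles X) \<le> dim (cycles (insert \<sigma> X))"
    by (rule dim_mono_finite[OF _ cycles_subset_span[of "insert \<sigma> X"]]) (use X in \<open>auto simp: cycles_def\<close>)
  obtain K where K: "K \<subseteq> cycles X" "independent K" "cycles X \<subseteq> span K" "card K = dim (cycles X)"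
    by (rule real_vector.basis_exists)
  have fK: "finite K"
    using real_vector.independent_span_bound[OF _ K(2), of "unit ` X"] K(1) cycles_subset_span[OF X] X by auto
  have le: "dim (cycles (insert \<sigma> X)) \<le> dim (cycles X) + 1"
  proof (cases "\<exists>f\<in>cycles (insert \<sigma> X). lookup f \<sigma> \<noteq> 0")
    case False
    then have "cycles (insert \<sigma> X) \<subseteq> cycles X"
      by (auto simp: cycles_def subset_iff in_keys_iff)
    then have "dim (cycles (insert \<sigma> X)) \<le> dim (cycles X)" by (rule dim_mono_finite[OF _ cycles_subset_span[OF X]]) (use X in simp)
    then show ?thesis by simp
  next
    case True
    then obtain f where f: "f \<in> cycles (insert \<sigma> X)" "lookup f \<sigma> \<noteq> 0" by blast
    have "cycles (insert \<sigma> X) \<subseteq> span (insert f K)"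
    proof
      fix g assume g: "g \<in> cycles (insert \<sigma> X)"
      define k where "k = lookup g \<sigma> / lookup f \<sigma>"
      have h: "g - k *\<^sub>R f \<in> cycles (insert \<sigma> X)"
        by (intro real_vector.subspace_diff[OF subspace_cycles] real_vector.subspace_scale[OF subspace_cycles] f g)
      have "lookup (g - k *\<^sub>R f) \<sigma> = 0" using f by (simp add: lookup_minus lookup_scaleR k_def)
      then have "g - k *\<^sub>R f \<in> cycles X" using h by (auto simp: cycles_def subset_iff in_keys_iff)
      then have "g - k *\<^sub>R f \<in> span K" using K(3) by blast
      then show "g \<in> span (insert f K)" unfolding real_vector.span_insert by blast
    qed
    then have "dim (cycles (insert \<sigma> X)) \<le> card (insert f K)" using fK by (intro real_vector.dim_le_card) auto
    also have "\<dots> \<le> card K + 1" using card_insert_le_m1[of "card K + 1" K f] fK by (simp add: card_insert_if)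
    finally show ?thesis using K(4) by simp
  qed
  show ?thesis using ge le by simp
qed

section \<open>Distance to a subspace\<close>

text \<open>
  Gram--Schmidt for functions on a finite set. A vector whose projection residual vanishes is skipped, so
  the family may be smaller than \<open>B\<close>.
\<close>

lemma orthonormal_spanning:
  fixes b :: "'i \<Rightarrow> 'e \<Rightarrow> real"
  assumes E: "finite E" and B: "finite B"
  shows "\<exists>U. finite U \<and> card U \<le> card B \<and> (\<forall>g\<in>U. \<forall>g'\<in>U. (\<Sum>x\<in>E. g x * g' x) = (if g = g' then 1 else 0)) \<and>
    (\<forall>i\<in>B. \<exists>a. \<forall>x\<in>E. b i x = (\<Sum>g\<in>U. a g * g x))"
  using B
proof (induction B rule: finite_induct)
  case empty
  show ?case by (intro exI[of _ "{}"]) auto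
next
  case (insert i B)
  then obtain U where U: "finite U" "card U \<le> card B" "\<And>g g'. g \<in> U \<Longrightarrow> g' \<in> U \<Longrightarrow> (\<Sum>x\<in>E. g x * g' x) = (if g = g' then 1 else 0)"
    "\<And>j. j \<in> B \<Longrightarrow> \<exists>a. \<forall>x\<in>E. b j x = (\<Sum>g\<in>U. a g * g x)" by blast
  define a where "a = (\<lambda>g. \<Sum>x\<in>E. b i x * g x)"
  \<comment> \<open>The residual of the projection of the new vector.\<close>
  define p where "p = (\<lambda>x. b i x - (\<Sum>g\<in>U. a g * g x))"
  have orth: "(\<Sum>x\<in>E. p x * g x) = 0" if g: "g \<in> U" for g
  proof -
    have "(\<Sum>x\<in>E. p x * g x) = a g - (\<Sum>x\<in>E. (\<Sum>g'\<in>U. a g' * g' x) * g x)"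
      by (simp add: p_def a_def left_diff_distrib sum_subtractf)
    also have "(\<Sum>x\<in>E. (\<Sum>g'\<in>U. a g' * g' x) * g x) = (\<Sum>g'\<in>U. a g' * (\<Sum>x\<in>E. g' x * g x))"
      by (simp add: sum_distrib_left sum_distrib_right mult.assoc) (rule sum.swap)
    also have "\<dots> = (\<Sum>g'\<in>U. if g' = g then a g' else 0)"
      using g by (intro sum.cong) (auto simp: U(3))
    also have "\<dots> = a g" using g U(1) by simp
    finally show ?thesis by simp
  qed
  show ?case
  proof (cases "(\<Sum>x\<in>E. p x * p x) = 0")
    case True
    then have "\<forall>x\<in>E. p x * p x = 0" using E by (subst (asm) sum_nonneg_eq_0_iff) auto
    then have "\<forall>x\<in>E. b i x = (\<Sum>g\<in>U. a g * g x)" by (simp add: p_def)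
    then have "\<forall>j\<in>insert i B. \<exists>a. \<forall>x\<in>E. b j x = (\<Sum>g\<in>U. a g * g x)" using U(4) by blast
    then show ?thesis using U insert by (intro exI[of _ U]) auto
  next
    case False
    define s where "s = sqrt (\<Sum>x\<in>E. p x * p x)"
    have nn: "0 \<le> (\<Sum>x\<in>E. p x * p x)" by (intro sum_nonneg) auto
    have s: "s > 0" "s * s = (\<Sum>x\<in>E. p x * p x)" using False nn by (auto simp: s_def)
    define q where "q = (\<lambda>x. p x / s)"
    have qo: "(\<Sum>x\<in>E. q x * g x) = 0" "(\<Sum>x\<in>E. g x * q x) = 0" if "g \<in> U" for g
      using orth[OF that] by (simp_all add: q_def mult.commute flip: sum_divide_distrib)
    have qq: "(\<Sum>x\<in>E. q x * q x) = 1"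
      using s False by (simp add: q_def flip: sum_divide_distrib)
    have qn: "q \<notin> U" using qo(1)[of q] qq by auto
    have "\<exists>a. \<forall>x\<in>E. b j x = (\<Sum>g\<in>insert q U. a g * g x)" if j: "j \<in> insert i B" for j
    proof (cases "j = i")
      case True
      have "b i x = (\<Sum>g\<in>insert q U. (a(q := s)) g * g x)" for x
      proof -
        have "(\<Sum>g\<in>U. (a(q := s)) g * g x) = (\<Sum>g\<in>U. a g * g x)" using qn by (intro sum.cong) auto
        then show ?thesis using U(1) qn s by (simp add: q_def p_def)
      qed
      then show ?thesis using True by blast
    next
      case False
      then obtain a' where a': "\<forall>x\<in>E. b j x = (\<Sum>g\<in>U. a' g * g x)" using U(4) j by blast
      have "(\<Sum>g\<in>U. (a'(q := 0)) g * g x) = (\<Sum>g\<in>U. a' g * g x)" for x using qn by (intro sum.cong) auto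
      then have "\<forall>x\<in>E. b j x = (\<Sum>g\<in>insert q U. (a'(q := 0)) g * g x)" using a' U(1) qn by simp
      then show ?thesis by blast
    qed
    moreover have "\<forall>g\<in>insert q U. \<forall>g'\<in>insert q U. (\<Sum>x\<in>E. g x * g' x) = (if g = g' then 1 else 0)"
      using U(3) qo qq qn by auto
    moreover have "card (insert q U) \<le> card (insert i B)" using U(1,2) qn insert by simp
    ultimately show ?thesis using U(1) by (intro exI[of _ "insert q U"]) auto
  qed
qed

text \<open>
  For the orthogonal projection onto the span of an orthonormal family \<open>U\<close>, the squared distance of the
  basis vector \<open>e\<close> to this span is \<open>1 - (\<Sum>g\<in>U. (g e)\<^sup>2)\<close>. Summed over \<open>e\<close> these numbers give
  \<open>card E - card U\<close>, and no point \<open>w e\<close> of the span is closer than the projection.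
\<close>

lemma card_le_dim_plus_distances:
  fixes B :: "('e \<Rightarrow>\<^sub>0 real) set"
  assumes E: "finite E" and B: "finite B" and w: "\<And>e. e \<in> E \<Longrightarrow> w e \<in> span B"
  shows "real (card E) \<le> real (card B) + (\<Sum>e\<in>E. \<Sum>x\<in>E. (lookup (unit e - w e) x)\<^sup>2)"
proof -
  obtain U where U: "finite U" "card U \<le> card B" "\<And>g g'. g \<in> U \<Longrightarrow> g' \<in> U \<Longrightarrow> (\<Sum>x\<in>E. g x * g' x) = (if g = g' then 1 else 0)"
    "\<And>v. v \<in> B \<Longrightarrow> \<exists>a. \<forall>x\<in>E. lookup v x = (\<Sum>g\<in>U. a g * g x)"
    using orthonormal_spanning[OF E B, of lookup] by blast
  have sp: "\<exists>a. \<forall>x\<in>E. lookup v x = (\<Sum>g\<in>U. a g * g x)" if "v \<in> span B" for v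
    using that
  proof (induction rule: real_vector.span_induct_alt)
    case base
    show ?case by (intro exI[of _ "\<lambda>_. 0"]) simp
  next
    case (step k v y)
    then obtain a a' where a: "\<forall>x\<in>E. lookup v x = (\<Sum>g\<in>U. a g * g x)" "\<forall>x\<in>E. lookup y x = (\<Sum>g\<in>U. a' g * g x)"
      using U(4) by blast
    have "\<forall>x\<in>E. lookup (k *\<^sub>R v + y) x = (\<Sum>g\<in>U. (k * a g + a' g) * g x)"
      using a by (simp add: lookup_add lookup_scaleR distrib_right sum.distrib sum_distrib_left mult.assoc)
    then show ?case by (intro exI[of _ "\<lambda>g. k * a g + a' g"])
  qed
  have one: "1 - (\<Sum>g\<in>U. (g e)\<^sup>2) \<le> (\<Sum>x\<in>E. (lookup (unit e - w e) x)\<^sup>2)" if e: "e \<in> E" for e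
  proof -
    obtain a where a: "\<And>x. x \<in> E \<Longrightarrow> lookup (w e) x = (\<Sum>g\<in>U. a g * g x)" using sp[OF w[OF e]] by blast
    have "(\<Sum>x\<in>E. (lookup (unit e - w e) x)\<^sup>2)
       = (\<Sum>x\<in>E. (of_bool (x = e) - (\<Sum>g\<in>U. a g * g x))\<^sup>2)"
      using a by (intro sum.cong) (auto simp: lookup_minus lookup_single when_def)
    also have "\<dots> = (\<Sum>x\<in>E. of_bool (x = e)) - 2 * (\<Sum>x\<in>E. of_bool (x = e) * (\<Sum>g\<in>U. a g * g x)) + (\<Sum>x\<in>E. (\<Sum>g\<in>U. a g * g x) * (\<Sum>g\<in>U. a g * g x))"
    proof -
      have "(of_bool P - t)\<^sup>2 = of_bool P - 2 * (of_bool P * t) + t * t" for P and t :: real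
        by (cases P) (simp_all add: power2_eq_square algebra_simps)
      then show ?thesis by (simp only: sum.distrib sum_subtractf sum_distrib_left[symmetric])
    qed
    also have "(\<Sum>x\<in>E. of_bool (x = e) :: real) = 1" using e E by simp
    also have "(\<Sum>x\<in>E. of_bool (x = e) * (\<Sum>g\<in>U. a g * g x)) = (\<Sum>g\<in>U. a g * g e)"
      using e E by (simp add: of_bool_def if_distrib[where f = "\<lambda>t. t * _"] cong: if_cong)
    also have "(\<Sum>x\<in>E. (\<Sum>g\<in>U. a g * g x) * (\<Sum>g\<in>U. a g * g x)) = (\<Sum>g\<in>U. \<Sum>g'\<in>U. a g * a g' * (\<Sum>x\<in>E. g x * g' x))"
    proof -
      have "(\<Sum>x\<in>E. (\<Sum>g\<in>U. a g * g x) * (\<Sum>g\<in>U. a g * g x)) = (\<Sum>x\<in>E. \<Sum>g\<in>U. \<Sum>g'\<in>U. a g * a g' * (g x * g' x))"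
        by (simp add: sum_product mult_ac)
      also have "\<dots> = (\<Sum>g\<in>U. \<Sum>x\<in>E. \<Sum>g'\<in>U. a g * a g' * (g x * g' x))" by (rule sum.swap)
      also have "\<dots> = (\<Sum>g\<in>U. \<Sum>g'\<in>U. \<Sum>x\<in>E. a g * a g' * (g x * g' x))" by (intro sum.cong refl sum.swap)
      finally show ?thesis by (simp add: sum_distrib_left)
    qed
    also have "\<dots> = (\<Sum>g\<in>U. \<Sum>g'\<in>U. if g' = g then (a g)\<^sup>2 else 0)"
      by (intro sum.cong) (auto simp: U(3) power2_eq_square)
    also have "\<dots> = (\<Sum>g\<in>U. (a g)\<^sup>2)" using U(1) by simp
    also have "1 - 2 * (\<Sum>g\<in>U. a g * g e) + (\<Sum>g\<in>U. (a g)\<^sup>2) = 1 - (\<Sum>g\<in>U. (g e)\<^sup>2) + (\<Sum>g\<in>U. (a g - g e)\<^sup>2)"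
      by (simp add: power2_diff sum.distrib sum_subtractf sum_distrib_left mult.assoc)
    finally show ?thesis using sum_nonneg[of U "\<lambda>g. (a g - g e)\<^sup>2"] by simp
  qed
  have "real (card E) - real (card U) = real (card E) - (\<Sum>g\<in>U. \<Sum>e\<in>E. (g e)\<^sup>2)"
    using U(3) by (simp add: power2_eq_square)
  also have "\<dots> = (\<Sum>e\<in>E. 1 - (\<Sum>g\<in>U. (g e)\<^sup>2))"
    by (simp add: sum_subtractf) (rule sum.swap)
  also have "\<dots> \<le> (\<Sum>e\<in>E. \<Sum>x\<in>E. (lookup (unit e - w e) x)\<^sup>2)" by (intro sum_mono one)
  finally show ?thesis using U(2) by linarith
qed

text \<open>
  The rank of the boundary operator is at least the number of cells minus the sum of the squared distances of
  the cells to the image.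
\<close>

lemma dim_cycles_le:
  assumes X: "finite X" and E: "finite E" and w: "\<And>e. e \<in> E \<Longrightarrow> w e \<in> span (boundary_face ` X)"
  shows "real (dim (cycles X)) \<le> real (card X) - real (card E) + (\<Sum>e\<in>E. \<Sum>x\<in>E. (lookup (unit e - w e) x)\<^sup>2)"
proof -
  obtain B where B: "B \<subseteq> X" "card B + dim (cycles X) = card X" "boundary_face ` X \<subseteq> span (boundary_face ` B)"
    "card (boundary_face ` B) = card B" "independent (boundary_face ` B :: ('a set \<Rightarrow>\<^sub>0 real) set)"
    by (rule kernel_complement[OF X])
  have fB: "finite (boundary_face ` B)" using B(1) X finite_subset by blast
  have "span (boundary_face ` X) \<subseteq> span (boundary_face ` B)"
    by (rule real_vector.span_minimal[OF B(3) real_vector.subspace_span])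
  then have "real (card E) \<le> real (card (boundary_face ` B)) + (\<Sum>e\<in>E. \<Sum>x\<in>E. (lookup (unit e - w e) x)\<^sup>2)"
    using w by (intro card_le_dim_plus_distances[OF E fB]) blast
  moreover have "real (card B) + real (dim (cycles X)) = real (card X)" using B(2) by (metis of_nat_add)
  ultimately show ?thesis unfolding B(4) by linarith
qed

section \<open>Local test chains\<close>

text \<open>
  The squared distance of \<open>e\<close> to the boundaries in its \<open>r\<close>-neighbourhood when this neighbourhood is a tree.
\<close>

abbreviation mass :: "nat \<Rightarrow> 'a::linorder set \<Rightarrow> 'a set set \<Rightarrow> real" where
  "mass \<equiv> local_val (\<lambda>xss. eff (map sum_list xss)) 1"

lemma sum_list_sorted: "finite A \<Longrightarrow> sum_list (map f (sorted_list_of_set A)) = sum f A"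
  by (simp add: sum_list_distinct_conv_sum_set)

lemma mass_Suc:
  assumes "finite e" "finite (link e X)"
  shows "mass (Suc r) e X = 1 / (1 + (\<Sum>v\<in>link e X. 1 / (\<Sum>u\<in>e. mass r (flip e v u) (del e X))))"
  using assms by (simp add: local_val_Suc children_def comp_def eff_def sum_list_sorted inverse_eq_divide)

lemma mass_bounds:
  assumes "finite e" "e \<noteq> {}"
  shows "0 < mass r e X \<and> mass r e X \<le> 1"
  using assms
proof (induction r arbitrary: e X)
  case (Suc r)
  have pos: "0 < sum_list zs" if zs: "zs \<in> set (map (map (\<lambda>g. mass r g (del e X))) (children e (link e X)))" for zs
  proof -
    obtain v where v: "v \<in> link e X" "zs = map (\<lambda>u. mass r (flip e v u) (del e X)) (sorted_list_of_set e)"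
      using zs by (cases "finite (link e X)") (auto simp: children_def)
    have "0 < mass r (flip e v u) (del e X)" if u: "u \<in> e" for u
    proof -
      have "v \<notin> e" using v by (simp add: link_def)
      then have "card (flip e v u) = card e" "finite (flip e v u)" using flip_card[OF Suc.prems(1) _ u] by auto
      moreover have "card e \<noteq> 0" using Suc.prems by simp
      ultimately have "finite (flip e v u)" "flip e v u \<noteq> {}" by (auto simp del: card_0_eq)
      then show ?thesis using Suc.IH by blast
    qed
    then show ?thesis using v Suc.prems by (simp add: sum_list_sorted sum_pos)
  qed
  show ?case
    unfolding local_val_Suc using pos by (intro conjI eff_bounds) auto
qed simp

lemma not_reached_if_isolated:
  assumes "\<And>\<sigma>. \<sigma> \<in> X \<Longrightarrow> \<not> e' \<subseteq> \<sigma>" "e \<noteq> e'"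
  shows "e' \<notin> reach r e X"
  using assms
proof (induction r arbitrary: e X)
  case (Suc r)
  have "e' \<notin> reach r (flip e v u) (del e X)" if "v \<in> link e X" "u \<in> e" for v u
  proof (rule Suc.IH)
    show "\<not> e' \<subseteq> \<sigma>" if "\<sigma> \<in> del e X" for \<sigma>
      using Suc.prems that by (auto simp: del_def)
    have "insert v e \<in> X" using that by (simp add: link_def)
    then show "flip e v u \<noteq> e'" using Suc.prems by (auto simp: flip_def)
  qed
  then show ?case using Suc.prems by auto
qed simp

lemma boundary_insert:
  assumes "finite e" "v \<notin> e"
  shows "\<exists>s t. s * s = (1::real) \<and> (\<forall>u. t u * t u = 1) \<and>
    boundary_face (insert v e) = s *\<^sub>R unit e + (\<Sum>u\<in>e. t u *\<^sub>R unit (flip e v u))"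
proof -
  let ?t = "\<lambda>u. (- 1) ^ card {w \<in> insert v e. w < u} :: real"
  have "?t u * ?t u = 1" for u by (simp flip: power_add mult_2)
  moreover have "boundary_face (insert v e) = ?t v *\<^sub>R unit e + (\<Sum>u\<in>e. ?t u *\<^sub>R unit (flip e v u))"
    unfolding boundary_face_def single_scaleR[of _ "_ ^ _"] using assms by (simp add: flip_def)
  ultimately show ?thesis by (intro exI[of _ "?t v"] exI[of _ ?t]) simp
qed

lemma power2_sum_disjoint:
  fixes f :: "'i \<Rightarrow> real"
  assumes "finite I" and "\<And>i j. i \<in> I \<Longrightarrow> j \<in> I \<Longrightarrow> i \<noteq> j \<Longrightarrow> f i = 0 \<or> f j = 0"
  shows "(\<Sum>i\<in>I. f i)\<^sup>2 = (\<Sum>i\<in>I. (f i)\<^sup>2)"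
proof (cases "\<exists>i\<in>I. f i \<noteq> 0")
  case True
  then obtain i where i: "i \<in> I" "f i \<noteq> 0" by blast
  have "f j = 0" if "j \<in> I - {i}" for j using assms(2)[OF i(1), of j] i that by auto
  then have "(\<Sum>j\<in>I - {i}. f j) = 0" "(\<Sum>j\<in>I - {i}. (f j)\<^sup>2) = 0" by (auto intro!: sum.neutral)
  then show ?thesis using sum.remove[OF assms(1) i(1), of f] sum.remove[OF assms(1) i(1), of "\<lambda>i. (f i)\<^sup>2"] by simp
qed auto

text \<open>
  Suppose that each child \<open>flip e v u\<close> is approximated by a boundary up to a residual \<open>\<rho>\<close> of squared norm at most
  its mass. The boundary of \<open>insert v e\<close> minus these approximations is \<open>\<plusminus>e\<close> plus the residuals below \<open>v\<close>, of
  total squared norm at most \<open>S v\<close>. Subtracting from \<open>e\<close> the combination of these chains with weights \<open>y v\<close> leaves squared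
  norm \<open>(1 - (\<Sum>v. y v))\<^sup>2 + (\<Sum>v. (y v)\<^sup>2 * S v)\<close>, because residuals of different branches have
  disjoint supports. The minimising weights are proportional to \<open>1 / S v\<close> and give the mass of \<open>e\<close>.
\<close>

lemma local_test_chain:
  assumes d: "d \<ge> 1" and "\<not> tangled r e X" "e \<in> cells n d" "X \<subseteq> cells n (Suc d)"
  shows "\<exists>w\<in>span (boundary_face ` X). (\<forall>x. lookup (unit e - w) x \<noteq> 0 \<longrightarrow> x \<in> reach r e X) \<and>
    (\<Sum>x\<in>cells n d. (lookup (unit e - w) x)\<^sup>2) \<le> mass r e X"
  using assms(2-4)
proof (induction r arbitrary: e X)
  case 0
  have "(\<Sum>x\<in>cells n d. (lookup (unit e) x)\<^sup>2) = 1" by (rule sum_squares_unit[OF finite_cells 0(2)])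
  then show ?case using 0 by (intro bexI[of _ 0]) (auto simp: real_vector.span_zero lookup_single when_def split: if_splits)
next
  case (Suc r)
  note e = Suc.prems(2) and X = Suc.prems(3)
  let ?L = "link e X" and ?Z = "del e X" and ?h = "mass (Suc r) e X"
  have fe: "finite e" by (rule cells_finite[OF e])
  have ne: "e \<noteq> {}" by (rule cells_nonempty[OF e d])
  have fL: "finite ?L" by (rule finite_link[OF X])
  have ZX: "?Z \<subseteq> X" by (rule del_subset)
  have vn: "v \<notin> e" "v < n" if "v \<in> ?L" for v using that link_less[OF X] by (auto simp: link_def)
  have c: "flip e v u \<in> cells n d" if "v \<in> ?L" "u \<in> e" for v u
    using vn[OF that(1)] that(2) by (intro flip_cells[OF e])
  have "\<forall>v\<in>?L. \<forall>u\<in>e. \<exists>w. w \<in> span (boundary_face ` ?Z) \<and>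
      (\<forall>x. lookup (unit (flip e v u) - w) x \<noteq> 0 \<longrightarrow> x \<in> reach r (flip e v u) ?Z) \<and>
      (\<Sum>x\<in>cells n d. (lookup (unit (flip e v u) - w) x)\<^sup>2) \<le> mass r (flip e v u) ?Z"
  proof (intro ballI)
    fix v u assume v: "v \<in> ?L" and u: "u \<in> e"
    have "\<not> tangled r (flip e v u) ?Z" using Suc.prems(1) v u by auto
    from Suc.IH[OF this c[OF v u] order_trans[OF ZX X]]
    show "\<exists>w. w \<in> span (boundary_face ` ?Z) \<and>
      (\<forall>x. lookup (unit (flip e v u) - w) x \<noteq> 0 \<longrightarrow> x \<in> reach r (flip e v u) ?Z) \<and>
      (\<Sum>x\<in>cells n d. (lookup (unit (flip e v u) - w) x)\<^sup>2) \<le> mass r (flip e v u) ?Z" by blast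
  qed
  then obtain W where W: "\<And>v u. v \<in> ?L \<Longrightarrow> u \<in> e \<Longrightarrow> W v u \<in> span (boundary_face ` ?Z)"
      "\<And>v u x. v \<in> ?L \<Longrightarrow> u \<in> e \<Longrightarrow> lookup (unit (flip e v u) - W v u) x \<noteq> 0 \<Longrightarrow> x \<in> reach r (flip e v u) ?Z"
      "\<And>v u. v \<in> ?L \<Longrightarrow> u \<in> e \<Longrightarrow> (\<Sum>x\<in>cells n d. (lookup (unit (flip e v u) - W v u) x)\<^sup>2) \<le> mass r (flip e v u) ?Z"
    by metis
  have "\<forall>v\<in>?L. \<exists>s t. s * s = (1::real) \<and> (\<forall>u. t u * t u = 1) \<and>
      boundary_face (insert v e) = s *\<^sub>R unit e + (\<Sum>u\<in>e. t u *\<^sub>R unit (flip e v u))"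
    using boundary_insert[OF fe] vn by blast
  from bchoice[OF this] obtain s where "\<forall>v\<in>?L. \<exists>t. s v * s v = (1::real) \<and> (\<forall>u. t u * t u = 1) \<and>
      boundary_face (insert v e) = s v *\<^sub>R unit e + (\<Sum>u\<in>e. t u *\<^sub>R unit (flip e v u))" ..
  from bchoice[OF this] obtain t where T: "\<forall>v\<in>?L. s v * s v = (1::real) \<and> (\<forall>u. t v u * t v u = 1) \<and>
      boundary_face (insert v e) = s v *\<^sub>R unit e + (\<Sum>u\<in>e. t v u *\<^sub>R unit (flip e v u))" ..
  have st: "s v * s v = (1::real)" "t v u * t v u = (1::real)"
      "boundary_face (insert v e) = s v *\<^sub>R unit e + (\<Sum>u\<in>e. t v u *\<^sub>R unit (flip e v u))" if "v \<in> ?L" for v u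
    using bspec[OF T that] by simp_all
  define \<rho> where "\<rho> = (\<lambda>i. unit (flip e (fst i) (snd i)) - W (fst i) (snd i))"
  let ?I = "?L \<times> e"
  have fI: "finite ?I" using fL fe by simp
  define S where "S = (\<lambda>v. \<Sum>u\<in>e. mass r (flip e v u) ?Z)"
  have Spos: "0 < S v" if "v \<in> ?L" for v
    unfolding S_def
  proof (intro sum_pos fe ne)
    fix u assume "u \<in> e"
    then show "0 < mass r (flip e v u) ?Z"
      using mass_bounds[OF cells_finite[OF c] cells_nonempty[OF c d]] that by blast
  qed
  define H where "H = (\<Sum>v\<in>?L. 1 / S v)"
  have Hnn: "0 \<le> H" unfolding H_def using Spos by (intro sum_nonneg) (simp add: less_imp_le)
  have h: "?h = 1 / (1 + H)" unfolding mass_Suc[OF fe fL] H_def S_def ..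
  \<comment> \<open>The weights that minimise the squared norm.\<close>
  define y where "y = (\<lambda>v. ?h / S v)"
  have sumy: "1 - (\<Sum>v\<in>?L. y v) = ?h"
  proof -
    have "(\<Sum>v\<in>?L. y v) = ?h * H" by (simp add: y_def H_def sum_distrib_left)
    then show ?thesis using Hnn unfolding h by (simp add: field_simps)
  qed
  define k where "k = (\<lambda>i. y (fst i) * s (fst i) * t (fst i) (snd i))"
  have k2: "(k i)\<^sup>2 = (y (fst i))\<^sup>2" if "i \<in> ?I" for i
  proof -
    have "(k i)\<^sup>2 = (y (fst i))\<^sup>2 * (s (fst i) * s (fst i)) * (t (fst i) (snd i) * t (fst i) (snd i))"
      by (simp add: k_def power2_eq_square)
    then show ?thesis using st(1)[of "fst i"] st(2)[of "fst i" "snd i"] that by auto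
  qed
  define w where "w = (\<Sum>v\<in>?L. (y v * s v) *\<^sub>R (boundary_face (insert v e) - (\<Sum>u\<in>e. t v u *\<^sub>R W v u)))"
  have wspan: "w \<in> span (boundary_face ` X)"
    unfolding w_def
  proof (intro real_vector.span_sum real_vector.span_scale real_vector.span_diff)
    show "boundary_face (insert v e) \<in> span (boundary_face ` X)" if "v \<in> ?L" for v
      using that by (intro real_vector.span_base imageI) (simp add: link_def)
    show "W v u \<in> span (boundary_face ` X)" if "v \<in> ?L" "u \<in> e" for v u
      using W(1)[OF that] real_vector.span_mono[OF image_mono[OF ZX], of boundary_face] by blast
  qed
  have res: "unit e - w = ?h *\<^sub>R unit e - (\<Sum>i\<in>?I. k i *\<^sub>R \<rho> i)"
  proof -
    have "w = (\<Sum>v\<in>?L. y v *\<^sub>R unit e + (\<Sum>u\<in>e. k (v, u) *\<^sub>R \<rho> (v, u)))"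
      unfolding w_def
    proof (rule sum.cong[OF refl])
      fix v assume v: "v \<in> ?L"
      have "boundary_face (insert v e) - (\<Sum>u\<in>e. t v u *\<^sub>R W v u) = s v *\<^sub>R unit e + (\<Sum>u\<in>e. t v u *\<^sub>R \<rho> (v, u))"
        unfolding st(3)[OF v] \<rho>_def by (simp add: scaleR_diff_right sum_subtractf)
      then show "(y v * s v) *\<^sub>R (boundary_face (insert v e) - (\<Sum>u\<in>e. t v u *\<^sub>R W v u))
          = y v *\<^sub>R unit e + (\<Sum>u\<in>e. k (v, u) *\<^sub>R \<rho> (v, u))"
        using st(1)[OF v] by (simp add: scaleR_add_right scaleR_sum_right k_def mult.assoc)
    qed
    also have "\<dots> = (\<Sum>v\<in>?L. y v) *\<^sub>R unit e + (\<Sum>i\<in>?I. k i *\<^sub>R \<rho> i)"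
      by (simp add: sum.distrib scaleR_sum_left sum.cartesian_product)
    finally show ?thesis unfolding sumy[symmetric] by (simp add: scaleR_diff_left)
  qed
  have \<rho>supp: "x \<in> reach r (flip e (fst i) (snd i)) ?Z" if "i \<in> ?I" "lookup (\<rho> i) x \<noteq> 0" for i x
    using W(2)[of "fst i" "snd i" x] that by (auto simp: \<rho>_def)
  have \<rho>e: "lookup (\<rho> i) e = 0" if "i \<in> ?I" for i
  proof (rule ccontr)
    assume "lookup (\<rho> i) e \<noteq> 0"
    then have "e \<in> reach r (flip e (fst i) (snd i)) ?Z" using \<rho>supp[OF that] by simp
    moreover have "flip e (fst i) (snd i) \<noteq> e" using that vn by (intro flip_neq) auto
    ultimately show False using not_reached_if_isolated[of ?Z e] by (auto simp: del_def)
  qed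
  have disj: "lookup (\<rho> i) x = 0 \<or> lookup (\<rho> j) x = 0" if "i \<in> ?I" "j \<in> ?I" "i \<noteq> j" for i j x
  proof (rule ccontr)
    assume "\<not> ?thesis"
    then have "x \<in> reach r (flip e (fst i) (snd i)) ?Z \<inter> reach r (flip e (fst j) (snd j)) ?Z"
      using \<rho>supp[OF that(1), of x] \<rho>supp[OF that(2), of x] by blast
    moreover obtain v u v' u' where ij: "i = (v, u)" "j = (v', u')" by (cases i, cases j)
    ultimately have "reach r (flip e v u) ?Z \<inter> reach r (flip e v' u') ?Z \<noteq> {}" by auto
    moreover have "v \<in> ?L" "u \<in> e" "v' \<in> ?L" "u' \<in> e" "(v, u) \<noteq> (v', u')" using that by (simp_all add: ij)
    ultimately have "\<exists>v\<in>?L. \<exists>u\<in>e. \<exists>v'\<in>?L. \<exists>u'\<in>e. (v, u) \<noteq> (v', u') \<and> reach r (flip e v u) ?Z \<inter> reach r (flip e v' u') ?Z \<noteq> {}"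
      by blast
    then show False using Suc.prems(1) by simp
  qed
  have lk: "lookup (unit e - w) x = ?h * of_bool (x = e) - (\<Sum>i\<in>?I. k i * lookup (\<rho> i) x)" for x
    unfolding res by (simp add: lookup_minus lookup_scaleR lookup_sum lookup_single when_def)
  have sq: "(lookup (unit e - w) x)\<^sup>2 = ?h\<^sup>2 * of_bool (x = e) + (\<Sum>i\<in>?I. (y (fst i))\<^sup>2 * (lookup (\<rho> i) x)\<^sup>2)" for x
  proof (cases "x = e")
    case True
    then show ?thesis using \<rho>e unfolding lk by simp
  next
    case False
    have "(\<Sum>i\<in>?I. k i * lookup (\<rho> i) x)\<^sup>2 = (\<Sum>i\<in>?I. (k i * lookup (\<rho> i) x)\<^sup>2)"
    proof (rule power2_sum_disjoint[OF fI])
      show "k i * lookup (\<rho> i) x = 0 \<or> k j * lookup (\<rho> j) x = 0" if "i \<in> ?I" "j \<in> ?I" "i \<noteq> j" for i j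
        using disj[OF that, of x] by auto
    qed
    also have "\<dots> = (\<Sum>i\<in>?I. (y (fst i))\<^sup>2 * (lookup (\<rho> i) x)\<^sup>2)"
      by (intro sum.cong refl) (simp only: power_mult_distrib k2)
    finally show ?thesis unfolding lk using False by simp
  qed
  have "(\<Sum>x\<in>cells n d. (lookup (unit e - w) x)\<^sup>2)
      = ?h\<^sup>2 + (\<Sum>i\<in>?I. (y (fst i))\<^sup>2 * (\<Sum>x\<in>cells n d. (lookup (\<rho> i) x)\<^sup>2))"
  proof -
    have "(\<Sum>x\<in>cells n d. ?h\<^sup>2 * of_bool (x = e)) = ?h\<^sup>2" using e by (simp flip: sum_distrib_left)
    moreover have "(\<Sum>x\<in>cells n d. \<Sum>i\<in>?I. (y (fst i))\<^sup>2 * (lookup (\<rho> i) x)\<^sup>2)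
       = (\<Sum>i\<in>?I. (y (fst i))\<^sup>2 * (\<Sum>x\<in>cells n d. (lookup (\<rho> i) x)\<^sup>2))"
      unfolding sum_distrib_left by (rule sum.swap)
    ultimately show ?thesis unfolding sq sum.distrib by simp
  qed
  also have "\<dots> \<le> ?h\<^sup>2 + (\<Sum>i\<in>?I. (y (fst i))\<^sup>2 * mass r (flip e (fst i) (snd i)) ?Z)"
    using W(3) by (intro add_left_mono sum_mono mult_left_mono) (auto simp: \<rho>_def)
  also have "(\<Sum>i\<in>?I. (y (fst i))\<^sup>2 * mass r (flip e (fst i) (snd i)) ?Z) = (\<Sum>v\<in>?L. (y v)\<^sup>2 * S v)"
    unfolding S_def sum_distrib_left sum.cartesian_product by (simp add: case_prod_unfold)
  also have "\<dots> = (\<Sum>v\<in>?L. ?h\<^sup>2 * (1 / S v))"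
    using Spos by (intro sum.cong refl) (force simp: y_def power2_eq_square)
  also have "?h\<^sup>2 + \<dots> = ?h\<^sup>2 * (1 + H)" by (simp only: H_def distrib_left sum_distrib_left mult_1_right)
  also have "\<dots> = ?h" using Hnn unfolding h by (simp add: power2_eq_square)
  finally have norm: "(\<Sum>x\<in>cells n d. (lookup (unit e - w) x)\<^sup>2) \<le> ?h" .
  have supp: "x \<in> reach (Suc r) e X" if x: "lookup (unit e - w) x \<noteq> 0" for x
  proof (cases "x = e")
    case False
    then have "(\<Sum>i\<in>?I. k i * lookup (\<rho> i) x) \<noteq> 0" using x unfolding lk by simp
    then obtain i where i: "i \<in> ?I" "k i * lookup (\<rho> i) x \<noteq> 0" by (meson sum.neutral)
    then have "x \<in> reach r (flip e (fst i) (snd i)) ?Z" using \<rho>supp by auto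
    then show ?thesis using i by auto
  qed (simp add: reach_self del: reach.simps)
  show ?case using wspan norm supp by blast
qed

section \<open>The expected dimension\<close>

lemma EF_card:
  assumes "0 \<le> c" "c \<le> real n"
  shows "EF d c n (\<lambda>X. real (card X)) = c / real n * real (n choose Suc d)"
  unfolding random_faces_def using assms
  by (subst expectation_card_random_subset) (auto simp: card_cells divide_le_eq_1)

lemma expected_faces:
  assumes c: "0 < c" and n: "d \<le> n" "0 < n"
  shows "c / real n * real (n choose Suc d) = real (n choose d) * (c / (real d + 1) * (1 - real d / real n))"
proof -
  have "real (n choose Suc d) = real (n choose d) * (real n - real d) / (real d + 1)"
    using choose_Suc_real[OF n(1)] by (simp add: eq_divide_eq add_nonneg_eq_0_iff)
  then have "c / real n * real (n choose Suc d) = c / real n * (real (n choose d) * (real n - real d) / (real d + 1))" by (simp only:)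
  also have "\<dots> = real (n choose d) * (c / (real d + 1) * ((real n - real d) / real n))" by (simp add: mult_ac)
  also have "(real n - real d) / real n = 1 - real d / real n" using n by (simp add: diff_divide_distrib)
  finally show ?thesis .
qed

text \<open>
  The bound \<open>dim_cycles_le\<close> with test chains from \<open>local_test_chain\<close>; at the few tangled cells the test chain
  is \<open>0\<close>, at squared distance \<open>1\<close>. The mean mass at a cell converges to the one on the Poisson tree, whose
  limit in the depth is bounded by the maximum of the potential.
\<close>

lemma expected_dim_upper:
  assumes d: "d \<ge> 2" and c: "c > c_star d" and eps: "\<epsilon> > 0"
  shows "\<exists>n0. \<forall>n\<ge>n0. EF d c n (\<lambda>X. real (dim (cycles X))) \<le> real (n choose d) * (excess d c (t_root d c) + \<epsilon>)"
proof -
  have c0: "0 < c" using c_star_pos[OF d] c by simp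
  have d1: "d \<ge> 1" using d by simp
  obtain m x where m: "(\<lambda>r. expect (mass_law c d r) (\<lambda>h. h)) \<longlonglongrightarrow> m" "0 \<le> x" "x \<le> 1" "m \<le> potential d c x"
    using mean_mass_limit[OF c0 d1] by blast
  have mle: "m \<le> 1 - c / (real d + 1) + excess d c (t_root d c)" using m(4) potential_le[OF d c m(2,3)] by linarith
  define \<delta> where "\<delta> = \<epsilon> / 3"
  have \<delta>: "\<delta> > 0" using eps by (simp add: \<delta>_def)
  have "\<forall>\<^sub>F r in sequentially. expect (mass_law c d r) (\<lambda>h. h) < m + \<delta>"
    using m(1) \<delta> by (intro order_tendstoD(2)) auto
  then obtain r where r: "expect (mass_law c d r) (\<lambda>h. h) < m + \<delta>" by (auto simp: eventually_sequentially)
  obtain n1 where n1: "\<And>n e f. n \<ge> n1 \<Longrightarrow> e \<in> cells n d \<Longrightarrow> (\<And>x. 0 \<le> (f x :: real) \<and> f x \<le> 1) \<Longrightarrow>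
     \<bar>EF d c n (\<lambda>X. f (mass r e X)) - expect (mass_law c d r) f\<bar> \<le> \<delta>"
    using local_limit_single[OF c0 \<delta>, of d "\<lambda>xss. eff (map sum_list xss)" 1 r] unfolding mass_law_def by blast
  obtain C where C: "C \<ge> 0" "\<And>n e. 0 < n \<Longrightarrow> c \<le> real n \<Longrightarrow> e \<in> cells n d \<Longrightarrow>
      PF d c n (\<lambda>X. tangled r e X) \<le> C / real n" using tangled_prob[of c d r] c0 by auto
  define n0 where "n0 = n1 + d + nat \<lceil>c\<rceil> + nat \<lceil>C / \<delta>\<rceil> + 1"
  have "EF d c n (\<lambda>X. real (dim (cycles X))) \<le> real (n choose d) * (excess d c (t_root d c) + \<epsilon>)" if n: "n \<ge> n0" for n
  proof -
    have nb: "n > 0" "c \<le> real n" "n \<ge> n1" "C / \<delta> \<le> real n" "d \<le> n" using n unfolding n0_def by linarith+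
    have Cn: "C / real n \<le> \<delta>" using nb \<delta> by (simp add: field_simps)
    let ?E = "cells n d"
    have mb: "0 < mass r e X \<and> mass r e X \<le> 1" if "e \<in> ?E" for e X
      by (rule mass_bounds[OF cells_finite[OF that] cells_nonempty[OF that d1]])
    have pw: "real (dim (cycles X)) \<le> real (card X) - real (card ?E) + (\<Sum>e\<in>?E. mass r e X + of_bool (tangled r e X))"
      if X: "X \<subseteq> cells n (Suc d)" for X
    proof -
      have "\<forall>e\<in>?E. \<exists>w. w \<in> span (boundary_face ` X) \<and> (\<Sum>x\<in>?E. (lookup (unit e - w) x)\<^sup>2) \<le> mass r e X + of_bool (tangled r e X)"
      proof
        fix e assume e: "e \<in> ?E"
        show "\<exists>w. w \<in> span (boundary_face ` X) \<and> (\<Sum>x\<in>?E. (lookup (unit e - w) x)\<^sup>2) \<le> mass r e X + of_bool (tangled r e X)"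
        proof (cases "tangled r e X")
          case False
          then show ?thesis using local_test_chain[OF d1 False e X] by auto
        next
          case True
          have "(\<Sum>x\<in>?E. (lookup (unit e) x)\<^sup>2) = 1" by (rule sum_squares_unit[OF finite_cells e])
          then show ?thesis using True mb[OF e, of X] by (intro exI[of _ 0]) (simp add: real_vector.span_zero)
        qed
      qed
      then obtain w where w: "\<And>e. e \<in> ?E \<Longrightarrow> w e \<in> span (boundary_face ` X)"
        "\<And>e. e \<in> ?E \<Longrightarrow> (\<Sum>x\<in>?E. (lookup (unit e - w e) x)\<^sup>2) \<le> mass r e X + of_bool (tangled r e X)" by metis
      have "real (dim (cycles X)) \<le> real (card X) - real (card ?E) + (\<Sum>e\<in>?E. \<Sum>x\<in>?E. (lookup (unit e - w e) x)\<^sup>2)"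
        by (rule dim_cycles_le[OF finite_subset[OF X finite_cells] finite_cells w(1)])
      also have "\<dots> \<le> real (card X) - real (card ?E) + (\<Sum>e\<in>?E. mass r e X + of_bool (tangled r e X))"
        using w(2) by (intro add_left_mono sum_mono)
      finally show ?thesis .
    qed
    have em: "EF d c n (\<lambda>X. mass r e X + of_bool (tangled r e X)) \<le> m + 3 * \<delta>" if e: "e \<in> ?E" for e
    proof -
      \<comment> \<open>Masses lie in \<open>(0, 1]\<close>, so truncation to \<open>[0, 1]\<close> gives a bounded test function without changing the value.\<close>
      let ?f = "\<lambda>h::real. max 0 (min 1 h)"
      have "\<bar>EF d c n (\<lambda>X. ?f (mass r e X)) - expect (mass_law c d r) ?f\<bar> \<le> \<delta>"
        by (rule n1[OF nb(3) e]) auto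
      moreover have "EF d c n (\<lambda>X. ?f (mass r e X)) = EF d c n (\<lambda>X. mass r e X)"
        using mb[OF e] by (intro expectation_cong) simp
      moreover have "expect (mass_law c d r) ?f = expect (mass_law c d r) (\<lambda>h. h)"
        using set_mass_law[OF d1, of c r] by (intro expectation_cong) (fastforce simp: max_def min_def)
      ultimately have "EF d c n (\<lambda>X. mass r e X) \<le> m + 2 * \<delta>" using r by linarith
      moreover have "PF d c n (\<lambda>X. tangled r e X) \<le> \<delta>" using C(2)[OF nb(1,2) e] Cn by linarith
      ultimately show ?thesis unfolding EF_add by linarith
    qed
    have "EF d c n (\<lambda>X. real (dim (cycles X))) \<le> EF d c n (\<lambda>X. (real (card X) - real (card ?E)) + (\<Sum>e\<in>?E. mass r e X + of_bool (tangled r e X)))"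
      by (rule EF_mono) (rule pw)
    also have "\<dots> = (EF d c n (\<lambda>X. real (card X)) - real (card ?E)) + (\<Sum>e\<in>?E. EF d c n (\<lambda>X. mass r e X + of_bool (tangled r e X)))"
      unfolding EF_add[of d c n "\<lambda>X. real (card X) - real (card ?E)"] EF_sum EF_diff by simp
    also have "\<dots> \<le> (EF d c n (\<lambda>X. real (card X)) - real (card ?E)) + (\<Sum>e\<in>?E. m + 3 * \<delta>)"
      by (intro add_left_mono sum_mono em)
    also have "\<dots> = real (n choose d) * (c / (real d + 1) * (1 - real d / real n)) - real (n choose d) + real (n choose d) * (m + 3 * \<delta>)"
      using EF_card[of c n d] expected_faces[OF c0 nb(5,1)] c0 nb by (simp add: card_cells)
    also have "\<dots> = real (n choose d) * (c / (real d + 1) * (1 - real d / real n) - 1 + (m + 3 * \<delta>))"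
      by (simp add: algebra_simps)
    also have "\<dots> \<le> real (n choose d) * (excess d c (t_root d c) + \<epsilon>)"
    proof (intro mult_left_mono)
      have "c / (real d + 1) * (1 - real d / real n) \<le> c / (real d + 1) * 1" using c0 by (intro mult_left_mono) auto
      then show "c / (real d + 1) * (1 - real d / real n) - 1 + (m + 3 * \<delta>) \<le> excess d c (t_root d c) + \<epsilon>"
        using mle unfolding \<delta>_def by linarith
    qed simp
    finally show ?thesis .
  qed
  then show ?thesis by blast
qed

text \<open>
  The dimension is at least the number of faces of the core minus the number of its \<open>(d - 1)\<close>-cells.
  Their expectations are known for each number \<open>r\<close> of rounds, and the difference converges to the
  excess as \<open>r\<close> grows.
\<close>

lemma expected_dim_lower:
  assumes d: "d \<ge> 1" and c: "0 < c" and eps: "\<epsilon> > 0"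
  shows "\<exists>n0. \<forall>n\<ge>n0. real (n choose d) * (excess d c (t_root d c) - \<epsilon>) \<le> EF d c n (\<lambda>X. real (dim (cycles X)))"
proof -
  let ?t = "t_root d c" and ?\<kappa> = "c / (real d + 1)"
  let ?a = "\<lambda>r. (1 - collapse_prob d c (Suc r)) ^ Suc d"
  let ?b = "\<lambda>r. 1 - collapse_prob d c (Suc r) - c * (1 - collapse_prob d c r) ^ d * collapse_prob d c (Suc r)"
  have \<kappa>: "0 < ?\<kappa>" using c by (simp add: add_nonneg_pos)
  \<comment> \<open>Three errors \<open>\<delta>\<close> and one error \<open>\<kappa> * \<delta>\<close> add up to \<open>\<epsilon>\<close>.\<close>
  define \<delta> where "\<delta> = \<epsilon> / (?\<kappa> + 3)"
  have \<delta>: "\<delta> > 0" using eps \<kappa> by (simp add: \<delta>_def)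
  have T: "collapse_prob d c \<longlonglongrightarrow> ?t" "(\<lambda>r. collapse_prob d c (Suc r)) \<longlonglongrightarrow> ?t"
    using collapse_prob_tendsto[OF d c] LIMSEQ_Suc by blast+
  have "(\<lambda>r. ?\<kappa> * ?a r - ?b r) \<longlonglongrightarrow> ?\<kappa> * (1 - ?t) ^ Suc d - (1 - ?t - c * (1 - ?t) ^ d * ?t)"
    by (intro tendsto_intros T)
  also have "?\<kappa> * (1 - ?t) ^ Suc d - (1 - ?t - c * (1 - ?t) ^ d * ?t) = excess d c ?t"
    by (simp add: excess_def mult_ac)
  finally have "\<forall>\<^sub>F r in sequentially. excess d c ?t - \<delta> < ?\<kappa> * ?a r - ?b r"
    using \<delta> by (intro order_tendstoD(1)) auto
  then obtain r where r: "excess d c ?t - \<delta> < ?\<kappa> * ?a r - ?b r" by (auto simp: eventually_sequentially)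
  obtain n1 where n1: "\<And>n. n \<ge> n1 \<Longrightarrow> EF d c n (\<lambda>X. real (card (core_faces n d r X))) \<le> real (n choose d) * (?b r + \<delta>)"
    using expected_core_faces_le[OF c \<delta>, of d r] by blast
  obtain n2 where n2: "\<And>n. n \<ge> n2 \<Longrightarrow> real (n choose Suc d) * (c / real n) * (?a r - \<delta>)
      \<le> EF d c n (\<lambda>X. real (card {\<sigma> \<in> X. facets \<sigma> \<subseteq> core_faces n d r X}))"
    using expected_core_cells_ge[OF c \<delta>, of d r] by blast
  define n0 where "n0 = n1 + n2 + d + nat \<lceil>?\<kappa> * real d / \<delta>\<rceil> + 1"
  have a01: "0 \<le> ?a r" "?a r \<le> 1"
  proof -
    have "0 \<le> collapse_prob d c (Suc r) \<and> collapse_prob d c (Suc r) \<le> 1"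
    proof -
      have "0 \<le> 1 - collapse_prob d c (Suc r) \<and> 1 - collapse_prob d c (Suc r) \<le> 1"
        unfolding prob_core_law_pos[OF c, symmetric] by (rule expectation_01) auto
      then show ?thesis by linarith
    qed
    then show "0 \<le> ?a r" "?a r \<le> 1" by (auto intro!: power_le_one simp del: collapse_prob.simps power_Suc)
  qed
  have "real (n choose d) * (excess d c ?t - \<epsilon>) \<le> EF d c n (\<lambda>X. real (dim (cycles X)))" if n: "n \<ge> n0" for n
  proof -
    have nb: "n > 0" "n \<ge> n1" "n \<ge> n2" "d \<le> n" "?\<kappa> * real d / \<delta> \<le> real n" using n unfolding n0_def by linarith+
    let ?N = "real (n choose d)"
    have "?\<kappa> * real d \<le> real n * \<delta>" using nb(5) \<delta> by (simp only: pos_divide_le_eq)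
    then have dn: "?\<kappa> * (real d / real n) \<le> \<delta>"
      using nb(1) by (simp only: times_divide_eq_right[of ?\<kappa>] pos_divide_le_eq of_nat_0_less_iff mult.commute[of \<delta>])
    have "EF d c n (\<lambda>X. real (card {\<sigma> \<in> X. facets \<sigma> \<subseteq> core_faces n d r X}) - real (card (core_faces n d r X)))
      \<le> EF d c n (\<lambda>X. real (dim (cycles X)))"
    proof (rule EF_mono)
      fix X assume X: "X \<subseteq> cells n (Suc d)"
      have "card {\<sigma> \<in> X. facets \<sigma> \<subseteq> core_faces n d r X} \<le> dim (cycles X) + card (core_faces n d r X)"
        using X cells_finite by (intro dim_cycles_ge finite_subset[OF X]) (auto simp: core_faces_def)
      then show "real (card {\<sigma> \<in> X. facets \<sigma> \<subseteq> core_faces n d r X}) - real (card (core_faces n d r X)) \<le> real (dim (cycles X))"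
        by linarith
    qed
    then have 1: "real (n choose Suc d) * (c / real n) * (?a r - \<delta>) - ?N * (?b r + \<delta>) \<le> EF d c n (\<lambda>X. real (dim (cycles X)))"
      unfolding EF_diff using n1[OF nb(2)] n2[OF nb(3)] by linarith
    have "real (n choose Suc d) * (c / real n) = ?N * (?\<kappa> * (1 - real d / real n))"
      using expected_faces[OF c nb(4,1)] by (simp only: mult.commute)
    then have 2: "real (n choose Suc d) * (c / real n) * (?a r - \<delta>) - ?N * (?b r + \<delta>)
       = ?N * (?\<kappa> * (1 - real d / real n) * (?a r - \<delta>) - (?b r + \<delta>))"
      by (simp only: right_diff_distrib[of ?N] mult.assoc)
    have "?N * (excess d c ?t - \<epsilon>) \<le> ?N * (?\<kappa> * (1 - real d / real n) * (?a r - \<delta>) - (?b r + \<delta>))"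
    proof (intro mult_left_mono)
      have arith: "x - \<epsilon> \<le> K - (B + \<delta>)"
        if "u \<le> \<delta>" "v \<le> k" "K = A - u - v" "\<epsilon> = k + 3 * \<delta>" "x - \<delta> < A - B" for x k u v A B K
        using that by linarith
      have "?\<kappa> * (real d / real n) * ?a r \<le> \<delta>" using mult_mono[OF dn a01(2)] a01 \<delta> by simp
      moreover have "?\<kappa> * (1 - real d / real n) * \<delta> \<le> ?\<kappa> * \<delta>"
        using \<kappa> \<delta> by (intro mult_right_mono mult_left_le) auto
      moreover have "?\<kappa> * (1 - real d / real n) * (?a r - \<delta>) = ?\<kappa> * ?a r - ?\<kappa> * (real d / real n) * ?a r - ?\<kappa> * (1 - real d / real n) * \<delta>"
        by (simp only: right_diff_distrib left_diff_distrib mult_1_right)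
      moreover have "\<epsilon> = ?\<kappa> * \<delta> + 3 * \<delta>"
      proof -
        have "\<epsilon> = (?\<kappa> + 3) * \<delta>" using \<kappa> unfolding \<delta>_def by (subst times_divide_eq_right) simp
        then show ?thesis by (simp only: distrib_right)
      qed
      ultimately show "excess d c ?t - \<epsilon> \<le> ?\<kappa> * (1 - real d / real n) * (?a r - \<delta>) - (?b r + \<delta>)"
        using r by (rule arith)
    qed simp
    then show ?thesis using 1 2 by linarith
  qed
  then show ?thesis by blast
qed

section \<open>Concentration\<close>

text \<open>
  Chebyshev's inequality, with the variance bounded by the expected number of faces.
\<close>

lemma prob_far_from_mean_le:
  assumes c: "0 < c" "c \<le> real n" and \<delta>: "\<delta> > 0"
  shows "measure_pmf.prob (random_faces d c n) {X. \<delta> < \<bar>real (dim (cycles X)) - EF d c n (\<lambda>X. real (dim (cycles X)))\<bar>}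
    \<le> c / real n * real (n choose Suc d) / \<delta>\<^sup>2"
proof -
  let ?D = "\<lambda>X. real (dim (cycles X))"
  let ?\<mu> = "EF d c n ?D"
  have p: "0 \<le> c / real n" "c / real n \<le> 1" using c by (auto simp: divide_le_eq_1)
  have "measure_pmf.prob (random_faces d c n) {X. \<delta> < \<bar>?D X - ?\<mu>\<bar>} = EF d c n (indicator {X. \<delta> < \<bar>?D X - ?\<mu>\<bar>})"
    by simp
  also have "\<dots> \<le> EF d c n (\<lambda>X. (?D X - ?\<mu>)\<^sup>2 / \<delta>\<^sup>2)"
  proof (rule EF_mono)
    fix X
    have "\<delta>\<^sup>2 \<le> (?D X - ?\<mu>)\<^sup>2" if "\<delta> < \<bar>?D X - ?\<mu>\<bar>"
      using that \<delta> by (metis abs_le_square_iff abs_of_pos less_imp_le)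
    then show "indicator {X. \<delta> < \<bar>?D X - ?\<mu>\<bar>} X \<le> (?D X - ?\<mu>)\<^sup>2 / \<delta>\<^sup>2"
      using \<delta> by (auto simp: indicator_def)
  qed
  also have "\<dots> = EF d c n (\<lambda>X. (?D X - ?\<mu>)\<^sup>2) / \<delta>\<^sup>2" by simp
  also have "\<dots> \<le> (c / real n * real (card (cells n (Suc d)))) / \<delta>\<^sup>2"
  proof (rule divide_right_mono)
    show "EF d c n (\<lambda>X. (?D X - ?\<mu>)\<^sup>2) \<le> c / real n * real (card (cells n (Suc d)))"
      unfolding random_faces_def
      by (rule variance_random_subset_le[OF finite_cells p]) (rule dim_cycles_insert, rule finite_subset[OF _ finite_cells])
  qed simp
  finally show ?thesis by (simp only: card_cells)
qed

lemma prob_random_complex: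
  "measure_pmf.prob (random_complex d n (c / real n)) {Y. P (dim (top_homology d Y))}
    = measure_pmf.prob (random_faces d c n) {X. P (dim (cycles X))}"
proof -
  have cells: "{\<sigma>. \<sigma> \<subseteq> {..<n} \<and> card \<sigma> = d + 1} = cells n (Suc d)" by (simp add: cells_def)
  have f: "faces d ({\<sigma>. \<sigma> \<subseteq> {..<n} \<and> card \<sigma> \<le> d} \<union> {\<sigma>. \<sigma> \<subseteq> {..<n} \<and> card \<sigma> = d + 1 \<and> Q \<sigma>}) = {\<sigma> \<in> cells n (Suc d). Q \<sigma>}" for Q
    by (auto simp: faces_def cells_def)
  show ?thesis
    unfolding random_complex_def random_faces_def random_subset_def cells measure_map_pmf
    by (simp add: vimage_def top_homology_cycles f[unfolded Suc_eq_plus1[symmetric]])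
qed

theorem theorem1p3:
  fixes d :: nat and c :: real
  assumes "d \<ge> 2" and "c > c_star d"
  shows "let t = t_root d c;
             A = (\<lambda>n. real (n choose d) *
                   (c * t * (1 - t) ^ d + c / (real d + 1) * (1 - t) ^ (d + 1) - (1 - t)))
         in \<forall>\<epsilon>>0. (\<lambda>n. measure_pmf.prob (random_complex d n (c / real n))
              {Y. (1 - \<epsilon>) * A n \<le> real (dim (top_homology d Y)) \<and>
                  real (dim (top_homology d Y)) \<le> (1 + \<epsilon>) * A n}) \<longlonglongrightarrow> 1"
proof -
  define f where "f = excess d c (t_root d c)"
  have f: "f > 0" unfolding f_def by (rule excess_t_root_pos[OF assms])
  have c: "0 < c" using c_star_pos[OF assms(1)] assms(2) by simp
  have d1: "d \<ge> 1" using assms by simp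
  have main: "(\<lambda>n. measure_pmf.prob (random_complex d n (c / real n))
      {Y. (1 - \<epsilon>) * (real (n choose d) * f) \<le> real (dim (top_homology d Y)) \<and>
          real (dim (top_homology d Y)) \<le> (1 + \<epsilon>) * (real (n choose d) * f)}) \<longlonglongrightarrow> 1" if \<epsilon>: "\<epsilon> > 0" for \<epsilon>
  proof -
    define \<delta> where "\<delta> = \<epsilon> * f / 2"
    have \<delta>: "\<delta> > 0" using \<epsilon> f by (simp add: \<delta>_def)
    define \<kappa> where "\<kappa> = c / (real d + 1)"
    obtain n1 where n1: "\<And>n. n \<ge> n1 \<Longrightarrow> EF d c n (\<lambda>X. real (dim (cycles X))) \<le> real (n choose d) * (f + \<delta>)"
      using expected_dim_upper[OF assms \<delta>] unfolding f_def by blast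
    obtain n2 where n2: "\<And>n. n \<ge> n2 \<Longrightarrow> real (n choose d) * (f - \<delta>) \<le> EF d c n (\<lambda>X. real (dim (cycles X)))"
      using expected_dim_lower[OF d1 c \<delta>] unfolding f_def by blast
    define P where "P = (\<lambda>n. measure_pmf.prob (random_complex d n (c / real n))
      {Y. (1 - \<epsilon>) * (real (n choose d) * f) \<le> real (dim (top_homology d Y)) \<and>
          real (dim (top_homology d Y)) \<le> (1 + \<epsilon>) * (real (n choose d) * f)})"
    have low: "1 - \<kappa> * real d / \<delta>\<^sup>2 * inverse (real n) \<le> P n" if n: "n \<ge> n1 + n2 + d + nat \<lceil>c\<rceil> + 1" for n
    proof -
      have nb: "n \<ge> n1" "n \<ge> n2" "d \<le> n" "c \<le> real n" "0 < n" using n by linarith+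
      let ?N = "real (n choose d)" and ?D = "\<lambda>X. real (dim (cycles X))"
      \<comment> \<open>The error probability is of the order of the inverse of the number of cells, which has to grow.\<close>
      have N: "real n / real d \<le> ?N"
      proof -
        have "1 \<le> real n / real d" using nb d1 by simp
        then have "(real n / real d) ^ 1 \<le> (real n / real d) ^ d" using d1 by (intro power_increasing) auto
        also have "\<dots> \<le> ?N" using binomial_ge_n_over_k_pow_k[OF nb(3)] by simp
        finally show ?thesis by simp
      qed
      then have Npos: "?N > 0" using nb d1 by (smt (verit) divide_pos_pos of_nat_0_less_iff less_le_trans zero_less_one)
      let ?bad = "{X. ?N * \<delta> < \<bar>?D X - EF d c n ?D\<bar>}"
      have sub: "- ?bad \<subseteq> {X. (1 - \<epsilon>) * (?N * f) \<le> ?D X \<and> ?D X \<le> (1 + \<epsilon>) * (?N * f)}"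
      proof
        fix X assume "X \<in> - ?bad"
        then have "\<bar>?D X - EF d c n ?D\<bar> \<le> ?N * \<delta>" by simp
        moreover have "?N * (f - \<delta>) - ?N * \<delta> = (1 - \<epsilon>) * (?N * f)" "?N * (f + \<delta>) + ?N * \<delta> = (1 + \<epsilon>) * (?N * f)"
          by (simp_all add: \<delta>_def algebra_simps)
        ultimately show "X \<in> {X. (1 - \<epsilon>) * (?N * f) \<le> ?D X \<and> ?D X \<le> (1 + \<epsilon>) * (?N * f)}"
          using n1[OF nb(1)] n2[OF nb(2)] by auto
      qed
      have "measure_pmf.prob (random_faces d c n) ?bad \<le> c / real n * real (n choose Suc d) / (?N * \<delta>)\<^sup>2"
        using Npos \<delta> by (intro prob_far_from_mean_le c nb) simp
      also have "\<dots> = ?N * (\<kappa> * (1 - real d / real n)) / (?N * \<delta>)\<^sup>2"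
        unfolding expected_faces[OF c nb(3,5)] \<kappa>_def ..
      also have "\<dots> \<le> ?N * (\<kappa> * 1) / (?N * \<delta>)\<^sup>2"
        using c Npos by (intro divide_right_mono mult_left_mono) (auto simp: \<kappa>_def)
      also have "\<dots> = \<kappa> / \<delta>\<^sup>2 * (1 / ?N)" using Npos by (simp add: power2_eq_square field_simps)
      also have "\<dots> \<le> \<kappa> / \<delta>\<^sup>2 * (1 / (real n / real d))"
        using N Npos nb d1 c by (intro mult_left_mono divide_left_mono) (auto simp: \<kappa>_def)
      also have "\<dots> = \<kappa> * real d / \<delta>\<^sup>2 * inverse (real n)" by (simp add: field_simps)
      finally have bad: "measure_pmf.prob (random_faces d c n) ?bad \<le> \<kappa> * real d / \<delta>\<^sup>2 * inverse (real n)" .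
      have "P n = measure_pmf.prob (random_faces d c n) {X. (1 - \<epsilon>) * (?N * f) \<le> ?D X \<and> ?D X \<le> (1 + \<epsilon>) * (?N * f)}"
        unfolding P_def by (rule prob_random_complex[of d n c "\<lambda>k. (1 - \<epsilon>) * (?N * f) \<le> real k \<and> real k \<le> (1 + \<epsilon>) * (?N * f)"])
      moreover have "measure_pmf.prob (random_faces d c n) (- ?bad)
          \<le> measure_pmf.prob (random_faces d c n) {X. (1 - \<epsilon>) * (?N * f) \<le> ?D X \<and> ?D X \<le> (1 + \<epsilon>) * (?N * f)}"
        by (rule measure_pmf.finite_measure_mono[OF sub]) simp
      moreover have "measure_pmf.prob (random_faces d c n) (- ?bad) = 1 - measure_pmf.prob (random_faces d c n) ?bad"
        using measure_pmf.prob_compl[of ?bad "random_faces d c n"] by (simp add: Compl_eq_Diff_UNIV)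
      ultimately show ?thesis using bad by linarith
    qed
    have lim: "(\<lambda>n. 1 - \<kappa> * real d / \<delta>\<^sup>2 * inverse (real n)) \<longlonglongrightarrow> 1 - \<kappa> * real d / \<delta>\<^sup>2 * 0"
      by (intro tendsto_intros lim_inverse_n)
    have "P \<longlonglongrightarrow> 1"
    proof (rule tendsto_sandwich)
      show "\<forall>\<^sub>F n in sequentially. 1 - \<kappa> * real d / \<delta>\<^sup>2 * inverse (real n) \<le> P n"
        using low unfolding eventually_sequentially by blast
      show "\<forall>\<^sub>F n in sequentially. P n \<le> 1" unfolding P_def by simp
      show "(\<lambda>n. 1 - \<kappa> * real d / \<delta>\<^sup>2 * inverse (real n)) \<longlonglongrightarrow> 1" using lim by simp
    qed simp
    then show ?thesis unfolding P_def .
  qed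
  show ?thesis unfolding Let_def using main unfolding f_def excess_def by blast
qed

end
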